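(* Let $\mu$ be a finite positive Borel measure on $\overline{\mathbb D}$ and $\Psi_1,\Psi_2$ Orlicz functions. 1) If the identity maps $H^{\Psi_1}$ compactly into $L^{\Psi_2}(\mu)$, then for every $A>0$, $\rho_\mu(h)=o\Big(\dfrac{1}{\Psi_2(A\Psi_1^{-1}(1/h))}\Big)$ as $h\to0$. 2) If $\mu(\mathbb T)=0$ and for every $A>0$, $K_\mu(h)=o\Big(\dfrac{1/h}{\Psi_2(A\Psi_1^{-1}(1/h))}\Big)$ as $h\to0$, then the identity maps $H^{\Psi_1}$ compactly into $L^{\Psi_2}(\mu)$. 3) If $\Psi_1=\Psi_2=\Psi$ satisfies $\nabla_0$, then the following are equivalent: the identity $H^\Psi\to L^\Psi(\mu)$ is compact; the condition in 1) holds for every $A>0$; the condition on $K_\mu$ in 2) holds for every $A>0$.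
   Context: An Orlicz function is a continuous, strictly convex, increasing $\Psi\colon[0,\infty)\to[0,\infty)$ with $\Psi(0)=0$ and $\Psi(x)/x\to\infty$. $L^\Psi(\nu)$ with Luxemburg norm $\inf\{C>0:\int\Psi(|f|/C)\,d\nu\le1\}$. $H^\Psi$ = analytic $f$ on $\mathbb D$ with $\sup_{r<1}\|f(re^{i\cdot})\|_{L^\Psi(m)}<\infty$ ($m$ normalized measure on $\mathbb T$), with boundary function $f^*$; an $f\in H^\Psi$ is regarded as a function on $\overline{\mathbb D}$ equal to $f$ on $\mathbb D$ and $f^*$ on $\mathbb T$. $W(\xi,h)=\{z\in\overline{\mathbb D}:1-h<|z|\le1,\ |\arg(z\bar\xi)|<h\}$; $\rho_\mu(h)=\sup_{\xi\in\mathbb T}\mu(W(\xi,h))$; $K_\mu(h)=\sup_{0<t\le h}\rho_\mu(t)/t$. $\Psi$ satisfies $\nabla_0$ if there are $x_0>0$ and $C\ge1$ with $\frac{\Psi(2x)}{\Psi(x)}\le\frac{\Psi(2Cy)}{\Psi(y)}$ for all $x_0\le x\le y$. *)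

theory Defs
  imports "HOL-Analysis.Analysis" "HOL-Probability.Probability" "HOL-Library.Landau_Symbols"
begin

definition strictly_convex_on :: "real set \<Rightarrow> (real \<Rightarrow> real) \<Rightarrow> bool" where
  "strictly_convex_on S f \<longleftrightarrow> convex S \<and>
     (\<forall>x\<in>S. \<forall>y\<in>S. \<forall>u. x \<noteq> y \<and> 0 < u \<and> u < 1 \<longrightarrow>
        f (u * x + (1 - u) * y) < u * f x + (1 - u) * f y)"

definition orlicz_function :: "(real \<Rightarrow> real) \<Rightarrow> bool" where
  "orlicz_function \<Psi> \<longleftrightarrow>
     continuous_on {0..} \<Psi> \<and>
     strictly_convex_on {0..} \<Psi> \<and>
     strict_mono_on {0..} \<Psi> \<and>
     (\<forall>x\<ge>0. \<Psi> x \<ge> 0) \<and>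
     \<Psi> 0 = 0 \<and>
     filterlim (\<lambda>x. \<Psi> x / x) at_top at_top"

definition orlicz_inv :: "(real \<Rightarrow> real) \<Rightarrow> real \<Rightarrow> real" where
  "orlicz_inv \<Psi> y = (THE x. 0 \<le> x \<and> \<Psi> x = y)"

definition nabla0 :: "(real \<Rightarrow> real) \<Rightarrow> bool" where
  "nabla0 \<Psi> \<longleftrightarrow> (\<exists>x0>0. \<exists>C\<ge>1. \<forall>x y. x0 \<le> x \<and> x \<le> y \<longrightarrow>
       \<Psi> (2 * x) / \<Psi> x \<le> \<Psi> (2 * C * y) / \<Psi> y)"

definition orlicz_space :: "(real \<Rightarrow> real) \<Rightarrow> 'a measure \<Rightarrow> ('a \<Rightarrow> complex) set" where
  "orlicz_space \<Psi> \<nu> = {f. f \<in> borel_measurable \<nu> \<and>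
      (\<exists>C>0. (\<integral>\<^sup>+ x. ennreal (\<Psi> (cmod (f x) / C)) \<partial>\<nu>) \<le> 1)}"

definition lux_norm :: "(real \<Rightarrow> real) \<Rightarrow> 'a measure \<Rightarrow> ('a \<Rightarrow> complex) \<Rightarrow> real" where
  "lux_norm \<Psi> \<nu> f = Inf {C. C > 0 \<and> (\<integral>\<^sup>+ x. ennreal (\<Psi> (cmod (f x) / C)) \<partial>\<nu>) \<le> 1}"

text \<open>Normalized Lebesgue measure m on the circle, parametrized by t in [0,2 pi]
  via t \<mapsto> e^{it}.\<close>
definition circle_measure :: "real measure" where
  "circle_measure = uniform_measure lborel {0..2*pi}"

definition hardy_orlicz :: "(real \<Rightarrow> real) \<Rightarrow> (complex \<Rightarrow> complex) set" where
  "hardy_orlicz \<Psi> = {f. f holomorphic_on ball 0 1 \<and>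
      (\<forall>r\<in>{0..<1}. (\<lambda>t. f (of_real r * cis t)) \<in> orlicz_space \<Psi> circle_measure) \<and>
      bdd_above ((\<lambda>r. lux_norm \<Psi> circle_measure (\<lambda>t. f (of_real r * cis t))) ` {0..<1})}"

definition hardy_norm :: "(real \<Rightarrow> real) \<Rightarrow> (complex \<Rightarrow> complex) \<Rightarrow> real" where
  "hardy_norm \<Psi> f = (SUP r\<in>{0..<1}. lux_norm \<Psi> circle_measure (\<lambda>t. f (of_real r * cis t)))"

text \<open>An analytic function on the disc regarded as a function on the closed disc:
  f inside, its radial limit f^* on the circle (0 where the radial limit does not exist;
  for f in H^Psi the radial limit exists m-a.e.).\<close>
definition boundary_ext :: "(complex \<Rightarrow> complex) \<Rightarrow> complex \<Rightarrow> complex" where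
  "boundary_ext f z =
     (if cmod z < 1 then f z
      else if (\<exists>l. ((\<lambda>r. f (of_real r * z)) \<longlongrightarrow> l) (at_left 1))
           then Lim (at_left 1) (\<lambda>r. f (of_real r * z)) else 0)"

definition compact_embedding ::
    "(real \<Rightarrow> real) \<Rightarrow> (real \<Rightarrow> real) \<Rightarrow> complex measure \<Rightarrow> bool" where
  "compact_embedding \<Psi>1 \<Psi>2 \<mu> \<longleftrightarrow>
     (\<forall>f\<in>hardy_orlicz \<Psi>1. boundary_ext f \<in> orlicz_space \<Psi>2 \<mu>) \<and>
     (\<forall>F::nat \<Rightarrow> complex \<Rightarrow> complex. (\<forall>n. F n \<in> hardy_orlicz \<Psi>1 \<and> hardy_norm \<Psi>1 (F n) \<le> 1) \<longrightarrow>
        (\<exists>s g. strict_mono s \<and> g \<in> orlicz_space \<Psi>2 \<mu> \<and>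
           (\<lambda>k. lux_norm \<Psi>2 \<mu> (\<lambda>z. boundary_ext (F (s k)) z - g z)) \<longlonglongrightarrow> 0))"

definition carleson_window :: "complex \<Rightarrow> real \<Rightarrow> complex set" where
  "carleson_window \<xi> h = {z. 1 - h < cmod z \<and> cmod z \<le> 1 \<and> \<bar>Arg (z * cnj \<xi>)\<bar> < h}"

definition rho_mu :: "complex measure \<Rightarrow> real \<Rightarrow> real" where
  "rho_mu \<mu> h = (SUP \<xi>\<in>sphere 0 1. measure \<mu> (carleson_window \<xi> h))"

text \<open>K_mu, valued in the extended reals (the supremum may be infinite).\<close>
definition K_mu :: "complex measure \<Rightarrow> real \<Rightarrow> ereal" where
  "K_mu \<mu> h = (SUP t\<in>{0<..h}. ereal (rho_mu \<mu> t / t))"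

end

theory Submission
  imports Defs "HOL-Complex_Analysis.Complex_Analysis"
begin

text \<open>Necessity: the functions \<open>x * (h / (1 - (1 - h) * cnj \<xi> * z))\<^sup>2\<close> with \<open>\<Psi>1 x = 1 / h\<close> lie in the unit
  ball of the Hardy-Orlicz space and have size at least \<open>x / 9\<close> on the window at \<open>\<xi>\<close>; a convergent
  subsequence with \<open>h\<close> tending to 0 forces the windows to have small measure.

  Sufficiency: \<open>sqrt (cmod f)\<close> is dominated by the Poisson integral of its boundary values, so where
  \<open>f\<close> exceeds a level \<open>s\<close> some dyadic arc nearby carries an average of \<open>sqrt (cmod f)\<close> of order \<open>sqrt s\<close>.
  The maximal such arcs are disjoint and, if \<open>f\<close> is in the unit ball, have length at most of order
  \<open>1 / \<Psi>1 (c * s)\<close>.  Thus only windows of that size enter, and summing over \<open>s = 4 ^ k\<close> shows that the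
  modular over the set where \<open>f\<close> is large is uniformly small.  Using the square root keeps the sum
  geometric even when \<open>\<Psi>1\<close> is nearly linear.  Montel's theorem and dominated convergence handle the
  bounded part.

  Under the \<open>nabla0\<close> condition the ratio \<open>\<Psi> (A * x) / \<Psi> x\<close> is dominated by \<open>\<Psi> (B * y) / \<Psi> y\<close> for
  \<open>x \<le> y\<close>, which upgrades the bound on \<open>rho_mu\<close> to one on \<open>K_mu\<close>.\<close>

section \<open>Orlicz functions and Luxemburg norms\<close>

text \<open>Boundary values are kept out of all estimates. Sufficiency is proved for functions
  continuous on the closed disc; a general analytic function is reached through its dilates, whose
  modulars on the unit circle are the bounded modulars of its slices, and Fatou's lemma on the open
  disc. Since the circle is a null set there, \<open>boundary_ext f\<close> agrees almost everywhere
  with \<open>f\<close> cut off to 0 on the circle, and only its measurability has to be checked. In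
  the \<open>nabla0\<close> case nullity of the circle is itself derived from the bound on
  \<open>rho_mu\<close> with A = 1. The test functions for necessity are continuous up to the
  circle, so their radial limits are their values.

  The second obstacle is that neither \<Psi>1 nor \<Psi>2 is assumed to satisfy a doubling
  condition, so constants cannot be pulled out of them. Convexity only allows \<Psi> (u * x) <= u *
  \<Psi> x for u <= 1. All remaining constants, and the accuracy 1 / \<epsilon> that compactness
  asks for, are absorbed by the freedom to choose A in the hypothesis.\<close>

context
  fixes \<Psi> :: "real \<Rightarrow> real"
  assumes orl: "orlicz_function \<Psi>"
begin

lemma orlicz_zero [simp]: "\<Psi> 0 = 0"
  and orlicz_nonneg: "0 \<le> x \<Longrightarrow> 0 \<le> \<Psi> x"
  and orlicz_continuous: "continuous_on {0..} \<Psi>"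
  and orlicz_strict_mono: "0 \<le> x \<Longrightarrow> x < y \<Longrightarrow> \<Psi> x < \<Psi> y"
  using orl unfolding orlicz_function_def strict_mono_on_def by auto

lemma orlicz_mono: "0 \<le> x \<Longrightarrow> x \<le> y \<Longrightarrow> \<Psi> x \<le> \<Psi> y"
  using orlicz_strict_mono[of x y] by (cases "x = y") auto

lemma orlicz_le_cancel: "0 \<le> x \<Longrightarrow> 0 \<le> y \<Longrightarrow> \<Psi> x \<le> \<Psi> y \<longleftrightarrow> x \<le> y"
  using orlicz_strict_mono[of y x] orlicz_mono[of x y] by linarith

lemma orlicz_pos: "0 < x \<Longrightarrow> 0 < \<Psi> x"
  using orlicz_strict_mono[of 0 x] by simp

lemma orlicz_convex:
  assumes "0 \<le> u" "u \<le> 1" "0 \<le> x" "0 \<le> y"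
  shows "\<Psi> (u * x + (1 - u) * y) \<le> u * \<Psi> x + (1 - u) * \<Psi> y"
proof (cases "x = y \<or> u = 0 \<or> u = 1")
  case True
  then show ?thesis by (auto simp: algebra_simps)
next
  case False
  then show ?thesis using orl assms
    unfolding orlicz_function_def strictly_convex_on_def by (auto intro!: less_imp_le)
qed

lemma orlicz_scale_le: "0 \<le> u \<Longrightarrow> u \<le> 1 \<Longrightarrow> 0 \<le> x \<Longrightarrow> \<Psi> (u * x) \<le> u * \<Psi> x"
  using orlicz_convex[of u x 0] by simp

lemma orlicz_scale_ge:
  assumes "1 \<le> k" "0 \<le> x" shows "k * \<Psi> x \<le> \<Psi> (k * x)"
  using orlicz_scale_le[of "1 / k" "k * x"] assms by (simp add: field_simps)

lemma orlicz_midpoint: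
  assumes "0 \<le> x" "0 \<le> y" shows "\<Psi> ((x + y) / 2) \<le> (\<Psi> x + \<Psi> y) / 2"
proof -
  have "(x + y) / 2 = 1 / 2 * x + (1 - 1 / 2) * y" by (simp add: field_simps)
  then show ?thesis using orlicz_convex[of "1 / 2" x y] assms by (simp add: field_simps)
qed

text \<open>Superlinear growth is used through this affine bound. It supplies the right end point
  for the intermediate value theorem, the smallness of windows at high levels, and an L1 bound from
  a modular bound.\<close>

lemma le_orlicz_plus_const: obtains x0 where "0 \<le> x0" "\<And>x. 0 \<le> x \<Longrightarrow> x \<le> x0 + \<Psi> x"
proof -
  have "eventually (\<lambda>x. 1 \<le> \<Psi> x / x) at_top"
    using orl unfolding orlicz_function_def filterlim_at_top by blast
  then obtain N where N: "\<And>x. N \<le> x \<Longrightarrow> 1 \<le> \<Psi> x / x" unfolding eventually_at_top_linorder by blast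
  show ?thesis
  proof (rule that[of "max N 1"])
    fix x :: real assume x: "0 \<le> x"
    show "x \<le> max N 1 + \<Psi> x"
    proof (cases "max N 1 \<le> x")
      case True
      then have "1 \<le> \<Psi> x / x" "0 < x" using N[of x] by auto
      then have "x \<le> \<Psi> x" by (simp only: le_divide_eq_1_pos)
      then show ?thesis by simp
    next
      case False
      then show ?thesis using orlicz_nonneg[OF x] by linarith
    qed
  qed simp
qed

lemma orlicz_inv_ex1: "0 \<le> y \<Longrightarrow> \<exists>!x. 0 \<le> x \<and> \<Psi> x = y"
proof -
  assume y: "0 \<le> y"
  obtain x0 where x0: "0 \<le> x0" "\<And>x. 0 \<le> x \<Longrightarrow> x \<le> x0 + \<Psi> x" using le_orlicz_plus_const by blast
  have "\<exists>x\<ge>0. x \<le> x0 + y \<and> \<Psi> x = y"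
  proof (rule IVT')
    show "y \<le> \<Psi> (x0 + y)" using x0(2)[of "x0 + y"] x0(1) y by simp
    show "continuous_on {0..x0 + y} \<Psi>" by (rule continuous_on_subset[OF orlicz_continuous]) auto
  qed (use y x0 in auto)
  then obtain x where "0 \<le> x" "\<Psi> x = y" by blast
  then show ?thesis
  proof (intro ex1I[of _ x] conjI)
    fix x' assume "0 \<le> x' \<and> \<Psi> x' = y"
    with \<open>0 \<le> x\<close> \<open>\<Psi> x = y\<close> show "x' = x"
      using orlicz_le_cancel[of x x'] orlicz_le_cancel[of x' x] by auto
  qed auto
qed

lemma orlicz_inv_nonneg: "0 \<le> y \<Longrightarrow> 0 \<le> orlicz_inv \<Psi> y"
  and orlicz_orlicz_inv: "0 \<le> y \<Longrightarrow> \<Psi> (orlicz_inv \<Psi> y) = y"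
  using theI'[OF orlicz_inv_ex1] unfolding orlicz_inv_def by auto

lemma orlicz_inv_pos: "0 < y \<Longrightarrow> 0 < orlicz_inv \<Psi> y"
  using orlicz_inv_nonneg[of y] orlicz_orlicz_inv[of y] by (cases "orlicz_inv \<Psi> y = 0") auto

lemma le_orlicz_inv_iff: "0 \<le> x \<Longrightarrow> 0 \<le> y \<Longrightarrow> x \<le> orlicz_inv \<Psi> y \<longleftrightarrow> \<Psi> x \<le> y"
  using orlicz_le_cancel[of x "orlicz_inv \<Psi> y"] orlicz_inv_nonneg[of y] orlicz_orlicz_inv[of y] by simp

lemma orlicz_inv_mono: "0 \<le> x \<Longrightarrow> x \<le> y \<Longrightarrow> orlicz_inv \<Psi> x \<le> orlicz_inv \<Psi> y"
  using le_orlicz_inv_iff[of "orlicz_inv \<Psi> x" y] orlicz_inv_nonneg[of x] orlicz_orlicz_inv[of x] by simp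

lemma continuous_on_orlicz:
  assumes "continuous_on S f" "\<And>x. x \<in> S \<Longrightarrow> 0 \<le> f x"
  shows "continuous_on S (\<lambda>x. \<Psi> (f x))"
  by (rule continuous_on_compose2[OF orlicz_continuous assms(1)]) (use assms(2) in auto)

lemma borel_measurable_orlicz:
  assumes "f \<in> borel_measurable M" "\<And>x. 0 \<le> f x"
  shows "(\<lambda>x. \<Psi> (f x)) \<in> borel_measurable M"
proof -
  have "(\<lambda>t. \<Psi> (max 0 t)) \<in> borel_measurable borel"
    by (intro borel_measurable_continuous_onI continuous_on_orlicz continuous_intros) auto
  from measurable_compose[OF assms(1) this] show ?thesis using assms(2) by (simp add: max_absorb2)
qed

lemma borel_measurable_modular:
  assumes "f \<in> borel_measurable M" "0 < C"
  shows "(\<lambda>x. ennreal (\<Psi> (cmod (f x) / C))) \<in> borel_measurable M"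
  using assms by (intro measurable_compose[OF borel_measurable_orlicz measurable_ennreal]) auto

section \<open>Modulars and the Luxemburg norm\<close>

lemma orlicz_modular_mono:
  assumes "0 < C" "C \<le> D"
  shows "(\<integral>\<^sup>+ x. ennreal (\<Psi> (cmod (f x) / D)) \<partial>M) \<le> (\<integral>\<^sup>+ x. ennreal (\<Psi> (cmod (f x) / C)) \<partial>M)"
  by (intro nn_integral_mono ennreal_leI orlicz_mono divide_left_mono divide_nonneg_nonneg) (use assms in auto)

lemma lux_norm_le:
  assumes "0 < C" "(\<integral>\<^sup>+ x. ennreal (\<Psi> (cmod (f x) / C)) \<partial>M) \<le> 1"
  shows "lux_norm \<Psi> M f \<le> C"
  unfolding lux_norm_def by (rule cInf_lower) (use assms in \<open>auto intro!: bdd_belowI[of _ 0]\<close>)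

lemma lux_norm_nonneg:
  assumes "f \<in> orlicz_space \<Psi> M" shows "0 \<le> lux_norm \<Psi> M f"
  unfolding lux_norm_def by (rule cInf_greatest) (use assms in \<open>auto simp: orlicz_space_def\<close>)

text \<open>Strictness gives an admissible constant D below C, and the modular decreases in the
  constant, so the infimum itself is never tested.\<close>

lemma modular_le_1_of_lux_norm_less:
  assumes "f \<in> orlicz_space \<Psi> M" "lux_norm \<Psi> M f < C"
  shows "(\<integral>\<^sup>+ x. ennreal (\<Psi> (cmod (f x) / C)) \<partial>M) \<le> 1"
proof -
  have "{C. C > 0 \<and> (\<integral>\<^sup>+ x. ennreal (\<Psi> (cmod (f x) / C)) \<partial>M) \<le> 1} \<noteq> {}"
    using assms(1) by (auto simp: orlicz_space_def)
  from cInf_lessD[OF this, of C] assms(2) obtain D where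
    "0 < D" "(\<integral>\<^sup>+ x. ennreal (\<Psi> (cmod (f x) / D)) \<partial>M) \<le> 1" "D < C"
    unfolding lux_norm_def by auto
  then show ?thesis using orlicz_modular_mono[of D C M f] by auto
qed

text \<open>Midpoint convexity makes the constant 2 * C work. This modular form does the work of a
  triangle inequality for the norm.\<close>

lemma modular_diff_le_1:
  assumes f: "f \<in> borel_measurable M" and g: "g \<in> borel_measurable M" and C: "0 < C"
    and mf: "(\<integral>\<^sup>+ x. ennreal (\<Psi> (cmod (f x) / C)) \<partial>M) \<le> 1"
    and mg: "(\<integral>\<^sup>+ x. ennreal (\<Psi> (cmod (g x) / C)) \<partial>M) \<le> 1"
  shows "(\<integral>\<^sup>+ x. ennreal (\<Psi> (cmod (f x - g x) / (2 * C))) \<partial>M) \<le> 1"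
proof -
  have "(\<integral>\<^sup>+ x. ennreal (\<Psi> (cmod (f x - g x) / (2 * C))) \<partial>M)
      \<le> (\<integral>\<^sup>+ x. ennreal (1 / 2) * ennreal (\<Psi> (cmod (f x) / C)) + ennreal (1 / 2) * ennreal (\<Psi> (cmod (g x) / C)) \<partial>M)"
  proof (rule nn_integral_mono)
    fix x
    have "\<Psi> (cmod (f x - g x) / (2 * C)) \<le> \<Psi> ((cmod (f x) / C + cmod (g x) / C) / 2)"
      using norm_triangle_ineq4[of "f x" "g x"] C by (intro orlicz_mono) (auto simp: field_simps)
    also have "\<dots> \<le> (\<Psi> (cmod (f x) / C) + \<Psi> (cmod (g x) / C)) / 2"
      by (rule orlicz_midpoint) (use C in auto)
    also have "\<dots> = 1 / 2 * \<Psi> (cmod (f x) / C) + 1 / 2 * \<Psi> (cmod (g x) / C)" by simp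
    finally have "ennreal (\<Psi> (cmod (f x - g x) / (2 * C)))
        \<le> ennreal (1 / 2 * \<Psi> (cmod (f x) / C) + 1 / 2 * \<Psi> (cmod (g x) / C))" by (rule ennreal_leI)
    also have "\<dots> = ennreal (1 / 2) * ennreal (\<Psi> (cmod (f x) / C)) + ennreal (1 / 2) * ennreal (\<Psi> (cmod (g x) / C))"
      using C orlicz_nonneg[of "cmod (f x) / C"] orlicz_nonneg[of "cmod (g x) / C"]
      by (simp only: ennreal_plus ennreal_mult mult_nonneg_nonneg zero_le_divide_1_iff zero_le_numeral divide_nonneg_nonneg norm_ge_zero less_imp_le)
    finally show "ennreal (\<Psi> (cmod (f x - g x) / (2 * C)))
        \<le> ennreal (1 / 2) * ennreal (\<Psi> (cmod (f x) / C)) + ennreal (1 / 2) * ennreal (\<Psi> (cmod (g x) / C))" .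
  qed
  also have "\<dots> = ennreal (1 / 2) * (\<integral>\<^sup>+ x. ennreal (\<Psi> (cmod (f x) / C)) \<partial>M)
      + ennreal (1 / 2) * (\<integral>\<^sup>+ x. ennreal (\<Psi> (cmod (g x) / C)) \<partial>M)"
    using borel_measurable_modular[OF f C] borel_measurable_modular[OF g C]
    by (simp add: nn_integral_add nn_integral_cmult)
  also have "\<dots> \<le> ennreal (1 / 2) * 1 + ennreal (1 / 2) * 1"
    by (intro add_mono mult_left_mono mf mg) auto
  also have "\<dots> = 1" by (simp only: mult_1_right, subst ennreal_plus[symmetric]) auto
  finally show ?thesis .
qed

lemma orlicz_space_diff:
  assumes f: "f \<in> orlicz_space \<Psi> M" and g: "g \<in> orlicz_space \<Psi> M"
  shows "(\<lambda>x. f x - g x) \<in> orlicz_space \<Psi> M"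
proof -
  obtain C D where C: "0 < C" "(\<integral>\<^sup>+ x. ennreal (\<Psi> (cmod (f x) / C)) \<partial>M) \<le> 1"
    and D: "0 < D" "(\<integral>\<^sup>+ x. ennreal (\<Psi> (cmod (g x) / D)) \<partial>M) \<le> 1"
    and m: "f \<in> borel_measurable M" "g \<in> borel_measurable M"
    using f g by (auto simp: orlicz_space_def)
  have "(\<integral>\<^sup>+ x. ennreal (\<Psi> (cmod (f x) / max C D)) \<partial>M) \<le> 1"
    "(\<integral>\<^sup>+ x. ennreal (\<Psi> (cmod (g x) / max C D)) \<partial>M) \<le> 1"
    using orlicz_modular_mono[of C "max C D" M f] orlicz_modular_mono[of D "max C D" M g] C D by auto
  from modular_diff_le_1[OF m _ this] C(1) m show ?thesis
    unfolding orlicz_space_def by (auto intro!: exI[of _ "2 * max C D"])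
qed

text \<open>A finite modular I suffices: enlarging C by the factor 1 + I multiplies the modular by
  at most 1 / (1 + I), by convexity, and I / (1 + I) <= 1.\<close>

lemma orlicz_spaceI:
  assumes f: "f \<in> borel_measurable M" and C: "0 < C"
    and fin: "(\<integral>\<^sup>+ x. ennreal (\<Psi> (cmod (f x) / C)) \<partial>M) < \<infinity>"
  shows "f \<in> orlicz_space \<Psi> M"
proof -
  obtain I where I: "(\<integral>\<^sup>+ x. ennreal (\<Psi> (cmod (f x) / C)) \<partial>M) = ennreal I" "0 \<le> I"
    using fin by (cases "\<integral>\<^sup>+ x. ennreal (\<Psi> (cmod (f x) / C)) \<partial>M") auto
  have "(\<integral>\<^sup>+ x. ennreal (\<Psi> (cmod (f x) / (C * (1 + I)))) \<partial>M)
      \<le> (\<integral>\<^sup>+ x. ennreal (1 / (1 + I)) * ennreal (\<Psi> (cmod (f x) / C)) \<partial>M)"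
  proof (rule nn_integral_mono)
    fix x
    have "\<Psi> (1 / (1 + I) * (cmod (f x) / C)) \<le> 1 / (1 + I) * \<Psi> (cmod (f x) / C)"
      using I C by (intro orlicz_scale_le) auto
    then have "ennreal (\<Psi> (cmod (f x) / (C * (1 + I)))) \<le> ennreal (1 / (1 + I) * \<Psi> (cmod (f x) / C))"
      by (intro ennreal_leI) (simp add: mult.commute)
    also have "\<dots> = ennreal (1 / (1 + I)) * ennreal (\<Psi> (cmod (f x) / C))"
      using I C by (intro ennreal_mult orlicz_nonneg) auto
    finally show "ennreal (\<Psi> (cmod (f x) / (C * (1 + I)))) \<le> ennreal (1 / (1 + I)) * ennreal (\<Psi> (cmod (f x) / C))" .
  qed
  also have "\<dots> = ennreal (1 / (1 + I)) * ennreal I"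
    using borel_measurable_modular[OF f C] I(1) by (simp add: nn_integral_cmult)
  also have "\<dots> = ennreal (1 / (1 + I) * I)" using I by (intro ennreal_mult[symmetric]) auto
  also have "\<dots> \<le> 1" using I by (subst ennreal_le_1) (simp add: field_simps)
  finally show ?thesis using f C I unfolding orlicz_space_def by (auto intro!: exI[of _ "C * (1 + I)"] mult_pos_pos)
qed

section \<open>Consequences of the \<open>nabla0\<close> condition\<close>

text \<open>The scale factors telescope because \<open>(2 * C) ^ n * y\<close> dominates \<open>2 ^ n * x\<close>.\<close>

lemma nabla0_iterate:
  assumes "nabla0 \<Psi>"
  obtains x0 C where "0 < x0" "1 \<le> C"
    "\<And>n x y. x0 \<le> x \<Longrightarrow> x \<le> y \<Longrightarrow> \<Psi> (2 ^ n * x) / \<Psi> x \<le> \<Psi> ((2 * C) ^ n * y) / \<Psi> y"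
proof -
  obtain x0 C where x0: "0 < x0" and C: "1 \<le> C"
    and N: "\<And>x y. x0 \<le> x \<Longrightarrow> x \<le> y \<Longrightarrow> \<Psi> (2 * x) / \<Psi> x \<le> \<Psi> (2 * C * y) / \<Psi> y"
    using assms unfolding nabla0_def by blast
  have "\<Psi> (2 ^ n * x) / \<Psi> x \<le> \<Psi> ((2 * C) ^ n * y) / \<Psi> y" if xy: "x0 \<le> x" "x \<le> y" for n x y
  proof (induction n)
    case 0
    have "0 < \<Psi> x" "0 < \<Psi> y" using orlicz_pos x0 xy by auto
    then show ?case by simp
  next
    case (Suc n)
    let ?u = "2 ^ n * x" and ?v = "(2 * C) ^ n * y"
    have "?u \<le> ?v" using C x0 xy by (intro mult_mono power_mono) auto
    moreover have "x0 \<le> ?u" using mult_mono[of 1 "2 ^ n" x0 x] x0 xy by simp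
    ultimately have 1: "\<Psi> (2 * ?u) / \<Psi> ?u \<le> \<Psi> (2 * C * ?v) / \<Psi> ?v" by (intro N)
    have pos: "0 < \<Psi> ?u" "0 < \<Psi> ?v" "0 < \<Psi> x" "0 < \<Psi> y" "0 \<le> \<Psi> (2 * C * ?v)"
      using x0 xy C by (auto intro!: orlicz_pos orlicz_nonneg)
    have "\<Psi> (2 * ?u) / \<Psi> ?u * (\<Psi> ?u / \<Psi> x) \<le> \<Psi> (2 * C * ?v) / \<Psi> ?v * (\<Psi> ?v / \<Psi> y)"
      by (intro mult_mono 1 Suc) (use pos in auto)
    then show ?case using pos by (simp add: mult.assoc)
  qed
  then show ?thesis using that x0 C by blast
qed

text \<open>Choosing n with A < 2 ^ n turns the iterated doubling comparison into one for the factor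
  A, at the price of B = (2 * C) ^ n on the right; B depends on A but not on x and y.\<close>

lemma nabla0_ratio:
  assumes "nabla0 \<Psi>" "0 < A"
  obtains x0 B where "0 < x0" "0 < B"
    "\<And>x y. x0 \<le> x \<Longrightarrow> x \<le> y \<Longrightarrow> \<Psi> (A * x) / \<Psi> x \<le> \<Psi> (B * y) / \<Psi> y"
proof -
  obtain x0 C where x0: "0 < x0" and C: "1 \<le> C"
    and N: "\<And>n x y. x0 \<le> x \<Longrightarrow> x \<le> y \<Longrightarrow> \<Psi> (2 ^ n * x) / \<Psi> x \<le> \<Psi> ((2 * C) ^ n * y) / \<Psi> y"
    using nabla0_iterate[OF assms(1)] by blast
  obtain n where n: "A < 2 ^ n" using real_arch_pow[of 2 A] by auto
  show ?thesis
  proof (rule that[of x0 "(2 * C) ^ n"])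
    fix x y :: real assume xy: "x0 \<le> x" "x \<le> y"
    have "\<Psi> (A * x) / \<Psi> x \<le> \<Psi> (2 ^ n * x) / \<Psi> x"
      using n x0 xy assms(2) by (intro divide_right_mono orlicz_mono mult_right_mono orlicz_nonneg) auto
    then show "\<Psi> (A * x) / \<Psi> x \<le> \<Psi> ((2 * C) ^ n * y) / \<Psi> y" using N[OF xy, of n] by linarith
  qed (use x0 C in auto)
qed

end

section \<open>Poisson integrals and subharmonicity\<close>

text \<open>The factor 1 / (2 * pi) is included, so this is a probability density in t on
  [0, 2 * pi]. The norm in the denominator equals the distance from z to \<open>cis t\<close>; the
  form chosen is the one produced by \<open>poisson_integral_formula\<close>.\<close>

definition poisson_kernel :: "complex \<Rightarrow> real \<Rightarrow> real" where
  "poisson_kernel z t = (1 - (cmod z)\<^sup>2) / (2 * pi * (cmod (1 - cnj z * cis t))\<^sup>2)"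

lemma one_minus_mult_nonzero:
  fixes a b :: complex
  assumes "cmod a < 1" "cmod b \<le> 1"
  shows "1 - a * b \<noteq> 0"
proof
  assume "1 - a * b = 0"
  then have "cmod (a * b) = 1" by simp
  moreover have "cmod a * cmod b \<le> cmod a * 1" by (intro mult_left_mono) (use assms in auto)
  ultimately show False using assms by (simp add: norm_mult)
qed

lemma poisson_kernel_nonneg: "cmod z < 1 \<Longrightarrow> 0 \<le> poisson_kernel z t"
  by (simp add: poisson_kernel_def abs_square_le_1)

lemma continuous_on_poisson_kernel [continuous_intros]:
  assumes "cmod z < 1" shows "continuous_on S (poisson_kernel z)"
proof -
  have "cmod (1 - cnj z * cis t) \<noteq> 0" for t
    using one_minus_mult_nonzero[of "cnj z" "cis t"] assms by simp
  then show ?thesis unfolding poisson_kernel_def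
    by (intro continuous_intros) auto
qed

lemma Cauchy_integral_cis:
  assumes cont: "continuous_on (cball 0 1) H" and hol: "H holomorphic_on ball 0 1" and z: "cmod z < 1"
  shows "((\<lambda>t. H (cis t) / (1 - z * cis (- t))) has_integral complex_of_real (2 * pi) * H z) {0..2 * pi}"
proof -
  have "((\<lambda>u. H u / (u - z)) has_contour_integral (2 * of_real pi * \<i> * H z)) (circlepath 0 1)"
    by (rule Cauchy_integral_circlepath) (use assms in auto)
  then have "((\<lambda>t. H (cis t) / (cis t - z) * \<i> * cis t) has_integral (2 * of_real pi * \<i> * H z)) {0..2 * pi}"
    unfolding circlepath_def by (subst (asm) has_contour_integral_part_circlepath_iff) auto
  from has_integral_mult_right[OF this, of "- \<i>"]
  have *: "((\<lambda>t. - \<i> * (H (cis t) / (cis t - z) * \<i> * cis t)) has_integral complex_of_real (2 * pi) * H z) {0..2 * pi}"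
    by (simp add: algebra_simps)
  have "- \<i> * (H (cis t) / (cis t - z) * \<i> * cis t) = H (cis t) / (1 - z * cis (- t))" for t
  proof -
    have "cis t * (1 - z * cis (- t)) = cis t - z"
      by (simp add: algebra_simps cis_mult flip: cis_inverse)
    moreover have "cis t \<noteq> 0" by simp
    ultimately have "H (cis t) / (1 - z * cis (- t)) = H (cis t) * cis t / (cis t - z)"
      by (metis mult.commute mult_divide_mult_cancel_left)
    then show ?thesis by (simp add: algebra_simps)
  qed
  with * show ?thesis by simp
qed

text \<open>Cauchy's formula is applied to q w / (1 - cnj z * w). The value of this function at z is
  q z / (1 - |z|^2), and on the circle its denominator and the Cauchy denominator multiply to |1 -
  cnj z * w|^2, which yields the positive kernel.\<close>

lemma poisson_integral_formula:
  assumes cont: "continuous_on (cball 0 1) q" and hol: "q holomorphic_on ball 0 1" and z: "cmod z < 1"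
  shows "((\<lambda>t. of_real (poisson_kernel z t) * q (cis t)) has_integral q z) {0..2 * pi}"
proof -
  define H where "H = (\<lambda>w. q w / (1 - cnj z * w))"
  have nz: "1 - cnj z * w \<noteq> 0" if "cmod w \<le> 1" for w
    using one_minus_mult_nonzero[of "cnj z" w] z that by simp
  have "continuous_on (cball 0 1) H" unfolding H_def
    by (intro continuous_intros cont) (use nz in auto)
  moreover have "H holomorphic_on ball 0 1" unfolding H_def
    by (intro holomorphic_intros hol) (use nz in auto)
  ultimately have "((\<lambda>t. H (cis t) / (1 - z * cis (- t))) has_integral complex_of_real (2 * pi) * H z) {0..2 * pi}"
    using z by (rule Cauchy_integral_cis)
  from has_integral_mult_right[OF this, of "of_real ((1 - (cmod z)\<^sup>2) / (2 * pi))"]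
  have *: "((\<lambda>t. of_real ((1 - (cmod z)\<^sup>2) / (2 * pi)) * (H (cis t) / (1 - z * cis (- t)))) has_integral
      of_real ((1 - (cmod z)\<^sup>2) / (2 * pi)) * (complex_of_real (2 * pi) * H z)) {0..2 * pi}" .
  have 1: "of_real ((1 - (cmod z)\<^sup>2) / (2 * pi)) * (complex_of_real (2 * pi) * H z) = q z"
  proof -
    have "1 - cnj z * z = of_real (1 - (cmod z)\<^sup>2)"
      by (metis complex_norm_square mult.commute of_real_1 of_real_diff)
    moreover have "1 - cnj z * z \<noteq> 0" using nz[of z] z by simp
    ultimately show ?thesis by (simp add: H_def)
  qed
  have 2: "of_real ((1 - (cmod z)\<^sup>2) / (2 * pi)) * (H (cis t) / (1 - z * cis (- t)))
      = of_real (poisson_kernel z t) * q (cis t)" for t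
  proof -
    have "(1 - cnj z * cis t) * (1 - z * cis (- t)) = of_real ((cmod (1 - cnj z * cis t))\<^sup>2)"
      by (subst complex_norm_square) (simp add: cis_cnj)
    then show ?thesis
      by (simp add: H_def poisson_kernel_def field_simps)
  qed
  show ?thesis using * unfolding 1 2 .
qed

lemma poisson_kernel_integral_1:
  assumes "cmod z < 1" shows "(poisson_kernel z has_integral 1) {0..2 * pi}"
proof -
  have "((\<lambda>t. of_real (poisson_kernel z t) * 1) has_integral (1::complex)) {0..2 * pi}"
    by (rule poisson_integral_formula) (use assms in auto)
  from has_integral_Re[OF this] show ?thesis by simp
qed

section \<open>Approximation on the circle by real parts of entire functions\<close>

text \<open>On the circle, complex conjugation of \<open>z ^ k\<close> is a negative power; hence the real parts of
  polynomials are closed under products there.\<close>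

inductive trig_poly :: "(complex \<Rightarrow> real) \<Rightarrow> bool" where
  monomial: "trig_poly (\<lambda>z. Re (a * z ^ k))"
| add: "trig_poly f \<Longrightarrow> trig_poly g \<Longrightarrow> trig_poly (\<lambda>z. f z + g z)"

lemma trig_poly_mult_monomial_monomial:
  "\<exists>h. trig_poly h \<and> (\<forall>z\<in>sphere 0 1. h z = Re (a * z ^ j) * Re (b * z ^ k))"
proof -
  have *: "\<exists>h. trig_poly h \<and> (\<forall>z\<in>sphere 0 1. h z = Re (a * z ^ j) * Re (b * z ^ k))" if "k \<le> j" for a b j k
  proof (intro exI conjI ballI)
    show "trig_poly (\<lambda>z. Re (a * b / 2 * z ^ (j + k)) + Re (a * cnj b / 2 * z ^ (j - k)))"
      by (intro trig_poly.intros)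
    fix z :: complex assume "z \<in> sphere 0 1"
    then have "z * cnj z = 1"
      by (metis complex_norm_square mem_sphere_0 of_real_1 power_one)
    then have "z ^ k * cnj z ^ k = 1"
      by (simp flip: power_mult_distrib)
    moreover have "z ^ j = z ^ (j - k) * z ^ k" using that by (simp flip: power_add)
    ultimately have "z ^ (j - k) = z ^ j * cnj (z ^ k)" by simp
    then have e2: "a * cnj b / 2 * z ^ (j - k) = (a * z ^ j) * cnj (b * z ^ k) / 2" by simp
    have e1: "a * b / 2 * z ^ (j + k) = (a * z ^ j) * (b * z ^ k) / 2" by (simp add: power_add)
    have "Re u * Re v = Re (u * v / 2) + Re (u * cnj v / 2)" for u v
      by (simp add: field_simps)
    then show "Re (a * b / 2 * z ^ (j + k)) + Re (a * cnj b / 2 * z ^ (j - k)) = Re (a * z ^ j) * Re (b * z ^ k)"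
      unfolding e1 e2 by (rule sym)
  qed
  show ?thesis
  proof (cases "k \<le> j")
    case True then show ?thesis by (rule *)
  next
    case False
    then have "j \<le> k" by simp
    from *[OF this, of b a] show ?thesis by (simp add: mult.commute)
  qed
qed

lemma trig_poly_mult:
  assumes "trig_poly f" "trig_poly g"
  shows "\<exists>h. trig_poly h \<and> (\<forall>z\<in>sphere 0 1. h z = f z * g z)"
  using assms
proof (induction f)
  case (monomial a j)
  from monomial show ?case
  proof (induction g)
    case (monomial b k)
    show ?case by (rule trig_poly_mult_monomial_monomial)
  next
    case (add g1 g2)
    then obtain h1 h2 where "trig_poly h1" "\<forall>z\<in>sphere 0 1. h1 z = Re (a * z ^ j) * g1 z"
      "trig_poly h2" "\<forall>z\<in>sphere 0 1. h2 z = Re (a * z ^ j) * g2 z" by blast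
    then show ?case
      by (intro exI[of _ "\<lambda>z. h1 z + h2 z"]) (simp add: trig_poly.add distrib_left del: times_complex.sel)
  qed
next
  case (add f1 f2)
  then obtain h1 h2 where "trig_poly h1" "\<forall>z\<in>sphere 0 1. h1 z = f1 z * g z"
      "trig_poly h2" "\<forall>z\<in>sphere 0 1. h2 z = f2 z * g z" by blast
  then show ?case
    by (intro exI[of _ "\<lambda>z. h1 z + h2 z"]) (auto intro: trig_poly.add simp: algebra_simps)
qed

lemma real_polynomial_trig_poly:
  fixes p :: "complex \<Rightarrow> real"
  assumes "real_polynomial_function p"
  shows "\<exists>h. trig_poly h \<and> (\<forall>z\<in>sphere 0 1. h z = p z)"
  using assms
proof induction
  case (linear f)
  \<comment> \<open>A real-linear functional on the plane is the real part of a complex-linear one,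
    with coefficient f 1 - i * f i.\<close>
  have "f z = Re (Complex (f 1) (- f \<i>) * z ^ 1)" for z
  proof -
    have "f z = f (Re z *\<^sub>R 1 + Im z *\<^sub>R \<i>)"
      by (rule arg_cong[of _ _ f]) (simp add: complex_eq_iff)
    also have "\<dots> = Re z * f 1 + Im z * f \<i>"
      using linear by (simp add: linear_simps)
    finally show ?thesis by simp
  qed
  then have "f = (\<lambda>z. Re (Complex (f 1) (- f \<i>) * z ^ 1))" by (rule ext)
  then have "trig_poly f" by (rule ssubst) (rule trig_poly.monomial)
  then show ?case by blast
next
  case (const c)
  show ?case using trig_poly.monomial[of "of_real c" 0] by (intro exI) auto
next
  case (add f g)
  then obtain h1 h2 where "trig_poly h1" "\<forall>z\<in>sphere 0 1. h1 z = f z"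
      "trig_poly h2" "\<forall>z\<in>sphere 0 1. h2 z = g z" by blast
  then show ?case
    by (intro exI[of _ "\<lambda>z. h1 z + h2 z"]) (auto intro: trig_poly.add)
next
  case (mult f g)
  then obtain h1 h2 where h: "trig_poly h1" "\<forall>z\<in>sphere 0 1. h1 z = f z"
      "trig_poly h2" "\<forall>z\<in>sphere 0 1. h2 z = g z" by blast
  from trig_poly_mult[OF h(1,3)] obtain h3 where "trig_poly h3" "\<forall>z\<in>sphere 0 1. h3 z = h1 z * h2 z"
    by blast
  with h show ?case by auto
qed

lemma trig_poly_Re_entire: "trig_poly h \<Longrightarrow> \<exists>q. q holomorphic_on UNIV \<and> (\<forall>z. h z = Re (q z))"
proof (induction rule: trig_poly.induct)
  case (monomial a k)
  show ?case by (intro exI[of _ "\<lambda>z. a * z ^ k"]) (auto intro!: holomorphic_intros)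
next
  case (add f g)
  then obtain q1 q2 where "q1 holomorphic_on UNIV" "\<forall>z. f z = Re (q1 z)"
    "q2 holomorphic_on UNIV" "\<forall>z. g z = Re (q2 z)" by blast
  then show ?case by (intro exI[of _ "\<lambda>z. q1 z + q2 z"]) (auto intro!: holomorphic_intros)
qed

text \<open>This stands in for solving the Dirichlet problem: approximate boundary data are attained
  by an entire function, so the maximum principle and the exact Poisson formula both apply to
  it.\<close>

lemma circle_approx_Re_entire:
  assumes "continuous_on (sphere 0 1) \<phi>" "0 < e"
  obtains q where "q holomorphic_on UNIV" "\<And>w. cmod w = 1 \<Longrightarrow> \<bar>\<phi> w - Re (q w)\<bar> < e"
proof -
  obtain p where p: "real_polynomial_function p" "\<And>x. x \<in> sphere 0 1 \<Longrightarrow> \<bar>\<phi> x - p x\<bar> < e"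
    using Stone_Weierstrass_real_polynomial_function[OF compact_sphere assms] by blast
  obtain h where h: "trig_poly h" "\<forall>z\<in>sphere 0 1. h z = p z" using real_polynomial_trig_poly[OF p(1)] by blast
  obtain q where "q holomorphic_on UNIV" "\<forall>z. h z = Re (q z)" using trig_poly_Re_entire[OF h(1)] by blast
  with p(2) h(2) show ?thesis by (intro that[of q]) (auto simp: dist_norm)
qed

text \<open>The tangent to the exponential at the mean m lies below its graph; integrating it
  against the Poisson density, which has mass 1, leaves exactly exp m.\<close>

lemma jensen_exp_poisson:
  assumes z: "cmod z < 1" and u: "continuous_on {0..2 * pi} u"
  shows "exp (integral {0..2 * pi} (\<lambda>t. poisson_kernel z t * u t))
    \<le> integral {0..2 * pi} (\<lambda>t. poisson_kernel z t * exp (u t))"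
proof -
  define m where "m = integral {0..2 * pi} (\<lambda>t. poisson_kernel z t * u t)"
  have i1: "((\<lambda>t. poisson_kernel z t * u t) has_integral m) {0..2 * pi}" unfolding m_def
    by (intro integrable_integral integrable_continuous_real continuous_intros z u)
  have i2: "((\<lambda>t. poisson_kernel z t * exp (u t)) has_integral
      integral {0..2 * pi} (\<lambda>t. poisson_kernel z t * exp (u t))) {0..2 * pi}"
    by (intro integrable_integral integrable_continuous_real continuous_intros z u)
  have "((\<lambda>t. exp m * (poisson_kernel z t * u t + (1 - m) * poisson_kernel z t)) has_integral
      exp m * (m + (1 - m) * 1)) {0..2 * pi}"
    by (intro has_integral_mult_right has_integral_add i1 poisson_kernel_integral_1 z)
  then have "exp m * (m + (1 - m) * 1) \<le> integral {0..2 * pi} (\<lambda>t. poisson_kernel z t * exp (u t))"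
  proof (rule has_integral_le[OF _ i2])
    fix t
    have "exp m * (1 + (u t - m)) \<le> exp m * exp (u t - m)"
      by (intro mult_left_mono exp_ge_add_one_self) auto
    then have "exp m * (1 + (u t - m)) \<le> exp (u t)" by (simp flip: exp_add)
    from mult_left_mono[OF this poisson_kernel_nonneg[OF z, of t]]
    show "exp m * (poisson_kernel z t * u t + (1 - m) * poisson_kernel z t) \<le> poisson_kernel z t * exp (u t)"
      by (simp add: algebra_simps)
  qed
  then show ?thesis by (simp add: m_def)
qed

text \<open>Choosing \<open>Re q\<close> slightly above \<open>ln (cmod G + \<delta>)\<close> on the circle makes \<open>G * exp (- q)\<close> at most 1
  in modulus there, hence in the disc; this bypasses the zeros of \<open>G\<close>.\<close>

lemma sqrt_cmod_le_poisson:
  assumes cont: "continuous_on (cball 0 1) G" and hol: "G holomorphic_on ball 0 1" and z: "cmod z < 1"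
  shows "sqrt (cmod (G z)) \<le> integral {0..2 * pi} (\<lambda>t. poisson_kernel z t * sqrt (cmod (G (cis t))))"
proof -
  define I where "I = integral {0..2 * pi} (\<lambda>t. poisson_kernel z t * sqrt (cmod (G (cis t))))"
  have Gcis: "continuous_on {0..2 * pi} (\<lambda>t. G (cis t))"
    by (rule continuous_on_compose2[OF cont]) (auto intro!: continuous_intros)
  have bound: "sqrt (cmod (G z)) \<le> exp \<delta> * (I + sqrt \<delta>)" if \<delta>: "0 < \<delta>" for \<delta>
  proof -
    \<comment> \<open>The inner \<delta> keeps the logarithm finite at zeros of G. The outer shift
      by \<delta>, equal to the tolerance of the approximation, places Re q between ln (|G| +
      \<delta>) and 2 * \<delta> + ln (|G| + \<delta>).\<close>
    have "continuous_on (sphere 0 1) (\<lambda>w. ln (cmod (G w) + \<delta>) + \<delta>)"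
      by (intro continuous_intros continuous_on_subset[OF cont])
        (use \<delta> in \<open>auto simp: add_nonneg_eq_0_iff\<close>)
    from circle_approx_Re_entire[OF this \<delta>] obtain q where q: "q holomorphic_on UNIV"
      and qa: "\<And>w. cmod w = 1 \<Longrightarrow> \<bar>ln (cmod (G w) + \<delta>) + \<delta> - Re (q w)\<bar> < \<delta>" by blast
    have qcont: "continuous_on S q" for S
      using q holomorphic_on_imp_continuous_on holomorphic_on_subset by blast
    have lo: "cmod (G w) + \<delta> \<le> exp (Re (q w))" and hi: "exp (Re (q w)) \<le> exp (2 * \<delta>) * (cmod (G w) + \<delta>)"
      if "cmod w = 1" for w
    proof -
      have p: "0 < cmod (G w) + \<delta>" using \<delta> by (simp add: add_nonneg_pos)
      have "ln (cmod (G w) + \<delta>) \<le> Re (q w)" "Re (q w) \<le> 2 * \<delta> + ln (cmod (G w) + \<delta>)"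
        using qa[OF that] by (simp_all add: abs_less_iff)
      then have "exp (ln (cmod (G w) + \<delta>)) \<le> exp (Re (q w))" "exp (Re (q w)) \<le> exp (2 * \<delta> + ln (cmod (G w) + \<delta>))"
        by simp_all
      then show "cmod (G w) + \<delta> \<le> exp (Re (q w))" "exp (Re (q w)) \<le> exp (2 * \<delta>) * (cmod (G w) + \<delta>)"
        using exp_ln[OF p] by (simp_all only: exp_add)
    qed
    have expn: "cmod (u * exp (- v)) = cmod u / exp (Re v)" for u v :: complex
      by (simp add: norm_mult divide_inverse flip: exp_minus)
    have "cmod (G z * exp (- q z)) \<le> 1"
    proof (rule maximum_modulus_frontier[where f = "\<lambda>z. G z * exp (- q z)" and S = "ball 0 1"])
      show "(\<lambda>z. G z * exp (- q z)) holomorphic_on interior (ball 0 1)"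
        using hol holomorphic_on_subset[OF q] by (auto intro!: holomorphic_intros)
      show "continuous_on (closure (ball 0 1)) (\<lambda>z. G z * exp (- q z))"
        using cont qcont by (auto intro!: continuous_intros)
      fix w :: complex assume "w \<in> frontier (ball 0 1)"
      then have w: "cmod w = 1" by simp
      have "cmod (G w) \<le> exp (Re (q w))" using lo[OF w] \<delta> by simp
      then show "cmod (G w * exp (- q w)) \<le> 1"
        by (simp add: expn)
    qed (use z in auto)
    then have "cmod (G z) \<le> exp (Re (q z))"
      by (simp add: expn)
    then have "sqrt (cmod (G z)) \<le> sqrt (exp (Re (q z)))" by simp
    also have "sqrt (exp (Re (q z))) = exp (Re (q z) / 2)"
      by (rule real_sqrt_unique) (simp_all add: power2_eq_square flip: exp_add)
    also have "Re (q z) / 2 = integral {0..2 * pi} (\<lambda>t. poisson_kernel z t * (Re (q (cis t)) / 2))"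
    proof -
      have "((\<lambda>t. of_real (poisson_kernel z t) * q (cis t)) has_integral q z) {0..2 * pi}"
        by (rule poisson_integral_formula) (use z q qcont holomorphic_on_subset in auto)
      from has_integral_divide[OF has_integral_Re[OF this], of 2] show ?thesis
        by (intro integral_unique[symmetric]) simp
    qed
    also have "exp \<dots> \<le> integral {0..2 * pi} (\<lambda>t. poisson_kernel z t * exp (Re (q (cis t)) / 2))"
      by (intro jensen_exp_poisson z continuous_intros continuous_on_compose2[OF qcont[of UNIV]]) auto
    also have "\<dots> \<le> integral {0..2 * pi} (\<lambda>t. exp \<delta> * (poisson_kernel z t * sqrt (cmod (G (cis t))) + sqrt \<delta> * poisson_kernel z t))"
    proof (rule integral_le)
      fix t
      have "exp (Re (q (cis t)) / 2) = sqrt (exp (Re (q (cis t))))"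
        by (rule real_sqrt_unique[symmetric]) (simp_all add: power2_eq_square flip: exp_add)
      also have "\<dots> \<le> sqrt (exp (2 * \<delta>) * (cmod (G (cis t)) + \<delta>))"
        using hi[of "cis t"] by simp
      also have "\<dots> = exp \<delta> * sqrt (cmod (G (cis t)) + \<delta>)"
      proof -
        have "sqrt (exp (2 * \<delta>)) = exp \<delta>"
          by (rule real_sqrt_unique) (simp_all add: power2_eq_square flip: exp_add)
        then show ?thesis by (simp add: real_sqrt_mult)
      qed
      also have "\<dots> \<le> exp \<delta> * (sqrt (cmod (G (cis t))) + sqrt \<delta>)"
        by (intro mult_left_mono sqrt_add_le_add_sqrt) (use \<delta> in auto)
      finally have "poisson_kernel z t * exp (Re (q (cis t)) / 2)
          \<le> poisson_kernel z t * (exp \<delta> * (sqrt (cmod (G (cis t))) + sqrt \<delta>))"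
        by (rule mult_left_mono[OF _ poisson_kernel_nonneg[OF z]])
      then show "poisson_kernel z t * exp (Re (q (cis t)) / 2)
          \<le> exp \<delta> * (poisson_kernel z t * sqrt (cmod (G (cis t))) + sqrt \<delta> * poisson_kernel z t)"
        by (simp add: algebra_simps)
    qed (intro integrable_continuous_real continuous_intros z Gcis
        continuous_on_compose2[OF qcont[of UNIV]] subset_UNIV; simp)+
    also have "\<dots> = exp \<delta> * (I + sqrt \<delta> * 1)"
      unfolding I_def
      by (intro integral_unique has_integral_mult_right has_integral_add integrable_integral
        integrable_continuous_real continuous_intros poisson_kernel_integral_1 z Gcis)
    finally show ?thesis by simp
  qed
  have "((\<lambda>\<delta>. exp \<delta> * (I + sqrt \<delta>)) \<longlongrightarrow> exp 0 * (I + sqrt 0)) (at_right 0)"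
    by (intro tendsto_intros)
  then have "sqrt (cmod (G z)) \<le> exp 0 * (I + sqrt 0)"
    by (rule tendsto_lowerbound) (auto simp: eventually_at_right_less intro!: eventually_mono[OF eventually_at_right_less] bound)
  then show ?thesis by (simp add: I_def)
qed

section \<open>Carleson windows and dyadic covers\<close>

lemma abs_Arg_rcis_le: "\<bar>Arg (rcis r \<alpha>)\<bar> \<le> \<bar>\<alpha>\<bar>" if "0 \<le> r"
proof (cases "r = 0 \<or> \<alpha> \<notin> {-pi<..pi}")
  case True
  then show ?thesis
    using Arg_bounded[of "rcis r \<alpha>"] by (auto simp: Arg_zero)
next
  case False
  with that show ?thesis by (simp add: Arg_rcis)
qed

text \<open>Membership is witnessed by any angle close to c rather than by the principal argument.
  This removes the wrap-around, so that windows over intervals of the real line can be compared by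
  comparing the intervals.\<close>

lemma mem_carleson_window_cis:
  "z \<in> carleson_window (cis c) h \<longleftrightarrow>
    1 - h < cmod z \<and> cmod z \<le> 1 \<and> (\<exists>\<theta>. z = rcis (cmod z) \<theta> \<and> \<bar>\<theta> - c\<bar> < h)"
proof -
  have "\<bar>Arg (z * cnj (cis c))\<bar> < h \<longleftrightarrow> (\<exists>\<theta>. z = rcis (cmod z) \<theta> \<and> \<bar>\<theta> - c\<bar> < h)"
  proof
    assume h: "\<bar>Arg (z * cnj (cis c))\<bar> < h"
    have "z * cnj (cis c) = rcis (cmod z) (Arg (z * cnj (cis c)))"
      using rcis_cmod_Arg[of "z * cnj (cis c)"] by (simp add: norm_mult)
    then have "z * cnj (cis c) * cis c = rcis (cmod z) (Arg (z * cnj (cis c))) * cis c" by simp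
    moreover have "z * cnj (cis c) * cis c = z" by (simp add: cis_cnj cis_mult mult.assoc)
    moreover have "rcis R x * cis y = rcis R (x + y)" for R x y by (simp add: rcis_def cis_mult mult.assoc)
    ultimately have "z = rcis (cmod z) (Arg (z * cnj (cis c)) + c)" by metis
    then show "\<exists>\<theta>. z = rcis (cmod z) \<theta> \<and> \<bar>\<theta> - c\<bar> < h" using h
      by (intro exI[of _ "Arg (z * cnj (cis c)) + c"]) auto
  next
    assume "\<exists>\<theta>. z = rcis (cmod z) \<theta> \<and> \<bar>\<theta> - c\<bar> < h"
    then obtain \<theta> where t: "z = rcis (cmod z) \<theta>" "\<bar>\<theta> - c\<bar> < h" by blast
    have "rcis (cmod z) \<theta> * cnj (cis c) = rcis (cmod z) (\<theta> - c)"
      by (simp add: rcis_def cis_cnj cis_mult)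
    with t have "z * cnj (cis c) = rcis (cmod z) (\<theta> - c)" by metis
    with abs_Arg_rcis_le[of "cmod z" "\<theta> - c"] t show "\<bar>Arg (z * cnj (cis c))\<bar> < h" by simp
  qed
  then show ?thesis by (auto simp: carleson_window_def)
qed

lemma carleson_window_mono:
  assumes "\<bar>c - c'\<bar> + h \<le> h'"
  shows "carleson_window (cis c) h \<subseteq> carleson_window (cis c') h'"
proof
  fix z assume "z \<in> carleson_window (cis c) h"
  then obtain \<theta> where "1 - h < cmod z" "cmod z \<le> 1" "z = rcis (cmod z) \<theta>" "\<bar>\<theta> - c\<bar> < h"
    unfolding mem_carleson_window_cis by blast
  moreover from this have "\<bar>\<theta> - c'\<bar> < h'" using assms by linarith
  ultimately show "z \<in> carleson_window (cis c') h'"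
    unfolding mem_carleson_window_cis using assms by auto
qed

text \<open>Library continuity of \<open>Arg\<close> excludes the closed negative axis; there it is constant except at 0.\<close>

lemma borel_measurable_Arg: "Arg \<in> borel_measurable borel"
proof (rule measurable_discrete_difference)
  have "continuous_on (- \<real>\<^sub>\<le>\<^sub>0) Arg" by (rule continuous_on_Arg)
  then show "(\<lambda>z. if z \<in> \<real>\<^sub>\<le>\<^sub>0 then pi else Arg z) \<in> borel_measurable borel"
    by (intro borel_measurable_continuous_on_if borel_closed closed_nonpos_Reals_complex) auto
  fix z :: complex assume "z \<notin> {0}"
  then have "z \<in> \<real>\<^sub>\<le>\<^sub>0 \<Longrightarrow> Arg z = pi"
    by (auto simp: Arg_eq_pi complex_nonpos_Reals_iff complex_eq_iff)
  then show "(if z \<in> \<real>\<^sub>\<le>\<^sub>0 then pi else Arg z) = Arg z" by simp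
qed auto

lemma carleson_window_borel [measurable]: "carleson_window \<xi> h \<in> sets borel"
proof -
  have [measurable]: "Arg \<in> borel_measurable borel" by (rule borel_measurable_Arg)
  show ?thesis unfolding carleson_window_def by measurable
qed

lemma carleson_window_subset_cball: "carleson_window \<xi> h \<subseteq> cball 0 1"
  by (auto simp: carleson_window_def)

section \<open>Dyadic stopping covers\<close>

text \<open>The factor 2 in the windows makes those of subintervals nested in those of the parent, so that
  only the maximal intervals with large average matter.\<close>

primrec dyadic_cover :: "(real \<Rightarrow> real) \<Rightarrow> real \<Rightarrow> nat \<Rightarrow> real \<Rightarrow> real \<Rightarrow> complex set" where
  "dyadic_cover \<phi> \<tau> 0 a b =
    (if \<tau> * (b - a) < integral {a..b} \<phi> then carleson_window (cis ((a + b) / 2)) (2 * (b - a)) else {})"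
| "dyadic_cover \<phi> \<tau> (Suc n) a b =
    (if \<tau> * (b - a) < integral {a..b} \<phi> then carleson_window (cis ((a + b) / 2)) (2 * (b - a))
     else dyadic_cover \<phi> \<tau> n a ((a + b) / 2) \<union> dyadic_cover \<phi> \<tau> n ((a + b) / 2) b)"

lemma dyadic_cover_borel [measurable]: "dyadic_cover \<phi> \<tau> n a b \<in> sets borel"
  by (induction n arbitrary: a b) auto

lemma dyadic_cover_subset_cball: "dyadic_cover \<phi> \<tau> n a b \<subseteq> cball 0 1"
  by (induction n arbitrary: a b) (simp_all add: carleson_window_subset_cball)

lemma dyadic_cover_Suc: "dyadic_cover \<phi> \<tau> n a b \<subseteq> dyadic_cover \<phi> \<tau> (Suc n) a b"
proof (induction n arbitrary: a b)
  case (Suc n)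
  show ?case using Suc[of a "(a + b) / 2"] Suc[of "(a + b) / 2" b] by auto
qed auto

lemma incseq_dyadic_cover: "incseq (\<lambda>n. dyadic_cover \<phi> \<tau> n a b)"
  by (rule incseq_SucI) (rule dyadic_cover_Suc)

text \<open>The part of \<phi> below \<tau> / 2 accounts for at most half of the integral, so the
  excess over \<tau> / 2 carries the rest. Retaining only the excess is what later confines the sum
  over levels to \<tau> < 2 * \<phi>.\<close>

lemma length_le_excess_integral:
  fixes \<phi> :: "real \<Rightarrow> real"
  assumes c: "continuous_on {a..b} \<phi>" and ab: "a < b" and g: "\<tau> * (b - a) < integral {a..b} \<phi>" and \<tau>: "0 < \<tau>"
  shows "b - a \<le> (2 / \<tau>) * integral {a..b} (\<lambda>t. max 0 (\<phi> t - \<tau> / 2))"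
proof -
  have "integral {a..b} \<phi> \<le> integral {a..b} (\<lambda>t. max 0 (\<phi> t - \<tau> / 2) + \<tau> / 2)"
    by (intro integral_le integrable_continuous_real continuous_intros c) auto
  also have "\<dots> = integral {a..b} (\<lambda>t. max 0 (\<phi> t - \<tau> / 2)) + integral {a..b} (\<lambda>t. \<tau> / 2)"
    by (intro integral_add integrable_continuous_real continuous_intros c)
  also have "integral {a..b} (\<lambda>t. \<tau> / 2) = (b - a) * \<tau> / 2" using ab by simp
  finally show ?thesis using g \<tau> by (simp add: field_simps)
qed

text \<open>A Calderon-Zygmund stopping argument in recursive form: a selected interval pays for its
  window with its own excess integral, and additivity of the integral over the two halves expresses
  disjointness. The bound does not depend on n, so it survives the union over n.\<close>

lemma emeasure_dyadic_cover_le: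
  fixes \<phi> :: "real \<Rightarrow> real" and M :: "complex measure"
  assumes sets: "\<And>n a b. dyadic_cover \<phi> \<tau> n a b \<in> sets M"
    and cont: "continuous_on {A..B} \<phi>" and \<tau>: "0 < \<tau>" and K: "0 \<le> K"
    and window: "\<And>a b. A \<le> a \<Longrightarrow> a < b \<Longrightarrow> b \<le> B \<Longrightarrow> \<tau> * (b - a) < integral {a..b} \<phi> \<Longrightarrow>
      emeasure M (carleson_window (cis ((a + b) / 2)) (2 * (b - a))) \<le> ennreal (K * (b - a))"
    and ab: "A \<le> a" "a < b" "b \<le> B"
  shows "emeasure M (dyadic_cover \<phi> \<tau> n a b)
    \<le> ennreal (K * (2 / \<tau>) * integral {a..b} (\<lambda>t. max 0 (\<phi> t - \<tau> / 2)))"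
proof -
  let ?f = "\<lambda>t. max 0 (\<phi> t - \<tau> / 2)"
  have c: "continuous_on {a..b} \<phi>" if "A \<le> a" "b \<le> B" for a b
    by (rule continuous_on_subset[OF cont]) (use that in auto)
  have fi: "?f integrable_on {a..b}" if "A \<le> a" "b \<le> B" for a b
    by (intro integrable_continuous_real continuous_intros c that)
  have good: "emeasure M (carleson_window (cis ((a + b) / 2)) (2 * (b - a)))
      \<le> ennreal (K * (2 / \<tau>) * integral {a..b} ?f)"
    if ab: "A \<le> a" "a < b" "b \<le> B" and g: "\<tau> * (b - a) < integral {a..b} \<phi>" for a b
  proof -
    have "K * (b - a) \<le> K * (2 / \<tau>) * integral {a..b} ?f"
      using mult_left_mono[OF length_le_excess_integral[OF c ab(2) g \<tau>] K] ab by (simp add: mult_ac)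
    then show ?thesis using window[OF ab g] by (meson ennreal_leI order_trans)
  qed
  show ?thesis using ab
  proof (induction n arbitrary: a b)
    case 0
    then show ?case using good[of a b] by simp
  next
    case (Suc n)
    let ?m = "(a + b) / 2"
    show ?case
    proof (cases "\<tau> * (b - a) < integral {a..b} \<phi>")
      case True
      then show ?thesis using good[of a b] Suc.prems by simp
    next
      case False
      have nn: "0 \<le> K * (2 / \<tau>) * integral {u..v} ?f" if "A \<le> u" "v \<le> B" for u v
        by (intro mult_nonneg_nonneg integral_nonneg fi that) (use K \<tau> in auto)
      have "emeasure M (dyadic_cover \<phi> \<tau> (Suc n) a b)
          \<le> emeasure M (dyadic_cover \<phi> \<tau> n a ?m) + emeasure M (dyadic_cover \<phi> \<tau> n ?m b)"
        using False by (simp add: emeasure_subadditive sets)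
      also have "\<dots> \<le> ennreal (K * (2 / \<tau>) * integral {a..?m} ?f) + ennreal (K * (2 / \<tau>) * integral {?m..b} ?f)"
        by (intro add_mono Suc.IH) (use Suc.prems in auto)
      also have "\<dots> = ennreal (K * (2 / \<tau>) * integral {a..?m} ?f + K * (2 / \<tau>) * integral {?m..b} ?f)"
        by (rule ennreal_plus[symmetric]; rule nn) (use Suc.prems in auto)
      also have "K * (2 / \<tau>) * integral {a..?m} ?f + K * (2 / \<tau>) * integral {?m..b} ?f = K * (2 / \<tau>) * integral {a..b} ?f"
      proof -
        have "integral {a..?m} ?f + integral {?m..b} ?f = integral {a..b} ?f"
          by (rule Henstock_Kurzweil_Integration.integral_combine) (use Suc.prems fi in auto)
        then show ?thesis by (metis distrib_left)
      qed
      finally show ?thesis .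
    qed
  qed
qed

text \<open>The recursion may stop before reaching the given dyadic interval, but then it stops at
  an ancestor, whose doubled window contains the doubled window of the interval.\<close>

lemma carleson_window_subset_dyadic_cover:
  fixes \<phi> :: "real \<Rightarrow> real"
  assumes "k \<le> n" "i < 2 ^ k" "a < b"
    and len: "len = (b - a) / 2 ^ k"
    and c: "c = a + real i * len"
    and large: "\<tau> * len < integral {c..c + len} \<phi>"
  shows "carleson_window (cis (c + len / 2)) (2 * len) \<subseteq> dyadic_cover \<phi> \<tau> n a b"
  using assms
proof (induction n arbitrary: k i a b c)
  case 0
  then have "k = 0" "i = 0" by auto
  with 0 have e: "c + len / 2 = (a + b) / 2" "len = b - a" and g: "\<tau> * (b - a) < integral {a..b} \<phi>"
    by (auto simp: field_simps)
  have "dyadic_cover \<phi> \<tau> 0 a b = carleson_window (cis (c + len / 2)) (2 * len)"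
    unfolding e(1) unfolding e(2) using g by simp
  then show ?case by simp
next
  case (Suc n)
  let ?m = "(a + b) / 2"
  have i: "real i + 1 \<le> 2 ^ k"
    using Suc.prems(2) by (metis Suc_leI of_nat_Suc of_nat_le_iff of_nat_numeral of_nat_power add.commute)
  have len_pos: "0 < len" using Suc.prems by simp
  have b: "b = a + 2 ^ k * len" using Suc.prems by simp
  show ?case
  proof (cases "\<tau> * (b - a) < integral {a..b} \<phi>")
    case True
    have "(real i + 1) * len \<le> 2 ^ k * len" "0 \<le> real i * len"
      using i len_pos by (auto intro: mult_right_mono)
    then have "a \<le> c" "c + len \<le> b" using b Suc.prems(5) by (auto simp: algebra_simps)
    \<comment> \<open>The centres differ by at most (b - a - len) / 2, since the small interval lies
      in the large one, and len <= b - a.\<close>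
    then have "\<bar>c + len / 2 - (a + b) / 2\<bar> + 2 * len \<le> 2 * (b - a)"
      using len_pos by (simp add: abs_if field_simps)
    then show ?thesis using True by (simp add: carleson_window_mono)
  next
    case False
    have "k \<noteq> 0"
    proof
      assume "k = 0"
      then show False using Suc.prems False by simp
    qed
    then obtain j where j: "k = Suc j" by (cases k) auto
    show ?thesis
    proof (cases "i < 2 ^ j")
      case True
      have "carleson_window (cis (c + len / 2)) (2 * len) \<subseteq> dyadic_cover \<phi> \<tau> n a ?m"
        by (rule Suc.IH[of j i]) (use Suc.prems j True in \<open>auto simp: field_simps\<close>)
      then show ?thesis using False by auto
    next
      case ge: False
      have "real i = 2 ^ j + real (i - 2 ^ j)" using ge by (simp add: of_nat_diff)
      moreover have "?m = a + 2 ^ j * len" using b j by (simp add: field_simps)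
      ultimately have "c = ?m + real (i - 2 ^ j) * len" using Suc.prems(5) by (simp add: algebra_simps)
      then have "carleson_window (cis (c + len / 2)) (2 * len) \<subseteq> dyadic_cover \<phi> \<tau> n ?m b"
        by (intro Suc.IH[of j "i - 2 ^ j"]) (use Suc.prems j ge in \<open>auto simp: field_simps\<close>)
      then show ?thesis using False by auto
    qed
  qed
qed

section \<open>Poisson integrals controlled by averages over centred arcs\<close>

lemma sin_ge_chord: "2 * x / pi \<le> sin x" if "0 \<le> x" "x \<le> pi / 2"
proof -
  have "concave_on {0..pi / 2} sin"
    by (rule f''_le0_imp_concave[where f' = cos and f'' = "\<lambda>x. - sin x"])
      (auto intro!: derivative_eq_intros sin_ge_zero)
  from concave_onD[OF this, of "2 * x / pi" 0 "pi / 2"] that show ?thesis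
    by (simp add: field_simps)
qed

text \<open>The chord |1 - cis \<alpha>| = 2 * sin (|\<alpha>| / 2) is at least 2 * |\<alpha>| / pi.
  Moving from radius 1 to radius r costs 1 - r, which the first bound dominates by the same modulus;
  this halves the constant.\<close>

lemma cmod_one_minus_rcis_ge:
  assumes "0 \<le> r" "r < 1" "\<bar>\<alpha>\<bar> \<le> pi"
  shows "1 - r \<le> cmod (1 - rcis r \<alpha>)" "\<bar>\<alpha>\<bar> / pi \<le> cmod (1 - rcis r \<alpha>)"
proof -
  show 1: "1 - r \<le> cmod (1 - rcis r \<alpha>)"
    using norm_triangle_ineq2[of 1 "rcis r \<alpha>"] assms by simp
  have "2 * \<bar>\<alpha>\<bar> / pi \<le> 2 * sin (\<bar>\<alpha>\<bar> / 2)"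
    using sin_ge_chord[of "\<bar>\<alpha>\<bar> / 2"] assms by (simp add: field_simps)
  also have "\<dots> \<le> cmod (1 - cis \<alpha>)"
  proof (rule power2_le_imp_le)
    have "(cmod (1 - cis \<alpha>))\<^sup>2 = (1 - cos \<alpha>)\<^sup>2 + (sin \<alpha>)\<^sup>2" by (simp add: cmod_power2)
    also have "\<dots> = 2 - 2 * cos \<bar>\<alpha>\<bar>"
      using sin_cos_squared_add[of \<alpha>] by (simp add: power2_eq_square algebra_simps abs_if)
    also have "cos \<bar>\<alpha>\<bar> = 1 - 2 * (sin (\<bar>\<alpha>\<bar> / 2))\<^sup>2"
      using cos_double_sin[of "\<bar>\<alpha>\<bar> / 2"] by simp
    finally show "(2 * sin (\<bar>\<alpha>\<bar> / 2))\<^sup>2 \<le> (cmod (1 - cis \<alpha>))\<^sup>2" by (simp add: power_mult_distrib)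
  qed simp
  also have "cmod (1 - cis \<alpha>) = cmod ((1 - rcis r \<alpha>) - of_real (1 - r) * cis \<alpha>)"
    by (simp add: rcis_def algebra_simps)
  also have "\<dots> \<le> cmod (1 - rcis r \<alpha>) + cmod (of_real (1 - r) * cis \<alpha>)"
    by (rule norm_triangle_ineq4)
  also have "cmod (of_real (1 - r) * cis \<alpha>) = 1 - r" using assms by (simp add: norm_mult flip: of_real_diff)
  finally show "\<bar>\<alpha>\<bar> / pi \<le> cmod (1 - rcis r \<alpha>)" using 1 by simp
qed

text \<open>The scale 2 ^ n is comparable to 1 / (1 - r). For pi / 2 ^ (m + 1) <= |\<alpha>| <= pi /
  2 ^ m the kernel is at most 16 * 4 ^ m / 2 ^ n, so that shell contributes at most \<beta> * 16 * 2
  ^ m / 2 ^ n, a geometric series in m. The innermost interval contributes \<beta>, whence 17 = 1 +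
  16.\<close>

lemma poisson_integral_le_averages:
  fixes \<psi> :: "real \<Rightarrow> real"
  defines "p \<equiv> \<lambda>r \<alpha>. (1 - r\<^sup>2) / (2 * pi * (cmod (1 - rcis r \<alpha>))\<^sup>2)"
  assumes r: "0 \<le> r" "r < 1" and n: "2 * pi / 2 ^ n \<le> 1 - r" "1 - r \<le> 4 * pi / 2 ^ n"
    and cont: "continuous_on {-pi..pi} \<psi>" and nonneg: "\<And>\<alpha>. 0 \<le> \<psi> \<alpha>"
    and avg: "\<And>m. m \<le> n \<Longrightarrow> integral {-pi / 2 ^ m..pi / 2 ^ m} \<psi> \<le> \<beta> / 2 ^ m"
  shows "integral {-pi..pi} (\<lambda>\<alpha>. p r \<alpha> * \<psi> \<alpha>) \<le> 17 * \<beta>"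
proof -
  have nz: "cmod (1 - rcis r \<alpha>) \<noteq> 0" for \<alpha>
    using norm_triangle_ineq2[of 1 "rcis r \<alpha>"] r by auto
  have pi_pow: "pi / 2 ^ m \<le> pi" for m by (simp add: field_simps)
  have contp: "continuous_on S (\<lambda>\<alpha>. p r \<alpha> * \<psi> \<alpha>)" if "S \<subseteq> {-pi..pi}" for S
    unfolding p_def rcis_def
    by (intro continuous_intros continuous_on_subset[OF cont that]) (use nz in \<open>auto simp: rcis_def\<close>)
  have cont': "continuous_on S \<psi>" if "S \<subseteq> {-pi..pi}" for S
    by (rule continuous_on_subset[OF cont that])
  have p_le: "p r \<alpha> \<le> (1 - r) / (pi * d\<^sup>2)" if "0 < d" "d \<le> cmod (1 - rcis r \<alpha>)" for d \<alpha>
  proof -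
    have "1 - r\<^sup>2 \<le> 2 * (1 - r)" using zero_le_power2[of "1 - r"] by (simp add: power2_eq_square algebra_simps)
    then have "p r \<alpha> \<le> 2 * (1 - r) / (2 * pi * d\<^sup>2)" unfolding p_def
      by (intro frac_le mult_left_mono power_mono mult_pos_pos) (use that r in auto)
    also have "\<dots> = (1 - r) / (pi * d\<^sup>2)"
      by (metis mult.assoc mult_divide_mult_cancel_left zero_neq_numeral)
    finally show ?thesis .
  qed
  have le_const: "integral {u..v} (\<lambda>\<alpha>. p r \<alpha> * \<psi> \<alpha>) \<le> C * integral {u..v} \<psi>"
    if uv: "-pi \<le> u" "v \<le> pi" and C: "\<And>\<alpha>. u \<le> \<alpha> \<Longrightarrow> \<alpha> \<le> v \<Longrightarrow> p r \<alpha> \<le> C" for u v C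
  proof -
    have s: "{u..v} \<subseteq> {-pi..pi}" using uv by auto
    have "integral {u..v} (\<lambda>\<alpha>. p r \<alpha> * \<psi> \<alpha>) \<le> integral {u..v} (\<lambda>\<alpha>. C * \<psi> \<alpha>)"
      by (intro integral_le integrable_continuous_real contp[OF s] continuous_intros cont'[OF s] mult_right_mono C nonneg) auto
    then show ?thesis by simp
  qed
  have \<beta>: "0 \<le> \<beta>"
  proof -
    have "0 \<le> integral {-pi / 2 ^ n..pi / 2 ^ n} \<psi>"
      by (intro integral_nonneg integrable_continuous_real cont') (use pi_pow[of n] nonneg in auto)
    with avg[of n] have "0 \<le> \<beta> / 2 ^ n" by linarith
    from mult_nonneg_nonneg[OF this, of "2 ^ n"] show ?thesis by simp
  qed
  \<comment> \<open>Downward induction from m = n; 1 - 2 ^ m / 2 ^ n is the sum of 2 ^ i / 2 ^ n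
    over m <= i < n.\<close>
  have claim: "integral {-pi / 2 ^ m..pi / 2 ^ m} (\<lambda>\<alpha>. p r \<alpha> * \<psi> \<alpha>) \<le> \<beta> * (1 + 16 * (1 - 2 ^ m / 2 ^ n))"
    if "m \<le> n" for m
    using that
  proof (induction rule: inc_induct)
    case base
    have "integral {-pi / 2 ^ n..pi / 2 ^ n} (\<lambda>\<alpha>. p r \<alpha> * \<psi> \<alpha>) \<le> 2 ^ n * integral {-pi / 2 ^ n..pi / 2 ^ n} \<psi>"
    proof (rule le_const)
      fix \<alpha> assume "-pi / 2 ^ n \<le> \<alpha>" "\<alpha> \<le> pi / 2 ^ n"
      then have "\<bar>\<alpha>\<bar> \<le> pi" using pi_pow[of n] by auto
      then have "p r \<alpha> \<le> (1 - r) / (pi * (1 - r)\<^sup>2)"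
        by (intro p_le cmod_one_minus_rcis_ge) (use r in auto)
      also have "\<dots> = 1 / (pi * (1 - r))" using r by (simp add: power2_eq_square)
      also have "\<dots> \<le> 1 / (pi * (2 * pi / 2 ^ n))"
        using n r by (intro divide_left_mono mult_left_mono mult_pos_pos) auto
      also have "\<dots> = 2 ^ n * (1 / (2 * pi\<^sup>2))" by (simp add: power2_eq_square)
      also have "\<dots> \<le> 2 ^ n * 1"
      proof (intro mult_left_mono)
        have "1 \<le> 2 * pi\<^sup>2" using one_le_power[of pi 2] pi_ge_two by linarith
        then show "1 / (2 * pi\<^sup>2) \<le> 1" by simp
      qed simp
      finally show "p r \<alpha> \<le> 2 ^ n" by simp
    qed (use pi_pow[of n] in auto)
    also have "\<dots> \<le> 2 ^ n * (\<beta> / 2 ^ n)" by (intro mult_left_mono avg) auto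
    finally show ?case by simp
  next
    case (step m)
    let ?u = "pi / 2 ^ m" and ?v = "pi / 2 ^ Suc m" and ?F = "\<lambda>\<alpha>. p r \<alpha> * \<psi> \<alpha>"
    have uv: "?v \<le> ?u" "?u \<le> pi" "0 < ?v" using pi_pow[of m] by (simp_all add: field_simps)
    have F: "?F integrable_on {a..b}" and \<psi>i: "\<psi> integrable_on {a..b}" if "-pi \<le> a" "b \<le> pi" for a b
      by (intro integrable_continuous_real contp cont'; use that in auto)+
    have pC: "p r \<alpha> \<le> 16 * 4 ^ m / 2 ^ n" if "?v \<le> \<bar>\<alpha>\<bar>" "\<bar>\<alpha>\<bar> \<le> ?u" for \<alpha>
    proof -
      have "?v / pi \<le> \<bar>\<alpha>\<bar> / pi" using that(1) by (intro divide_right_mono) auto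
      then have "?v / pi \<le> cmod (1 - rcis r \<alpha>)"
        using cmod_one_minus_rcis_ge(2)[OF r, of \<alpha>] that uv by linarith
      then have "p r \<alpha> \<le> (1 - r) / (pi * (?v / pi)\<^sup>2)" by (intro p_le) auto
      also have "\<dots> \<le> (4 * pi / 2 ^ n) / (pi * (?v / pi)\<^sup>2)" using n by (intro divide_right_mono) auto
      also have "\<dots> = 16 * 4 ^ m / 2 ^ n"
      proof -
        have "(?v / pi)\<^sup>2 = 1 / (4 * 4 ^ m)"
          by (simp add: power2_eq_square power_mult_distrib[symmetric])
        then show ?thesis by (simp add: field_simps)
      qed
      finally show ?thesis .
    qed
    have "integral {-?u..?u} ?F = integral {-?u..-?v} ?F + integral {-?v..?v} ?F + integral {?v..?u} ?F"
    proof -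
      have "integral {-?u..-?v} ?F + integral {-?v..?u} ?F = integral {-?u..?u} ?F"
        by (rule Henstock_Kurzweil_Integration.integral_combine) (use uv in \<open>auto intro!: F\<close>)
      moreover have "integral {-?v..?v} ?F + integral {?v..?u} ?F = integral {-?v..?u} ?F"
        by (rule Henstock_Kurzweil_Integration.integral_combine) (use uv in \<open>auto intro!: F\<close>)
      ultimately show ?thesis by simp
    qed
    moreover have "integral {-?u..-?v} ?F \<le> (16 * 4 ^ m / 2 ^ n) * integral {-?u..-?v} \<psi>"
      by (rule le_const) (use uv in \<open>auto intro!: pC\<close>)
    moreover have "integral {?v..?u} ?F \<le> (16 * 4 ^ m / 2 ^ n) * integral {?v..?u} \<psi>"
      by (rule le_const) (use uv in \<open>auto intro!: pC\<close>)
    moreover have "integral {-?u..-?v} \<psi> + integral {?v..?u} \<psi> \<le> \<beta> / 2 ^ m"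
    proof -
      have "integral {-?u..-?v} \<psi> + integral {-?v..?u} \<psi> = integral {-?u..?u} \<psi>"
        by (rule Henstock_Kurzweil_Integration.integral_combine) (use uv in \<open>auto intro!: \<psi>i\<close>)
      moreover have "integral {-?v..?v} \<psi> + integral {?v..?u} \<psi> = integral {-?v..?u} \<psi>"
        by (rule Henstock_Kurzweil_Integration.integral_combine) (use uv in \<open>auto intro!: \<psi>i\<close>)
      moreover have "0 \<le> integral {-?v..?v} \<psi>"
        by (intro integral_nonneg \<psi>i nonneg) (use uv in auto)
      moreover have "integral {-?u..?u} \<psi> \<le> \<beta> / 2 ^ m" using avg[of m] step by simp
      ultimately show ?thesis by linarith
    qed
    then have "(16 * 4 ^ m / 2 ^ n) * (integral {-?u..-?v} \<psi> + integral {?v..?u} \<psi>) \<le> (16 * 4 ^ m / 2 ^ n) * (\<beta> / 2 ^ m)"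
      by (intro mult_left_mono) auto
    moreover have "(16 * 4 ^ m / 2 ^ n) * (\<beta> / 2 ^ m) = \<beta> * (16 * (2 ^ m / 2 ^ n))"
    proof -
      have "(4::real) ^ m = 2 ^ m * 2 ^ m" by (simp flip: power_mult_distrib)
      then show ?thesis by simp
    qed
    moreover have "integral {-?v..?v} ?F \<le> \<beta> * (1 + 16 * (1 - 2 ^ Suc m / 2 ^ n))" using step.IH by simp
    ultimately have "integral {-?u..?u} ?F \<le> \<beta> * (1 + 16 * (1 - 2 ^ Suc m / 2 ^ n)) + \<beta> * (16 * (2 ^ m / 2 ^ n))"
      by (simp only: distrib_left)
    also have "\<dots> = \<beta> * (1 + 16 * (1 - 2 ^ m / 2 ^ n))" by (simp add: field_simps)
    finally show ?case by simp
  qed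
  have "integral {-pi..pi} (\<lambda>\<alpha>. p r \<alpha> * \<psi> \<alpha>) \<le> \<beta> * (1 + 16 * (1 - 1 / 2 ^ n))"
    using claim[of 0] by simp
  also have "\<dots> \<le> \<beta> * 17" using \<beta> by (intro mult_left_mono) (auto simp: field_simps)
  finally show ?thesis by simp
qed

text \<open>If every arc centred at \<open>Arg z\<close> of length 2 * pi / 2 ^ m with m <= n had
  average at most 2 * \<tau>, the Poisson integral would be at most 17 * 4 * pi * \<tau> < 256 *
  \<tau>. An arc with average above 2 * \<tau> lies in two adjacent grid intervals of the same
  length, one of which has average above \<tau>. The base interval [-4 * pi, 4 * pi] has room for
  both, whatever the argument of z.\<close>

lemma mem_dyadic_cover_of_large:
  assumes cont: "continuous_on (cball 0 1) G" and hol: "G holomorphic_on ball 0 1"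
    and z: "cmod z < 1" and \<tau>: "0 < \<tau>" and large: "256 * \<tau> < sqrt (cmod (G z))"
  shows "\<exists>n. z \<in> dyadic_cover (\<lambda>t. sqrt (cmod (G (cis t)))) \<tau> n (-4 * pi) (4 * pi)"
proof -
  define \<phi> where "\<phi> = (\<lambda>t. sqrt (cmod (G (cis t))))"
  define r \<theta> where "r = cmod z" and "\<theta> = Arg z"
  have zr: "z = rcis r \<theta>" unfolding r_def \<theta>_def by (rule rcis_cmod_Arg[symmetric])
  have r: "0 \<le> r" "r < 1" using z by (auto simp: r_def)
  have \<theta>: "-pi < \<theta>" "\<theta> \<le> pi" unfolding \<theta>_def using Arg_bounded[of z] by auto
  have \<phi>c: "continuous_on S \<phi>" for S unfolding \<phi>_def
    by (intro continuous_intros continuous_on_compose2[OF cont]) auto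
  have \<phi>0: "0 \<le> \<phi> t" for t by (simp add: \<phi>_def)
  \<comment> \<open>The least n with the first property is positive because 1 - r <= 1 < 2 * pi; its
    failure at the predecessor is the second property.\<close>
  obtain n where n: "2 * pi / 2 ^ n \<le> 1 - r" "1 - r < 4 * pi / 2 ^ n"
  proof -
    let ?P = "\<lambda>n. 2 * pi / 2 ^ n \<le> 1 - r"
    obtain N where "2 * pi / (1 - r) < 2 ^ N" using real_arch_pow[of 2 "2 * pi / (1 - r)"] by auto
    then have "?P N" using r by (simp add: field_simps)
    then have L: "?P (Least ?P)" by (rule LeastI)
    have "Least ?P \<noteq> 0"
    proof
      assume "Least ?P = 0"
      with L have "2 * pi \<le> 1 - r" by simp
      then show False using r pi_ge_two by linarith
    qed
    then obtain k where k: "Least ?P = Suc k" by (cases "Least ?P") auto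
    then have "\<not> ?P k" by (metis lessI not_less_Least)
    then show ?thesis using that[of "Suc k"] L k by (simp add: field_simps)
  qed
  have "\<exists>m\<le>n. 4 * pi * \<tau> / 2 ^ m < integral {-pi / 2 ^ m..pi / 2 ^ m} (\<lambda>\<alpha>. \<phi> (\<theta> + \<alpha>))"
  proof (rule ccontr)
    assume "\<not> ?thesis"
    then have avg: "integral {-pi / 2 ^ m..pi / 2 ^ m} (\<lambda>\<alpha>. \<phi> (\<theta> + \<alpha>)) \<le> (4 * pi * \<tau>) / 2 ^ m" if "m \<le> n" for m
      using that by (meson not_less)
    \<comment> \<open>The rotation moves z to -r, so the kernel peaks at t = pi, the midpoint of
      [0, 2 * pi], and the shift by pi makes the domain symmetric.\<close>
    define H where "H = (\<lambda>w. G (w * cis (\<theta> - pi)))"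
    have "sqrt (cmod (H (- of_real r))) \<le> integral {0..2 * pi} (\<lambda>t. poisson_kernel (- of_real r) t * sqrt (cmod (H (cis t))))"
    proof (rule sqrt_cmod_le_poisson)
      show "continuous_on (cball 0 1) H" unfolding H_def
        by (intro continuous_on_compose2[OF cont] continuous_intros) (auto simp: norm_mult)
      show "H holomorphic_on ball 0 1" unfolding H_def
        by (rule holomorphic_on_compose_gen[OF _ hol, unfolded o_def]) (auto intro!: holomorphic_intros simp: norm_mult)
    qed (use r in auto)
    moreover have "- of_real r * cis (\<theta> - pi) = z"
      by (simp add: zr rcis_def complex_eq_iff)
    then have "H (- of_real r) = G z" by (simp add: H_def)
    moreover have "H (cis t) = G (cis (\<theta> + (t - pi)))" for t by (simp add: H_def cis_mult algebra_simps)
    moreover have "poisson_kernel (- of_real r) t = (1 - r\<^sup>2) / (2 * pi * (cmod (1 - rcis r (t - pi)))\<^sup>2)" for t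
    proof -
      have "1 - cnj (- of_real r) * cis t = 1 - rcis r (t - pi)"
        by (simp add: rcis_def complex_eq_iff)
      then show ?thesis using r by (simp add: poisson_kernel_def)
    qed
    ultimately have "sqrt (cmod (G z)) \<le> integral {0..2 * pi}
        (\<lambda>t. (1 - r\<^sup>2) / (2 * pi * (cmod (1 - rcis r (t - pi)))\<^sup>2) * \<phi> (\<theta> + (t - pi)))"
      by (simp add: \<phi>_def)
    also have "\<dots> = integral {0 + -pi..2 * pi + -pi} (\<lambda>\<alpha>. (1 - r\<^sup>2) / (2 * pi * (cmod (1 - rcis r \<alpha>))\<^sup>2) * \<phi> (\<theta> + \<alpha>))"
      by (subst integral_shift_Icc_real[symmetric]) (simp add: o_def)
    also have "\<dots> = integral {-pi..pi} (\<lambda>\<alpha>. (1 - r\<^sup>2) / (2 * pi * (cmod (1 - rcis r \<alpha>))\<^sup>2) * \<phi> (\<theta> + \<alpha>))"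
      by simp
    also have "\<dots> \<le> 17 * (4 * pi * \<tau>)"
    proof (rule poisson_integral_le_averages[OF r n(1)])
      show "continuous_on {-pi..pi} (\<lambda>\<alpha>. \<phi> (\<theta> + \<alpha>))"
        by (intro continuous_on_compose2[OF \<phi>c[of UNIV]] continuous_intros) auto
    qed (use n avg \<phi>0 in auto)
    also have "\<dots> \<le> 256 * \<tau>"
    proof -
      have "17 * (4 * pi) \<le> 256" using pi_approx by simp
      from mult_right_mono[OF this, of \<tau>] \<tau> show ?thesis by simp
    qed
    finally show False using large by simp
  qed
  then obtain m where m: "m \<le> n" "4 * pi * \<tau> / 2 ^ m < integral {-pi / 2 ^ m..pi / 2 ^ m} (\<lambda>\<alpha>. \<phi> (\<theta> + \<alpha>))"
    by blast
  define len where "len = 2 * pi / 2 ^ m"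
  \<comment> \<open>Position of the left end of the centred arc in the grid of mesh
    \<open>len\<close> starting at -4 * pi; i is the index of the grid interval containing that
    end.\<close>
  define x where "x = (\<theta> - len / 2 + 4 * pi) / len"
  define i where "i = nat \<lfloor>x\<rfloor>"
  have len: "0 < len" "len \<le> 2 * pi" by (auto simp: len_def field_simps)
  have x: "0 \<le> x" using \<theta> len by (simp add: x_def)
  then have i: "real i \<le> x" "x < real i + 1" unfolding i_def by linarith+
  define c where "c = -4 * pi + real i * len"
  have "real i * len \<le> x * len" "x * len < (real i + 1) * len"
    using i len by (auto intro: mult_right_mono mult_strict_right_mono)
  moreover have "x * len = \<theta> - len / 2 + 4 * pi" using len by (simp add: x_def)
  ultimately have c: "c \<le> \<theta> - len / 2" "\<theta> - len / 2 < c + len" by (auto simp: c_def algebra_simps)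
  have \<phi>i: "\<phi> integrable_on {a..b}" for a b by (rule integrable_continuous_real[OF \<phi>c])
  have "4 * pi * \<tau> / 2 ^ m = 2 * (\<tau> * len)" by (simp add: len_def)
  with m(2) have "2 * (\<tau> * len) < integral {-pi / 2 ^ m..pi / 2 ^ m} (\<lambda>\<alpha>. \<phi> (\<theta> + \<alpha>))" by simp
  also have "integral {-pi / 2 ^ m..pi / 2 ^ m} (\<lambda>\<alpha>. \<phi> (\<theta> + \<alpha>)) = integral {\<theta> - len / 2..\<theta> + len / 2} \<phi>"
    using integral_shift_Icc_real[of "- (len / 2)" "len / 2" \<phi> \<theta>]
    by (simp add: o_def len_def add.commute)
  also have "\<dots> \<le> integral {c..c + 2 * len} \<phi>"
    by (rule integral_subset_le) (use c \<phi>i \<phi>0 in auto)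
  also have "\<dots> = integral {c..c + len} \<phi> + integral {c + len..c + 2 * len} \<phi>"
    by (rule Henstock_Kurzweil_Integration.integral_combine[symmetric]) (use len \<phi>i in auto)
  finally have "2 * (\<tau> * len) < integral {c..c + len} \<phi> + integral {c + len..c + 2 * len} \<phi>" .
  then consider "\<tau> * len < integral {c..c + len} \<phi>" | "\<tau> * len < integral {c + len..c + 2 * len} \<phi>" by linarith
  then obtain j where j: "j = i \<or> j = Suc i"
    and gj: "\<tau> * len < integral {-4 * pi + real j * len..-4 * pi + real j * len + len} \<phi>"
  proof cases
    case 1 then show ?thesis using that[of i] by (simp add: c_def)
  next
    case 2
    then show ?thesis using that[of "Suc i"] by (simp add: c_def algebra_simps)
  qed
  have "j < 2 ^ (m + 2)"
  proof -
    have "c + 2 * len \<le> 4 * pi" using c \<theta> len by linarith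
    then have "(real i + 2) * len \<le> 8 * pi" by (simp add: c_def algebra_simps)
    also have "8 * pi = 2 ^ (m + 2) * len" by (simp add: len_def)
    finally have "real i + 2 \<le> 2 ^ (m + 2)" using len by simp
    then have "real (i + 2) \<le> real (2 ^ (m + 2))" by simp
    then have "i + 2 \<le> 2 ^ (m + 2)" by (simp only: of_nat_le_iff)
    then show ?thesis using j by linarith
  qed
  then have "carleson_window (cis (-4 * pi + real j * len + len / 2)) (2 * len) \<subseteq> dyadic_cover \<phi> \<tau> (m + 2) (-4 * pi) (4 * pi)"
    by (intro carleson_window_subset_dyadic_cover[of "m + 2" _ j] gj) (auto simp: len_def)
  moreover have "z \<in> carleson_window (cis (-4 * pi + real j * len + len / 2)) (2 * len)"
  proof -
    have "-4 * pi + real j * len = c \<or> -4 * pi + real j * len = c + len"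
      using j by (auto simp: c_def algebra_simps)
    then have "\<bar>\<theta> - (-4 * pi + real j * len + len / 2)\<bar> < 2 * len" using c len by auto
    \<comment> \<open>The arc found may be much longer than 1 - r; since m <= n, its doubled window
      always reaches down past z.\<close>
    moreover have "1 - 2 * len < r"
    proof -
      have "4 * pi / 2 ^ n \<le> 4 * pi / 2 ^ m" using m(1) by (intro divide_left_mono power_increasing) auto
      also have "\<dots> = 2 * len" by (simp add: len_def)
      finally show ?thesis using n(2) by simp
    qed
    ultimately show ?thesis unfolding mem_carleson_window_cis
      using zr r unfolding r_def by (intro conjI exI[of _ \<theta>]) simp_all
  qed
  ultimately show ?thesis unfolding \<phi>_def by blast
qed

lemma integral_four_periods:
  fixes f :: "real \<Rightarrow> real"
  assumes "continuous_on UNIV f" "\<And>t. f (t + 2 * pi) = f t"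
  shows "integral {-4 * pi..4 * pi} f = 4 * integral {0..2 * pi} f"
proof -
  have fi: "f integrable_on {a..b}" for a b
    by (intro integrable_continuous_real continuous_on_subset[OF assms(1)]) auto
  have shift: "integral {a + 2 * pi..b + 2 * pi} f = integral {a..b} f" for a b
    using integral_shift_Icc_real[of a b f "2 * pi"] assms(2) by (simp add: o_def add.commute)
  have "integral {-4 * pi..-2 * pi} f + integral {-2 * pi..4 * pi} f = integral {-4 * pi..4 * pi} f"
    by (rule Henstock_Kurzweil_Integration.integral_combine) (use fi in auto)
  moreover have "integral {-2 * pi..0} f + integral {0..4 * pi} f = integral {-2 * pi..4 * pi} f"
    by (rule Henstock_Kurzweil_Integration.integral_combine) (use fi in auto)
  moreover have "integral {0..2 * pi} f + integral {2 * pi..4 * pi} f = integral {0..4 * pi} f"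
    by (rule Henstock_Kurzweil_Integration.integral_combine) (use fi in auto)
  ultimately show ?thesis
    using shift[of "-4 * pi" "-2 * pi"] shift[of "-2 * pi" 0] shift[of 0 "2 * pi"] by simp
qed

section \<open>Window conditions and test functions\<close>

lemma nn_integral_circle_measure:
  assumes c: "continuous_on UNIV f" and nn: "\<And>t. 0 \<le> f t"
  shows "(\<integral>\<^sup>+ t. ennreal (f t) \<partial>circle_measure) = ennreal (integral {0..2 * pi} f / (2 * pi))"
proof -
  have m: "f \<in> borel_measurable lborel" using borel_measurable_continuous_onI[OF c] by simp
  have i: "f integrable_on {0..2 * pi}" by (intro integrable_continuous_real continuous_on_subset[OF c]) auto
  have "(\<integral>\<^sup>+ t. ennreal (f t) \<partial>circle_measure)
      = (\<integral>\<^sup>+ t. ennreal (f t) * indicator {0..2 * pi} t \<partial>lborel) / emeasure lborel {0..2 * pi}"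
    unfolding circle_measure_def by (rule nn_integral_uniform_measure) (use m in auto)
  also have "(\<integral>\<^sup>+ t. ennreal (f t) * indicator {0..2 * pi} t \<partial>lborel) = ennreal (integral {0..2 * pi} f)"
    by (rule nn_integral_has_integral_lebesgue'[OF nn integrable_integral[OF i]])
  also have "emeasure lborel {0..2 * pi} = ennreal (2 * pi)" by simp
  also have "ennreal (integral {0..2 * pi} f) / ennreal (2 * pi) = ennreal (integral {0..2 * pi} f / (2 * pi))"
    by (rule divide_ennreal) (use nn in \<open>auto intro!: integral_nonneg[OF i]\<close>)
  finally show ?thesis .
qed

section \<open>Test functions concentrated near a boundary point\<close>

lemma cmod_one_minus_cis_le: "cmod (1 - cis \<theta>) \<le> \<bar>\<theta>\<bar>"
proof (rule power2_le_imp_le)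
  have "(cmod (1 - cis \<theta>))\<^sup>2 = (1 - cos \<theta>)\<^sup>2 + (sin \<theta>)\<^sup>2" by (simp add: cmod_power2)
  also have "\<dots> = 2 - 2 * cos \<theta>"
    using sin_cos_squared_add[of \<theta>] by (simp add: power2_eq_square algebra_simps)
  also have "cos \<theta> = 1 - 2 * (sin (\<theta> / 2))\<^sup>2"
    using cos_double_sin[of "\<theta> / 2"] by simp
  also have "2 - 2 * (1 - 2 * (sin (\<theta> / 2))\<^sup>2) = 4 * \<bar>sin (\<theta> / 2)\<bar>\<^sup>2" by simp
  also have "\<dots> \<le> 4 * \<bar>\<theta> / 2\<bar>\<^sup>2"
    by (intro mult_left_mono power_mono abs_sin_x_le_abs_x) auto
  finally show "(cmod (1 - cis \<theta>))\<^sup>2 \<le> \<bar>\<theta>\<bar>\<^sup>2" by (simp add: power2_eq_square)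
qed simp

lemma boundary_ext_eq:
  assumes "cmod z \<le> 1" "isCont f z" shows "boundary_ext f z = f z"
proof (cases "cmod z < 1")
  case True then show ?thesis by (simp add: boundary_ext_def)
next
  case False
  have "((\<lambda>r. of_real r * z) \<longlongrightarrow> of_real 1 * z) (at_left 1)"
    by (intro tendsto_intros)
  then have "((\<lambda>r. f (of_real r * z)) \<longlongrightarrow> f z) (at_left 1)"
    using assms(2) by (intro isCont_tendsto_compose[of z f]) auto
  moreover have "\<not> trivial_limit (at_left (1 :: real))" by simp
  ultimately show ?thesis using False tendsto_Lim[of "at_left (1::real)"]
    by (auto simp: boundary_ext_def)
qed

text \<open>On the circle the square makes the modulus a constant multiple of the Poisson kernel at
  (1 - h) * \<xi>. With a first power the modular estimate below would lose a logarithm of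
  h.\<close>

definition carleson_test :: "real \<Rightarrow> real \<Rightarrow> complex \<Rightarrow> complex \<Rightarrow> complex" where
  "carleson_test x h \<xi> z = of_real x * (of_real h / (1 - cnj (of_real (1 - h) * \<xi>) * z))\<^sup>2"

context
  fixes x h :: real and \<xi> :: complex
  assumes x: "0 \<le> x" and h: "0 < h" "h \<le> 1" and \<xi>: "cmod \<xi> = 1"
begin

lemma carleson_test_nz: "cmod z \<le> 1 \<Longrightarrow> 1 - cnj (of_real (1 - h) * \<xi>) * z \<noteq> 0"
  using h \<xi> by (intro one_minus_mult_nonzero) (auto simp: norm_mult simp flip: of_real_diff)

lemma cmod_carleson_test:
  "cmod (carleson_test x h \<xi> z) = x * (h / cmod (1 - cnj (of_real (1 - h) * \<xi>) * z))\<^sup>2"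
  using x h by (simp add: carleson_test_def norm_mult norm_divide norm_power)

lemma isCont_carleson_test: "cmod z \<le> 1 \<Longrightarrow> isCont (carleson_test x h \<xi>) z"
  unfolding carleson_test_def using carleson_test_nz by (intro continuous_intros) auto

lemma carleson_test_le:
  assumes "cmod z \<le> 1" shows "cmod (carleson_test x h \<xi> z) \<le> x"
proof -
  have "cmod (cnj (of_real (1 - h) * \<xi>) * z) \<le> (1 - h) * 1"
    using h \<xi> assms by (simp add: norm_mult mult_left_le flip: of_real_diff)
  then have "h \<le> cmod (1 - cnj (of_real (1 - h) * \<xi>) * z)"
    using norm_triangle_ineq2[of 1 "cnj (of_real (1 - h) * \<xi>) * z"] by simp
  then have "h / cmod (1 - cnj (of_real (1 - h) * \<xi>) * z) \<le> 1"
    using h(1) by (subst divide_le_eq_1_pos) linarith+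
  then have "(h / cmod (1 - cnj (of_real (1 - h) * \<xi>) * z))\<^sup>2 \<le> 1"
    using h by (intro power_le_one) auto
  from mult_left_mono[OF this x] show ?thesis by (simp add: cmod_carleson_test)
qed

text \<open>On the window the denominator is at most 3 * h: radial distance, angular distance and
  the shift of the pole contribute h each. Squaring gives 9.\<close>

lemma carleson_test_ge:
  assumes z: "z \<in> carleson_window \<xi> h" shows "x / 9 \<le> cmod (carleson_test x h \<xi> z)"
proof -
  have z1: "cmod z \<le> 1" "1 - h < cmod z" and A: "\<bar>Arg (z * cnj \<xi>)\<bar> < h" using z by (auto simp: carleson_window_def)
  define w where "w = z * cnj \<xi>"
  have w: "cmod w = cmod z" using \<xi> by (simp add: w_def norm_mult)
  have "w = rcis (cmod z) (Arg w)" using rcis_cmod_Arg[of w] w by simp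
  then have "1 - w = (1 - cis (Arg w)) + of_real (1 - cmod z) * cis (Arg w)"
    by (simp add: rcis_def algebra_simps)
  then have "cmod (1 - w) \<le> cmod (1 - cis (Arg w)) + cmod (of_real (1 - cmod z) * cis (Arg w))"
    by (metis norm_triangle_ineq)
  moreover have "cmod (of_real (1 - cmod z) * cis (Arg w)) = 1 - cmod z"
    using z1 by (simp add: norm_mult del: of_real_diff)
  ultimately have "cmod (1 - w) \<le> 2 * h"
    using cmod_one_minus_cis_le[of "Arg w"] A z1 by (simp add: w_def)
  moreover have "1 - cnj (of_real (1 - h) * \<xi>) * z = (1 - w) + of_real h * w"
    by (simp add: w_def algebra_simps)
  then have "cmod (1 - cnj (of_real (1 - h) * \<xi>) * z) \<le> cmod (1 - w) + cmod (of_real h * w)"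
    by (metis norm_triangle_ineq)
  moreover have "cmod (of_real h * w) \<le> h"
    using w z1 h by (simp add: norm_mult mult_left_le)
  ultimately have le: "cmod (1 - cnj (of_real (1 - h) * \<xi>) * z) \<le> 3 * h" by linarith
  have "0 < cmod (1 - cnj (of_real (1 - h) * \<xi>) * z)" using carleson_test_nz[OF z1(1)] by simp
  then have "1 / 3 \<le> h / cmod (1 - cnj (of_real (1 - h) * \<xi>) * z)" using le by (simp add: field_simps)
  then have "(1 / 3)\<^sup>2 \<le> (h / cmod (1 - cnj (of_real (1 - h) * \<xi>) * z))\<^sup>2" by (intro power_mono) auto
  from mult_left_mono[OF this x] show ?thesis by (simp add: cmod_carleson_test power2_eq_square)
qed

lemma boundary_ext_carleson_test:
  "cmod z \<le> 1 \<Longrightarrow> boundary_ext (carleson_test x h \<xi>) z = carleson_test x h \<xi> z"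
  by (intro boundary_ext_eq isCont_carleson_test)

text \<open>With d the modulus of the denominator, (h / d)^2 <= 1, so convexity bounds \<Psi> of the
  function by (h / d)^2 * \<Psi> x = h / d^2. This is at most 2 * pi times a Poisson kernel, whose
  mass is 1.\<close>

lemma carleson_test_hardy:
  assumes orl: "orlicz_function \<Psi>" and xh: "\<Psi> x = 1 / h"
  shows "carleson_test x h \<xi> \<in> hardy_orlicz \<Psi>" "hardy_norm \<Psi> (carleson_test x h \<xi>) \<le> 1"
proof -
  let ?F = "carleson_test x h \<xi>"
  have slice: "(\<lambda>t. ?F (of_real r * cis t)) \<in> borel_measurable circle_measure"
      "(\<integral>\<^sup>+ t. ennreal (\<Psi> (cmod (?F (of_real r * cis t)) / 1)) \<partial>circle_measure) \<le> 1" if r: "0 \<le> r" "r < 1" for r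
  proof -
    have cF: "continuous_on UNIV (\<lambda>t. ?F (of_real r * cis t))"
    proof (rule continuous_on_compose2[of "cball 0 1" ?F])
      show "continuous_on (cball 0 1) ?F"
        by (intro continuous_at_imp_continuous_on ballI isCont_carleson_test) auto
    qed (use r in \<open>auto intro!: continuous_intros simp: norm_mult\<close>)
    then show "(\<lambda>t. ?F (of_real r * cis t)) \<in> borel_measurable circle_measure"
      using borel_measurable_continuous_onI[OF cF] by (simp add: circle_measure_def cong: measurable_cong_sets)
    have c\<Psi>: "continuous_on UNIV (\<lambda>t. \<Psi> (cmod (?F (of_real r * cis t))))"
      by (intro continuous_on_orlicz[OF orl] continuous_intros cF) auto
    \<comment> \<open>The slice of radius r is absorbed into the pole: along it the function has the
      denominator of the Poisson kernel at a, and |a| <= 1 - h keeps the numerator 1 - |a|^2 above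
      h.\<close>
    define a where "a = of_real r * (of_real (1 - h) * \<xi>)"
    have a: "cmod a = r * (1 - h)" using r h \<xi> by (simp add: a_def norm_mult flip: of_real_diff)
    have "cmod a \<le> 1 - h" using r h by (simp add: a mult_left_le_one_le)
    then have a1: "cmod a < 1" using h by simp
    have "(cmod a)\<^sup>2 \<le> (1 - h)\<^sup>2" using \<open>cmod a \<le> 1 - h\<close> by (intro power_mono) auto
    also have "(1 - h)\<^sup>2 \<le> 1 - h" using h by (simp add: power2_eq_square mult_left_le)
    finally have ah: "h \<le> 1 - (cmod a)\<^sup>2" by simp
    have le: "\<Psi> (cmod (?F (of_real r * cis t))) \<le> 2 * pi * poisson_kernel a t" for t
    proof -
      define d where "d = cmod (1 - cnj a * cis t)"
      have d: "cmod (1 - cnj (of_real (1 - h) * \<xi>) * (of_real r * cis t)) = d"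
        by (simp add: d_def a_def mult_ac)
      have d0: "0 < d" using one_minus_mult_nonzero[of "cnj a" "cis t"] a1 by (simp add: d_def)
      have u: "cmod (?F (of_real r * cis t)) = (h / d)\<^sup>2 * x" unfolding cmod_carleson_test d by simp
      have "h \<le> d"
        using norm_triangle_ineq2[of 1 "cnj a * cis t"] \<open>cmod a \<le> 1 - h\<close> by (simp add: d_def norm_mult)
      then have "\<Psi> ((h / d)\<^sup>2 * x) \<le> (h / d)\<^sup>2 * \<Psi> x"
        using h d0 x by (intro orlicz_scale_le[OF orl] power_le_one) auto
      also have "\<dots> = h / d\<^sup>2" using h by (simp add: xh power2_eq_square)
      also have "\<dots> \<le> (1 - (cmod a)\<^sup>2) / d\<^sup>2" by (intro divide_right_mono ah) auto
      also have "\<dots> = 2 * pi * poisson_kernel a t" by (simp add: poisson_kernel_def d_def)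
      finally show ?thesis by (simp add: u)
    qed
    have "integral {0..2 * pi} (\<lambda>t. \<Psi> (cmod (?F (of_real r * cis t)))) \<le> 2 * pi * 1"
    proof (rule has_integral_le[OF integrable_integral])
      show "((\<lambda>t. 2 * pi * poisson_kernel a t) has_integral 2 * pi * 1) {0..2 * pi}"
        by (intro has_integral_mult_right poisson_kernel_integral_1 a1)
    qed (use le in \<open>auto intro!: integrable_continuous_real continuous_on_subset[OF c\<Psi>]\<close>)
    then show "(\<integral>\<^sup>+ t. ennreal (\<Psi> (cmod (?F (of_real r * cis t)) / 1)) \<partial>circle_measure) \<le> 1"
      using nn_integral_circle_measure[OF c\<Psi>] orlicz_nonneg[OF orl] by (simp add: field_simps)
  qed
  then have le1: "lux_norm \<Psi> circle_measure (\<lambda>t. ?F (of_real r * cis t)) \<le> 1" if "r \<in> {0..<1}" for r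
    using that by (intro lux_norm_le[OF orl]) auto
  have "?F holomorphic_on ball 0 1" unfolding carleson_test_def
    using carleson_test_nz by (intro holomorphic_intros) auto
  then show "?F \<in> hardy_orlicz \<Psi>"
    using slice le1 unfolding hardy_orlicz_def orlicz_space_def
    by (auto intro!: exI[of _ 1] bdd_aboveI[of _ 1])
  show "hardy_norm \<Psi> ?F \<le> 1" unfolding hardy_norm_def
    by (rule cSUP_least) (use le1 in auto)
qed

end

section \<open>Measures of windows and the two window conditions\<close>

context
  fixes \<mu> :: "complex measure"
  assumes mu_borel: "sets \<mu> = sets (restrict_space borel (cball (0::complex) 1))"
    and mu_finite: "finite_measure \<mu>"
begin

lemma space_eq_cball: "space \<mu> = cball 0 1"
  using sets_eq_imp_space_eq[OF mu_borel] by (simp add: space_restrict_space)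

lemma borel_in_sets: "A \<in> sets borel \<Longrightarrow> A \<subseteq> cball 0 1 \<Longrightarrow> A \<in> sets \<mu>"
  unfolding mu_borel by (subst sets_restrict_space_iff) auto

lemma carleson_window_sets: "carleson_window \<xi> h \<in> sets \<mu>"
  by (intro borel_in_sets carleson_window_borel carleson_window_subset_cball)

lemma measure_window_le_rho:
  assumes "cmod \<xi> = 1" shows "measure \<mu> (carleson_window \<xi> h) \<le> rho_mu \<mu> h"
  unfolding rho_mu_def
  by (rule cSUP_upper) (use assms finite_measure.bounded_measure[OF mu_finite] in \<open>auto intro!: bdd_aboveI[of _ "measure \<mu> (space \<mu>)"]\<close>)

lemma rho_mu_nonneg: "0 \<le> rho_mu \<mu> h"
  by (rule order_trans[OF measure_nonneg measure_window_le_rho[of 1]]) simp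

lemma rho_mu_lessE:
  assumes "b < rho_mu \<mu> h" obtains \<xi> where "cmod \<xi> = 1" "b < measure \<mu> (carleson_window \<xi> h)"
proof -
  have "sphere (0::complex) 1 \<noteq> {}" by simp
  then have "\<exists>\<xi>\<in>sphere 0 1. b < measure \<mu> (carleson_window \<xi> h)"
    using assms unfolding rho_mu_def
    by (subst (asm) less_cSUP_iff) (use finite_measure.bounded_measure[OF mu_finite] in \<open>auto intro!: bdd_aboveI[of _ "measure \<mu> (space \<mu>)"]\<close>)
  then show ?thesis using that by auto
qed

lemma rho_mu_le_K_mu:
  assumes "K_mu \<mu> h \<le> ereal k" "0 < t" "t \<le> h" shows "rho_mu \<mu> t \<le> k * t"
proof -
  have "ereal (rho_mu \<mu> t / t) \<le> K_mu \<mu> h" unfolding K_mu_def by (rule SUP_upper) (use assms in auto)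
  then have "ereal (rho_mu \<mu> t / t) \<le> ereal k" using assms(1) by (rule order_trans)
  then show ?thesis using assms(2) by (simp add: field_simps)
qed

text \<open>About 7 / h windows of size h cover the circle, each of measure at most c * h for small
  h, so the circle has measure at most 7 * c for every c > 0.\<close>

lemma sphere_null_of_rho_smallo:
  assumes "rho_mu \<mu> \<in> o[at_right 0](\<lambda>h. h)"
  shows "emeasure \<mu> (sphere 0 1) = 0"
proof -
  interpret finite_measure \<mu> by (rule mu_finite)
  have S: "sphere (0::complex) 1 \<in> sets \<mu>" by (intro borel_in_sets) auto
  have le: "measure \<mu> (sphere 0 1) \<le> 7 * c" if c: "0 < c" for c
  proof -
    have "eventually (\<lambda>h. norm (rho_mu \<mu> h) \<le> c * norm h) (at_right 0)"
      using assms c by (rule landau_o.smallD)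
    then obtain b where b: "0 < b" "\<And>h. 0 < h \<Longrightarrow> h < b \<Longrightarrow> \<bar>rho_mu \<mu> h\<bar> \<le> c * \<bar>h\<bar>"
      unfolding eventually_at_right_field by auto
    obtain N :: nat where N: "7 / b < real N" using reals_Archimedean2 by blast
    have N0: "0 < real N" using N b by (smt (verit) divide_pos_pos)
    \<comment> \<open>Since 7 > 2 * pi, the spacing 2 * pi / N of the centres is smaller than the
      angular half-width h.\<close>
    define h where "h = 7 / real N"
    have h: "0 < h" "h < b" using N N0 b by (auto simp: h_def field_simps)
    define \<xi> where "\<xi> = (\<lambda>k. cis (2 * pi * real k / real N))"
    have "sphere 0 1 \<subseteq> (\<Union>k<N. carleson_window (\<xi> k) h)"
    proof
      fix z :: complex assume "z \<in> sphere 0 1"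
      then have z: "cmod z = 1" by simp
      define \<theta> where "\<theta> = Arg2pi z"
      have \<theta>: "0 \<le> \<theta>" "\<theta> < 2 * pi" "z = rcis 1 \<theta>"
        using Arg2pi[of z] z by (auto simp: \<theta>_def is_Arg_def rcis_def cis_conv_exp)
      define y where "y = \<theta> * real N / (2 * pi)"
      define k where "k = nat \<lfloor>y\<rfloor>"
      have y: "0 \<le> y" "y < real N" using \<theta> N0 by (auto simp: y_def field_simps)
      then have k: "real k \<le> y" "y < real k + 1" unfolding k_def by linarith+
      have "k < N" using k y by linarith
      have "\<theta> = 2 * pi * y / real N" using N0 by (simp add: y_def)
      then have "\<theta> - 2 * pi * real k / real N = 2 * pi / real N * (y - real k)" by (simp add: algebra_simps diff_divide_distrib)
      moreover have "0 \<le> 2 * pi / real N * (y - real k)" using k N0 by simp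
      moreover have "2 * pi / real N * (y - real k) \<le> 2 * pi / real N * 1"
        using k N0 by (intro mult_left_mono) auto
      moreover have "2 * pi / real N < h" unfolding h_def using N0 pi_approx by (intro divide_strict_right_mono) auto
      ultimately have "\<bar>\<theta> - 2 * pi * real k / real N\<bar> < h" by linarith
      then have "z \<in> carleson_window (\<xi> k) h"
        unfolding \<xi>_def mem_carleson_window_cis using \<theta>(3) z h by auto
      then show "z \<in> (\<Union>k<N. carleson_window (\<xi> k) h)" using \<open>k < N\<close> by blast
    qed
    then have "measure \<mu> (sphere 0 1) \<le> measure \<mu> (\<Union>k<N. carleson_window (\<xi> k) h)"
      by (rule finite_measure_mono) (auto intro!: carleson_window_sets)
    also have "\<dots> \<le> (\<Sum>k<N. measure \<mu> (carleson_window (\<xi> k) h))"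
      by (rule finite_measure_subadditive_finite) (auto intro!: carleson_window_sets)
    also have "\<dots> \<le> (\<Sum>k<N. c * h)"
    proof (rule sum_mono)
      fix k
      have "measure \<mu> (carleson_window (\<xi> k) h) \<le> rho_mu \<mu> h"
        by (rule measure_window_le_rho) (simp add: \<xi>_def)
      also have "\<dots> \<le> c * h" using b(2)[OF h] h by simp
      finally show "measure \<mu> (carleson_window (\<xi> k) h) \<le> c * h" .
    qed
    also have "\<dots> = 7 * c" using N0 by (simp add: h_def)
    finally show ?thesis .
  qed
  have "measure \<mu> (sphere 0 1) \<le> 0"
  proof (rule field_le_epsilon)
    fix e :: real assume "0 < e"
    then show "measure \<mu> (sphere 0 1) \<le> 0 + e" using le[of "e / 7"] by simp
  qed
  then have "measure \<mu> (sphere 0 1) = 0" using measure_nonneg[of \<mu> "sphere 0 1"] by linarith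
  then show ?thesis by (simp add: emeasure_eq_measure)
qed

text \<open>The choice t = h in the supremum defining \<open>K_mu\<close> gives the bound on
  \<open>rho_mu\<close>; the factors h cancel.\<close>

lemma rho_smallo_of_K_smallo:
  assumes orl1: "orlicz_function \<Psi>1" and orl2: "orlicz_function \<Psi>2" and A: "0 < A"
    and K: "\<And>c. 0 < c \<Longrightarrow> eventually (\<lambda>h. K_mu \<mu> h \<le>
             ereal (c * ((1 / h) / \<Psi>2 (A * orlicz_inv \<Psi>1 (1 / h))))) (at_right 0)"
  shows "rho_mu \<mu> \<in> o[at_right 0](\<lambda>h. 1 / \<Psi>2 (A * orlicz_inv \<Psi>1 (1 / h)))"
proof (rule landau_o.smallI)
  fix c :: real assume c: "0 < c"
  show "\<forall>\<^sub>F h in at_right 0. norm (rho_mu \<mu> h) \<le> c * norm (1 / \<Psi>2 (A * orlicz_inv \<Psi>1 (1 / h)))"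
    using K[OF c] eventually_at_right_less[of "0::real"]
  proof eventually_elim
    case (elim h)
    from rho_mu_le_K_mu[OF elim(1) elim(2) order_refl] elim(2)
    have "rho_mu \<mu> h \<le> c * (1 / \<Psi>2 (A * orlicz_inv \<Psi>1 (1 / h)))" by simp
    moreover have "0 < \<Psi>2 (A * orlicz_inv \<Psi>1 (1 / h))"
      using elim(2) A by (intro orlicz_pos[OF orl2] mult_pos_pos orlicz_inv_pos[OF orl1]) auto
    ultimately show ?case using rho_mu_nonneg[of h] by simp
  qed
qed

text \<open>With \<Psi> x = 1 / h and \<Psi> y = 1 / t, the ratio inequality reads \<Psi> (A * x) *
  h <= \<Psi> (B * y) * t. The \<open>rho_mu\<close> bound at t with factor B is thus a bound on
  rho_mu t / t that no longer depends on t.\<close>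

lemma K_smallo_of_rho_smallo:
  assumes orl: "orlicz_function \<Psi>" and n: "nabla0 \<Psi>"
    and rho: "\<And>A. 0 < A \<Longrightarrow> rho_mu \<mu> \<in> o[at_right 0](\<lambda>h. 1 / \<Psi> (A * orlicz_inv \<Psi> (1 / h)))"
    and A: "0 < A" and c: "0 < c"
  shows "eventually (\<lambda>h. K_mu \<mu> h \<le> ereal (c * ((1 / h) / \<Psi> (A * orlicz_inv \<Psi> (1 / h))))) (at_right 0)"
proof -
  obtain x0 B where x0: "0 < x0" and B: "0 < B"
    and ratio: "\<And>x y. x0 \<le> x \<Longrightarrow> x \<le> y \<Longrightarrow> \<Psi> (A * x) / \<Psi> x \<le> \<Psi> (B * y) / \<Psi> y"
    using nabla0_ratio[OF orl n A] by blast
  have "eventually (\<lambda>h. norm (rho_mu \<mu> h) \<le> c * norm (1 / \<Psi> (B * orlicz_inv \<Psi> (1 / h)))) (at_right 0)"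
    using rho[OF B] c by (rule landau_o.smallD)
  then obtain b where b: "0 < b" "\<And>h. 0 < h \<Longrightarrow> h < b \<Longrightarrow>
      norm (rho_mu \<mu> h) \<le> c * norm (1 / \<Psi> (B * orlicz_inv \<Psi> (1 / h)))"
    unfolding eventually_at_right_field by auto
  show ?thesis unfolding eventually_at_right_field
  \<comment> \<open>h < 1 / \<Psi> x0 puts x in the range x0 <= x where the ratio inequality holds;
    h < b serves every t <= h.\<close>
  proof (intro exI[of _ "min b (1 / \<Psi> x0)"] conjI allI impI)
    show "0 < min b (1 / \<Psi> x0)" using b x0 orlicz_pos[OF orl] by simp
    fix h :: real assume h: "0 < h" "h < min b (1 / \<Psi> x0)"
    show "K_mu \<mu> h \<le> ereal (c * ((1 / h) / \<Psi> (A * orlicz_inv \<Psi> (1 / h))))"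
      unfolding K_mu_def
    proof (rule SUP_least)
      fix t assume "t \<in> {0<..h}"
      then have t: "0 < t" "t \<le> h" by auto
      define x y where "x = orlicz_inv \<Psi> (1 / h)" and "y = orlicz_inv \<Psi> (1 / t)"
      have \<Psi>x: "\<Psi> x = 1 / h" "\<Psi> y = 1 / t" using h t by (simp_all add: x_def y_def orlicz_orlicz_inv[OF orl])
      have "\<Psi> x0 \<le> 1 / h" using h x0 orlicz_pos[OF orl x0] by (simp add: field_simps)
      then have "x0 \<le> x" unfolding x_def using x0 h by (subst le_orlicz_inv_iff[OF orl]) auto
      moreover have "x \<le> y" unfolding x_def y_def using h t
        by (intro orlicz_inv_mono[OF orl]) (auto simp: field_simps)
      ultimately have r: "\<Psi> (A * x) * h \<le> \<Psi> (B * y) * t" using ratio[of x y] \<Psi>x by simp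
      have pos: "0 < \<Psi> (A * x)" "0 < \<Psi> (B * y)"
        using \<open>x0 \<le> x\<close> \<open>x \<le> y\<close> x0 A B by (auto intro!: orlicz_pos[OF orl])
      have "rho_mu \<mu> t \<le> c * (1 / \<Psi> (B * y))"
        using b(2)[of t] t h pos rho_mu_nonneg[of t] by (simp add: y_def)
      then have "rho_mu \<mu> t / t \<le> c * (1 / \<Psi> (B * y)) / t"
        using t by (intro divide_right_mono) auto
      also have "\<dots> = c * (1 / (\<Psi> (B * y) * t))" by simp
      also have "\<dots> \<le> c * (1 / (\<Psi> (A * x) * h))"
        using r pos h c t by (intro mult_left_mono divide_left_mono mult_pos_pos) auto
      also have "\<dots> = c * ((1 / h) / \<Psi> (A * x))" by simp
      finally show "ereal (rho_mu \<mu> t / t) \<le> ereal (c * ((1 / h) / \<Psi> (A * orlicz_inv \<Psi> (1 / h))))"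
        by (simp add: x_def)
    qed
  qed
qed

section \<open>Necessity of the window condition\<close>

text \<open>Two test functions of very different heights \<open>x a\<close>, \<open>x b\<close> far out in a convergent subsequence are
  close in norm, while on the window of the taller one they differ by at least \<open>x b / 18\<close>.\<close>

lemma rho_smallo_of_compact_embedding:
  assumes orl1: "orlicz_function \<Psi>1" and orl2: "orlicz_function \<Psi>2"
    and comp: "compact_embedding \<Psi>1 \<Psi>2 \<mu>" and A: "0 < A"
  shows "rho_mu \<mu> \<in> o[at_right 0](\<lambda>h. 1 / \<Psi>2 (A * orlicz_inv \<Psi>1 (1 / h)))"
proof (rule landau_o.smallI, rule ccontr)
  interpret finite_measure \<mu> by (rule mu_finite)
  fix c :: real assume c: "0 < c"
  let ?P = "\<lambda>h. norm (rho_mu \<mu> h) \<le> c * norm (1 / \<Psi>2 (A * orlicz_inv \<Psi>1 (1 / h)))"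
  assume "\<not> eventually ?P (at_right 0)"
  then have "\<exists>h>0. h < 1 / (real n + 1) \<and> \<not> ?P h" for n :: nat
    unfolding eventually_at_right_field by (metis add_nonneg_pos divide_pos_pos of_nat_0_le_iff zero_less_one)
  then obtain h where h: "\<And>n. 0 < h n" "\<And>n. h n < 1 / (real n + 1)" "\<And>n. \<not> ?P (h n)" by metis
  define x where "x = (\<lambda>n. orlicz_inv \<Psi>1 (1 / h n))"
  have h1: "h n \<le> 1" for n
  proof -
    have "1 / (real n + 1) \<le> 1" by simp
    then show ?thesis using h(2)[of n] by linarith
  qed
  have x0: "0 < x n" for n unfolding x_def using h(1) by (intro orlicz_inv_pos[OF orl1]) simp
  have x\<Psi>: "\<Psi>1 (x n) = 1 / h n" for n
    unfolding x_def using h(1)[of n] by (intro orlicz_orlicz_inv[OF orl1]) simp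
  have A\<Psi>: "0 < \<Psi>2 (A * x n)" for n using x0 A by (intro orlicz_pos[OF orl2]) simp
  have "c / \<Psi>2 (A * x n) < rho_mu \<mu> (h n)" for n
    using h(3)[of n] rho_mu_nonneg[of "h n"] A\<Psi>[of n] by (simp add: x_def not_le)
  then have "\<exists>\<xi>. cmod \<xi> = 1 \<and> c / \<Psi>2 (A * x n) < measure \<mu> (carleson_window \<xi> (h n))" for n
    by (metis rho_mu_lessE)
  then obtain \<xi> where \<xi>: "\<And>n. cmod (\<xi> n) = 1"
    "\<And>n. c / \<Psi>2 (A * x n) < measure \<mu> (carleson_window (\<xi> n) (h n))" by metis
  define F where "F = (\<lambda>n. carleson_test (x n) (h n) (\<xi> n))"
  have hyps: "0 \<le> x n" "0 < h n" "h n \<le> 1" "cmod (\<xi> n) = 1" for n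
    using x0[of n] h(1) h1 \<xi>(1) by auto
  have F: "F n \<in> hardy_orlicz \<Psi>1" "hardy_norm \<Psi>1 (F n) \<le> 1" for n
    unfolding F_def using carleson_test_hardy[OF hyps orl1 x\<Psi>] by auto
  then obtain s g where s: "strict_mono s" and g: "g \<in> orlicz_space \<Psi>2 \<mu>"
    and lim: "(\<lambda>k. lux_norm \<Psi>2 \<mu> (\<lambda>z. boundary_ext (F (s k)) z - g z)) \<longlonglongrightarrow> 0"
    using comp unfolding compact_embedding_def by meson
  have bF: "boundary_ext (F n) \<in> orlicz_space \<Psi>2 \<mu>" for n
    using comp F unfolding compact_embedding_def by blast
  \<comment> \<open>\<kappa> * c = c + 1 exceeds 1, which gives the final contradiction. \<epsilon>
    makes x b / (36 * \<epsilon>) = \<kappa> * A * x b, where 36 = 2 * 18: a gap of x b / 18 is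
    measured at scale 2 * \<epsilon>.\<close>
  define \<kappa> where "\<kappa> = 1 + 1 / c"
  define \<epsilon> where "\<epsilon> = 1 / (36 * A * \<kappa>)"
  have \<kappa>: "1 \<le> \<kappa>" using c by (simp add: \<kappa>_def)
  have \<epsilon>: "0 < \<epsilon>" using A \<kappa> by (simp add: \<epsilon>_def)
  have "eventually (\<lambda>k. lux_norm \<Psi>2 \<mu> (\<lambda>z. boundary_ext (F (s k)) z - g z) < \<epsilon>) sequentially"
    using lim \<epsilon> by (rule order_tendstoD)
  then obtain N where N: "\<And>k. N \<le> k \<Longrightarrow> lux_norm \<Psi>2 \<mu> (\<lambda>z. boundary_ext (F (s k)) z - g z) < \<epsilon>"
    unfolding eventually_sequentially by blast
  have close: "(\<integral>\<^sup>+ z. ennreal (\<Psi>2 (cmod (boundary_ext (F (s k)) z - g z) / \<epsilon>)) \<partial>\<mu>) \<le> 1" if "N \<le> k" for k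
    by (rule modular_le_1_of_lux_norm_less[OF orl2 orlicz_space_diff[OF orl2 bF g] N[OF that]])
  \<comment> \<open>One index is frozen before the other is sent far out; since h tends to 0, x b
    then exceeds 18 * x a. This leaves x b / 9 - x a >= x b / 18 on the window.\<close>
  define a where "a = s N"
  obtain k where k: "N \<le> k" "\<Psi>1 (18 * x a) \<le> real k"
    by (metis linear nat_le_real_less of_nat_le_iff order_trans real_arch_simple)
  define b where "b = s k"
  have "real k \<le> real b" unfolding b_def using s by (simp add: strict_mono_imp_increasing)
  also have "\<dots> \<le> 1 / h b" using h(1,2)[of b] by (simp add: field_simps)
  finally have xb: "18 * x a \<le> x b"
    using k(2) x0[of a] h(1)[of b] unfolding x_def
    by (subst le_orlicz_inv_iff[OF orl1]) auto
  let ?W = "carleson_window (\<xi> b) (h b)"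
  \<comment> \<open>The unknown limit g cancels: both functions are within \<epsilon> of it in the
    modular sense, so their difference is controlled at 2 * \<epsilon>.\<close>
  have "(\<integral>\<^sup>+ z. ennreal (\<Psi>2 (cmod ((boundary_ext (F b) z - g z) - (boundary_ext (F a) z - g z)) / (2 * \<epsilon>))) \<partial>\<mu>) \<le> 1"
    using orlicz_space_diff[OF orl2 bF g] close[OF k(1)] close[of N] \<epsilon>
    by (intro modular_diff_le_1[OF orl2]) (auto simp: orlicz_space_def a_def b_def)
  then have le1: "(\<integral>\<^sup>+ z. ennreal (\<Psi>2 (cmod (boundary_ext (F b) z - boundary_ext (F a) z) / (2 * \<epsilon>))) \<partial>\<mu>) \<le> 1"
    by simp
  have "(\<integral>\<^sup>+ z. ennreal (\<Psi>2 (x b / (36 * \<epsilon>))) * indicator ?W z \<partial>\<mu>)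
      \<le> (\<integral>\<^sup>+ z. ennreal (\<Psi>2 (cmod (boundary_ext (F b) z - boundary_ext (F a) z) / (2 * \<epsilon>))) \<partial>\<mu>)"
  proof (intro nn_integral_mono)
    fix z
    show "ennreal (\<Psi>2 (x b / (36 * \<epsilon>))) * indicator ?W z
        \<le> ennreal (\<Psi>2 (cmod (boundary_ext (F b) z - boundary_ext (F a) z) / (2 * \<epsilon>)))"
    proof (cases "z \<in> ?W")
      case True
      then have z: "cmod z \<le> 1" by (simp add: carleson_window_def)
      have "x b / 9 \<le> cmod (F b z)" unfolding F_def by (rule carleson_test_ge[OF hyps True])
      moreover have "cmod (F a z) \<le> x a" unfolding F_def by (rule carleson_test_le[OF hyps z])
      ultimately have "x b / 18 \<le> cmod (F b z - F a z)"
        using norm_triangle_ineq2[of "F b z" "F a z"] xb by linarith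
      then have "x b / (36 * \<epsilon>) \<le> cmod (F b z - F a z) / (2 * \<epsilon>)" using \<epsilon> by (simp add: field_simps)
      then have "\<Psi>2 (x b / (36 * \<epsilon>)) \<le> \<Psi>2 (cmod (F b z - F a z) / (2 * \<epsilon>))"
        using x0[of b] \<epsilon> by (intro orlicz_mono[OF orl2]) auto
      moreover have "boundary_ext (F n) z = F n z" for n
        unfolding F_def by (rule boundary_ext_carleson_test[OF hyps z])
      ultimately show ?thesis using True by (simp add: ennreal_leI)
    qed simp
  qed
  also note le1
  finally have "ennreal (\<Psi>2 (x b / (36 * \<epsilon>))) * emeasure \<mu> ?W \<le> 1"
    using carleson_window_sets by (simp add: nn_integral_cmult_indicator)
  then have "ennreal (\<Psi>2 (x b / (36 * \<epsilon>)) * measure \<mu> ?W) \<le> 1"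
    using x0[of b] \<epsilon> by (simp add: emeasure_eq_measure ennreal_mult orlicz_nonneg[OF orl2])
  then have "\<Psi>2 (x b / (36 * \<epsilon>)) * measure \<mu> ?W \<le> 1" by simp
  moreover have "x b / (36 * \<epsilon>) = \<kappa> * (A * x b)" using A \<kappa> by (simp add: \<epsilon>_def)
  then have "\<kappa> * \<Psi>2 (A * x b) \<le> \<Psi>2 (x b / (36 * \<epsilon>))"
    using orlicz_scale_ge[OF orl2 \<kappa>, of "A * x b"] A x0[of b] by simp
  ultimately have "\<kappa> * \<Psi>2 (A * x b) * measure \<mu> ?W \<le> 1"
    by (meson measure_nonneg mult_right_mono order_trans)
  moreover have "\<kappa> * \<Psi>2 (A * x b) * (c / \<Psi>2 (A * x b)) < \<kappa> * \<Psi>2 (A * x b) * measure \<mu> ?W"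
    using \<xi>(2)[of b] \<kappa> A\<Psi>[of b] by (intro mult_strict_left_mono) auto
  moreover have "\<kappa> * \<Psi>2 (A * x b) * (c / \<Psi>2 (A * x b)) = c + 1"
    using A\<Psi>[of b] c by (simp add: \<kappa>_def field_simps)
  ultimately show False using c by linarith
qed

end

section \<open>Superlevel sets of analytic functions\<close>

definition disc_part :: "(complex \<Rightarrow> complex) \<Rightarrow> complex \<Rightarrow> complex" where
  "disc_part f z = (if cmod z < 1 then f z else 0)"

text \<open>For u = 2 * y / \<tau> >= 1 the left side is u - 1 <= u^2, and convexity gives u^2 *
  \<Psi> (\<tau>^2) <= \<Psi> (u^2 * \<tau>^2). With y^2 = |G| this bounds the length of a selected
  arc by the modular of 4 * G.\<close>

lemma excess_le_orlicz_ratio: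
  assumes orl: "orlicz_function \<Psi>" and \<tau>: "0 < \<tau>" and y: "0 \<le> y"
  shows "2 / \<tau> * max 0 (y - \<tau> / 2) \<le> \<Psi> (4 * y\<^sup>2) / \<Psi> (\<tau>\<^sup>2)"
proof (cases "\<tau> / 2 \<le> y")
  case True
  define u where "u = 2 * y / \<tau>"
  have u: "1 \<le> u" using True \<tau> by (simp add: u_def field_simps)
  have \<Psi>\<tau>: "0 < \<Psi> (\<tau>\<^sup>2)" using \<tau> by (intro orlicz_pos[OF orl]) simp
  have "u * 1 \<le> u * u" using u by (intro mult_left_mono) auto
  then have "u * \<Psi> (\<tau>\<^sup>2) \<le> u\<^sup>2 * \<Psi> (\<tau>\<^sup>2)"
    using \<Psi>\<tau> by (intro mult_right_mono) (auto simp: power2_eq_square)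
  also have "\<dots> \<le> \<Psi> (u\<^sup>2 * \<tau>\<^sup>2)" using u by (intro orlicz_scale_ge[OF orl]) auto
  also have "u\<^sup>2 * \<tau>\<^sup>2 = 4 * y\<^sup>2" using \<tau> by (simp add: u_def power2_eq_square)
  finally have "u \<le> \<Psi> (4 * y\<^sup>2) / \<Psi> (\<tau>\<^sup>2)" using \<Psi>\<tau> by (simp add: field_simps)
  moreover have "2 / \<tau> * max 0 (y - \<tau> / 2) \<le> u"
    using True \<tau> by (simp add: u_def field_simps)
  ultimately show ?thesis by linarith
next
  case False
  then show ?thesis using orlicz_nonneg[OF orl, of "4 * y\<^sup>2"] orlicz_nonneg[OF orl, of "\<tau>\<^sup>2"] by simp
qed

text \<open>A geometric sum is at most twice its largest term. The extra bound 2 ^ N * b carried in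
  the induction is what makes room for the next term.\<close>

lemma sum_dyadic_below:
  fixes b Y :: real
  assumes b: "0 < b" and Y: "0 \<le> Y"
  shows "(\<Sum>j<N. if 2 ^ j * b < Y then 2 ^ j * b else 0) \<le> 2 * Y"
proof -
  have "(\<Sum>j<N. if 2 ^ j * b < Y then 2 ^ j * b else 0) \<le> min (2 * Y) (2 ^ N * b)"
  proof (induction N)
    case 0 then show ?case using b Y by simp
  next
    case (Suc N)
    show ?case
    proof (cases "2 ^ N * b < Y")
      case True
      then show ?thesis using Suc by (simp add: mult.commute)
    next
      case False
      then have "(\<Sum>j<Suc N. if 2 ^ j * b < Y then 2 ^ j * b else 0) \<le> min (2 * Y) (2 ^ N * b)"
        using Suc by simp
      also have "\<dots> \<le> min (2 * Y) (2 ^ Suc N * b)" using b by (intro min.mono) auto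
      finally show ?thesis .
    qed
  qed
  then show ?thesis by simp
qed

text \<open>The gain from the square root: with u = \<tau> / (2 * y) < 1, convexity yields \<Psi>
  (\<tau>^2) <= u^2 * \<Psi> (4 * y^2), while the excess factor costs only 1 / u. The surviving
  factor u is proportional to \<tau> and sums over the dyadic \<tau> below 2 * y. With \<Psi> \<tau>
  in place of \<Psi> (\<tau>^2) nothing would survive.\<close>

lemma sum_excess_le_orlicz:
  assumes orl: "orlicz_function \<Psi>" and b: "0 < b" and y: "0 \<le> y"
  shows "(\<Sum>j<N. \<Psi> ((2 ^ j * b)\<^sup>2) * (2 / (2 ^ j * b)) * max 0 (y - 2 ^ j * b / 2)) \<le> 2 * \<Psi> (4 * y\<^sup>2)"
proof (cases "y = 0")
  case True
  then show ?thesis using b by (simp add: orlicz_zero[OF orl])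
next
  case False
  with y have y: "0 < y" by simp
  let ?P = "\<Psi> (4 * y\<^sup>2)"
  have P: "0 \<le> ?P" by (intro orlicz_nonneg[OF orl]) simp
  have "(\<Sum>j<N. \<Psi> ((2 ^ j * b)\<^sup>2) * (2 / (2 ^ j * b)) * max 0 (y - 2 ^ j * b / 2))
      \<le> (\<Sum>j<N. ?P / (2 * y) * (if 2 ^ j * b < 2 * y then 2 ^ j * b else 0))"
  proof (rule sum_mono)
    fix j
    define \<tau> where "\<tau> = 2 ^ j * b"
    have \<tau>: "0 < \<tau>" using b by (simp add: \<tau>_def)
    have "\<Psi> (\<tau>\<^sup>2) * (2 / \<tau>) * max 0 (y - \<tau> / 2) \<le> ?P / (2 * y) * (if \<tau> < 2 * y then \<tau> else 0)"
    proof (cases "\<tau> < 2 * y")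
      case True
      define u where "u = \<tau> / (2 * y)"
      have u: "0 < u" "u \<le> 1" using True \<tau> y by (auto simp: u_def)
      have "\<Psi> (\<tau>\<^sup>2) = \<Psi> (u\<^sup>2 * (4 * y\<^sup>2))" using y by (simp add: u_def power2_eq_square)
      also have "\<dots> \<le> u\<^sup>2 * ?P" using u by (intro orlicz_scale_le[OF orl] power_le_one) auto
      finally have 1: "\<Psi> (\<tau>\<^sup>2) \<le> u\<^sup>2 * ?P" .
      have 2: "(2 / \<tau>) * max 0 (y - \<tau> / 2) \<le> 1 / u" using True \<tau> y by (simp add: u_def field_simps)
      have "\<Psi> (\<tau>\<^sup>2) * ((2 / \<tau>) * max 0 (y - \<tau> / 2)) \<le> u\<^sup>2 * ?P * (1 / u)"
        by (intro mult_mono 1 2) (use \<tau> P u in auto)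
      also have "\<dots> = ?P / (2 * y) * \<tau>" using u y \<tau> by (simp add: power2_eq_square) (simp add: u_def)
      finally show ?thesis using True by (simp add: mult.assoc)
    next
      case False
      then show ?thesis by simp
    qed
    then show "\<Psi> ((2 ^ j * b)\<^sup>2) * (2 / (2 ^ j * b)) * max 0 (y - 2 ^ j * b / 2)
      \<le> ?P / (2 * y) * (if 2 ^ j * b < 2 * y then 2 ^ j * b else 0)" unfolding \<tau>_def .
  qed
  also have "\<dots> = ?P / (2 * y) * (\<Sum>j<N. if 2 ^ j * b < 2 * y then 2 ^ j * b else 0)"
    by (rule sum_distrib_left[symmetric])
  also have "\<dots> \<le> ?P / (2 * y) * (2 * (2 * y))"
    using y P by (intro mult_left_mono sum_dyadic_below b) auto
  also have "\<dots> = 2 * ?P" using y by simp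
  finally show ?thesis .
qed

lemma nn_integral_le_of_liminf:
  fixes u :: "nat \<Rightarrow> 'a \<Rightarrow> ennreal"
  assumes "\<And>n. u n \<in> borel_measurable M" "\<And>n. (\<integral>\<^sup>+ x. u n x \<partial>M) \<le> B"
    and "\<And>x. x \<in> space M \<Longrightarrow> v x \<le> liminf (\<lambda>n. u n x)"
  shows "(\<integral>\<^sup>+ x. v x \<partial>M) \<le> B"
proof -
  have "(\<integral>\<^sup>+ x. v x \<partial>M) \<le> (\<integral>\<^sup>+ x. liminf (\<lambda>n. u n x) \<partial>M)" by (intro nn_integral_mono assms)
  also have "\<dots> \<le> liminf (\<lambda>n. \<integral>\<^sup>+ x. u n x \<partial>M)" by (intro nn_integral_liminf assms)
  also have "\<dots> \<le> B" by (intro Liminf_le) (auto simp: assms)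
  finally show ?thesis .
qed

context
  fixes \<mu> :: "complex measure"
  assumes mu_borel: "sets \<mu> = sets (restrict_space borel (cball (0::complex) 1))"
    and mu_finite: "finite_measure \<mu>"
begin

lemma borel_measurable_muI: "f \<in> borel_measurable borel \<Longrightarrow> f \<in> borel_measurable \<mu>"
  using measurable_restrict_space1[of f borel borel "cball 0 1"] measurable_cong_sets[OF mu_borel refl] by blast

lemma borel_measurable_continuous_cball:
  "continuous_on (cball 0 1) f \<Longrightarrow> f \<in> borel_measurable \<mu>"
  using borel_measurable_continuous_on_restrict[of "cball 0 1" f] measurable_cong_sets[OF mu_borel refl] by blast

lemma borel_measurable_disc_part:
  assumes "continuous_on (ball 0 1) f" shows "disc_part f \<in> borel_measurable \<mu>"
proof -
  have "(\<lambda>z. if z \<in> ball 0 1 then f z else 0) \<in> borel_measurable borel"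
    by (intro borel_measurable_continuous_on_if assms) auto
  moreover have "(\<lambda>z. if z \<in> ball 0 1 then f z else 0) = disc_part f"
    by (auto simp: disc_part_def fun_eq_iff)
  ultimately show ?thesis using borel_measurable_muI by simp
qed

text \<open>The modular bound on G forces every selected interval to be short, so its window lies at
  a scale where \<open>K_mu\<close> is at most k; the stopping bound then applies with K = 2 * k,
  the 2 coming from the doubled windows.\<close>

lemma emeasure_superlevel_le:
  assumes orl: "orlicz_function \<Psi>"
    and cont: "continuous_on (cball 0 1) G" and hol: "G holomorphic_on ball 0 1"
    and I: "integral {0..2 * pi} (\<lambda>t. \<Psi> (4 * cmod (G (cis t)))) \<le> 2 * pi"
    and \<tau>: "0 < \<tau>" and k: "0 \<le> k" and K: "K_mu \<mu> (16 * pi / \<Psi> (\<tau>\<^sup>2)) \<le> ereal k"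
  shows "emeasure \<mu> {z \<in> space \<mu>. (256 * \<tau>)\<^sup>2 < cmod (disc_part G z)}
    \<le> ennreal (2 * k * (2 / \<tau>) * integral {-4 * pi..4 * pi} (\<lambda>t. max 0 (sqrt (cmod (G (cis t))) - \<tau> / 2)))"
proof -
  interpret finite_measure \<mu> by (rule mu_finite)
  define \<phi> where "\<phi> = (\<lambda>t. sqrt (cmod (G (cis t))))"
  let ?U = "\<lambda>n. dyadic_cover \<phi> \<tau> n (-4 * pi) (4 * pi)"
  have Gc: "continuous_on S (\<lambda>t. G (cis t))" for S
    by (intro continuous_on_compose2[OF cont] continuous_intros) auto
  have \<phi>c: "continuous_on S \<phi>" for S unfolding \<phi>_def by (intro continuous_intros Gc)
  have \<Psi>c: "continuous_on S (\<lambda>t. \<Psi> (4 * cmod (G (cis t))))" for S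
    by (intro continuous_on_orlicz[OF orl] continuous_intros Gc) auto
  have \<Psi>\<tau>: "0 < \<Psi> (\<tau>\<^sup>2)" using \<tau> by (intro orlicz_pos[OF orl]) simp
  have U: "dyadic_cover \<phi> \<tau> n a b \<in> sets \<mu>" for n a b
    by (intro borel_in_sets[OF mu_borel mu_finite] dyadic_cover_borel dyadic_cover_subset_cball)
  have "{z \<in> space \<mu>. (256 * \<tau>)\<^sup>2 < cmod (disc_part G z)} \<subseteq> (\<Union>n. ?U n)"
  proof
    fix z assume "z \<in> {z \<in> space \<mu>. (256 * \<tau>)\<^sup>2 < cmod (disc_part G z)}"
    then have l: "(256 * \<tau>)\<^sup>2 < cmod (disc_part G z)" by simp
    have z: "cmod z < 1"
    proof (rule ccontr)
      assume "\<not> cmod z < 1"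
      with l show False using zero_le_power2[of "256 * \<tau>"] by (simp add: disc_part_def)
    qed
    with l have "256 * \<tau> < sqrt (cmod (G z))" by (intro real_less_rsqrt) (simp add: disc_part_def)
    from mem_dyadic_cover_of_large[OF cont hol z \<tau> this] show "z \<in> (\<Union>n. ?U n)"
      unfolding \<phi>_def by blast
  qed
  then have "emeasure \<mu> {z \<in> space \<mu>. (256 * \<tau>)\<^sup>2 < cmod (disc_part G z)} \<le> emeasure \<mu> (\<Union>n. ?U n)"
    by (rule emeasure_mono) (use U in \<open>auto intro!: sets.countable_UN\<close>)
  also have "\<dots> = (SUP n. emeasure \<mu> (?U n))"
    by (rule SUP_emeasure_incseq[symmetric]) (auto intro: U incseq_dyadic_cover)
  also have "\<dots> \<le> ennreal (2 * k * (2 / \<tau>) * integral {-4 * pi..4 * pi} (\<lambda>t. max 0 (\<phi> t - \<tau> / 2)))"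
  proof (rule SUP_least, rule emeasure_dyadic_cover_le[where A = "-4 * pi" and B = "4 * pi"])
    fix a b assume ab: "-4 * pi \<le> a" "a < b" "b \<le> 4 * pi" and g: "\<tau> * (b - a) < integral {a..b} \<phi>"
    have "b - a \<le> (2 / \<tau>) * integral {a..b} (\<lambda>t. max 0 (\<phi> t - \<tau> / 2))"
      by (rule length_le_excess_integral[OF \<phi>c ab(2) g \<tau>])
    also have "\<dots> = integral {a..b} (\<lambda>t. (2 / \<tau>) * max 0 (\<phi> t - \<tau> / 2))" by simp
    also have "\<dots> \<le> integral {a..b} (\<lambda>t. \<Psi> (4 * cmod (G (cis t))) / \<Psi> (\<tau>\<^sup>2))"
    proof (rule integral_le)
      fix t
      show "(2 / \<tau>) * max 0 (\<phi> t - \<tau> / 2) \<le> \<Psi> (4 * cmod (G (cis t))) / \<Psi> (\<tau>\<^sup>2)"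
        using excess_le_orlicz_ratio[OF orl \<tau>, of "\<phi> t"] by (simp add: \<phi>_def)
    qed (use \<Psi>\<tau> in \<open>intro integrable_continuous_real continuous_intros \<phi>c \<Psi>c; simp\<close>)+
    also have "\<dots> \<le> integral {-4 * pi..4 * pi} (\<lambda>t. \<Psi> (4 * cmod (G (cis t))) / \<Psi> (\<tau>\<^sup>2))"
    proof (rule integral_subset_le)
      show "\<forall>t\<in>{-4 * pi..4 * pi}. 0 \<le> \<Psi> (4 * cmod (G (cis t))) / \<Psi> (\<tau>\<^sup>2)"
        using \<Psi>\<tau> by (intro ballI divide_nonneg_nonneg orlicz_nonneg[OF orl]) auto
    qed (use \<Psi>\<tau> ab in \<open>(auto intro!: integrable_continuous_real continuous_intros \<Psi>c)\<close>)
    also have "\<dots> = integral {-4 * pi..4 * pi} (\<lambda>t. \<Psi> (4 * cmod (G (cis t)))) / \<Psi> (\<tau>\<^sup>2)" by simp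
    also have "integral {-4 * pi..4 * pi} (\<lambda>t. \<Psi> (4 * cmod (G (cis t)))) = 4 * integral {0..2 * pi} (\<lambda>t. \<Psi> (4 * cmod (G (cis t))))"
    proof (rule integral_four_periods[OF \<Psi>c])
      fix t
      have "cis (t + 2 * pi) = cis t" by (simp add: complex_eq_iff)
      then show "\<Psi> (4 * cmod (G (cis (t + 2 * pi)))) = \<Psi> (4 * cmod (G (cis t)))" by simp
    qed
    also have "4 * integral {0..2 * pi} (\<lambda>t. \<Psi> (4 * cmod (G (cis t)))) / \<Psi> (\<tau>\<^sup>2) \<le> 4 * (2 * pi) / \<Psi> (\<tau>\<^sup>2)"
      using I \<Psi>\<tau> by (intro divide_right_mono) auto
    \<comment> \<open>16 * pi collects 2 * pi from the modular bound, 4 from the number of periods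
      and 2 from the doubled window.\<close>
    finally have len: "2 * (b - a) \<le> 16 * pi / \<Psi> (\<tau>\<^sup>2)" by simp
    have "measure \<mu> (carleson_window (cis ((a + b) / 2)) (2 * (b - a))) \<le> rho_mu \<mu> (2 * (b - a))"
      by (rule measure_window_le_rho[OF mu_borel mu_finite]) simp
    also have "\<dots> \<le> k * (2 * (b - a))"
      by (rule rho_mu_le_K_mu[OF mu_borel mu_finite K _ len]) (use ab in simp)
    finally show "emeasure \<mu> (carleson_window (cis ((a + b) / 2)) (2 * (b - a))) \<le> ennreal (2 * k * (b - a))"
      by (simp add: emeasure_eq_measure ennreal_leI mult_ac)
  qed (use U \<phi>c \<tau> k in auto)
  finally show ?thesis unfolding \<phi>_def .
qed

text \<open>On the level \<open>4 ^ k < cmod G \<le> 4 ^ (k + 1)\<close> the relevant windows have size at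
  most \<open>16 * pi / \<Psi>1 (\<tau>\<^sup>2)\<close> with \<open>\<tau> = 2 ^ k / 256\<close>, so the hypothesis on \<open>K_mu\<close> trades the factor
  \<open>\<Psi>2 (4 ^ (k + 1) / \<epsilon>)\<close> for \<open>\<Psi>1 (\<tau>\<^sup>2)\<close>, and the sum over \<open>k\<close> is controlled by
  \<open>sum_excess_le_orlicz\<close>.\<close>

lemma large_part_small_cball:
  assumes orl1: "orlicz_function \<Psi>1" and orl2: "orlicz_function \<Psi>2"
    and Kc: "\<And>A c. 0 < A \<Longrightarrow> 0 < c \<Longrightarrow> eventually (\<lambda>h. K_mu \<mu> h \<le>
             ereal (c * ((1 / h) / \<Psi>2 (A * orlicz_inv \<Psi>1 (1 / h))))) (at_right 0)"
    and \<epsilon>: "0 < \<epsilon>" and c: "0 < c"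
  obtains k0 where "\<And>G. continuous_on (cball 0 1) G \<Longrightarrow> G holomorphic_on ball 0 1 \<Longrightarrow>
      integral {0..2 * pi} (\<lambda>t. \<Psi>1 (4 * cmod (G (cis t)))) \<le> 2 * pi \<Longrightarrow>
      (\<integral>\<^sup>+ z. (if 4 ^ k0 < cmod (disc_part G z) then ennreal (\<Psi>2 (cmod (disc_part G z) / \<epsilon>)) else 0) \<partial>\<mu>)
        \<le> ennreal (2 * c)"
proof -
  \<comment> \<open>256^2 undoes the scaling in \<tau>, 4 passes from the lower to the upper end of
    a level, and 51 > 16 * pi absorbs the constant in the window size.\<close>
  define A where "A = 4 * 51 * 256\<^sup>2 / \<epsilon>"
  have A: "0 < A" using \<epsilon> by (simp add: A_def)
  obtain b where b: "0 < b" and Kb: "\<And>h. 0 < h \<Longrightarrow> h < b \<Longrightarrow>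
      K_mu \<mu> h \<le> ereal (c * ((1 / h) / \<Psi>2 (A * orlicz_inv \<Psi>1 (1 / h))))"
    using Kc[OF A c] unfolding eventually_at_right_field by auto
  obtain x0 where x0: "0 \<le> x0" "\<And>x. 0 \<le> x \<Longrightarrow> x \<le> x0 + \<Psi>1 x"
    using le_orlicz_plus_const[OF orl1] by blast
  \<comment> \<open>Once \<tau> >= R >= 1, also \<tau>^2 >= R, and the affine bound gives \<Psi>1
    (\<tau>^2) > 16 * pi / b. Hence all windows from level k0 on have size below b.\<close>
  define R where "R = x0 + 16 * pi / b + 1"
  have R: "1 \<le> R" using x0 b by (simp add: R_def)
  obtain k0 :: nat where k0: "256 * R < 2 ^ k0" using real_arch_pow[of 2 "256 * R"] by auto
  define \<tau> where "\<tau> = (\<lambda>k::nat. 2 ^ k / 256 :: real)"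
  have \<tau>: "0 < \<tau> k" for k by (simp add: \<tau>_def)
  define h where "h = (\<lambda>k. 16 * pi / \<Psi>1 ((\<tau> k)\<^sup>2))"
  define \<kappa> where "\<kappa> = (\<lambda>k. c * ((1 / h k) / \<Psi>2 (A * orlicz_inv \<Psi>1 (1 / h k))))"
  have \<Psi>\<tau>: "0 < \<Psi>1 ((\<tau> k)\<^sup>2)" for k using \<tau>[of k] by (intro orlicz_pos[OF orl1]) simp
  have h0: "0 < h k" for k using \<Psi>\<tau>[of k] by (simp add: h_def)
  have \<Psi>2pos: "0 < \<Psi>2 (A * orlicz_inv \<Psi>1 (1 / h k))" for k
    using h0[of k] A by (intro orlicz_pos[OF orl2] mult_pos_pos orlicz_inv_pos[OF orl1]) auto
  have \<kappa>0: "0 \<le> \<kappa> k" for k using h0[of k] \<Psi>2pos[of k] c by (simp add: \<kappa>_def)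
  have K\<kappa>: "K_mu \<mu> (h k) \<le> ereal (\<kappa> k)" if "k0 \<le> k" for k
    unfolding \<kappa>_def
  proof (rule Kb[OF h0])
    have "(2::real) ^ k0 \<le> 2 ^ k" using that by (intro power_increasing) auto
    then have "256 * R < 2 ^ k" using k0 by linarith
    then have R\<tau>: "R \<le> \<tau> k" by (simp add: \<tau>_def)
    have "\<tau> k * 1 \<le> \<tau> k * \<tau> k" using R R\<tau> by (intro mult_left_mono) auto
    then have "R \<le> (\<tau> k)\<^sup>2" using R\<tau> by (simp add: power2_eq_square)
    then have "16 * pi / b < \<Psi>1 ((\<tau> k)\<^sup>2)" using x0(2)[of "(\<tau> k)\<^sup>2"] by (simp add: R_def)
    then show "h k < b" using b \<Psi>\<tau>[of k] by (simp add: h_def field_simps)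
  qed
  have \<Psi>2\<kappa>: "\<Psi>2 (4 ^ Suc k / \<epsilon>) * \<kappa> k \<le> c / (16 * pi) * \<Psi>1 ((\<tau> k)\<^sup>2)" for k
  proof -
    \<comment> \<open>Convexity allows 16 * pi to be traded for a smaller argument of \<Psi>1; the
      lost factor 51 is recovered from A.\<close>
    have "\<Psi>1 (1 / 51 * (\<tau> k)\<^sup>2) \<le> 1 / 51 * \<Psi>1 ((\<tau> k)\<^sup>2)" by (intro orlicz_scale_le[OF orl1]) auto
    also have "\<dots> \<le> 1 / (16 * pi) * \<Psi>1 ((\<tau> k)\<^sup>2)"
      using \<Psi>\<tau>[of k] pi_approx by (intro mult_right_mono divide_left_mono) auto
    also have "\<dots> = 1 / h k" by (simp add: h_def)
    finally have "1 / 51 * (\<tau> k)\<^sup>2 \<le> orlicz_inv \<Psi>1 (1 / h k)"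
      using h0[of k] by (subst le_orlicz_inv_iff[OF orl1]) auto
    then have "A * (1 / 51 * (\<tau> k)\<^sup>2) \<le> A * orlicz_inv \<Psi>1 (1 / h k)" using A by (intro mult_left_mono) auto
    moreover have "A * (1 / 51 * (\<tau> k)\<^sup>2) = 4 ^ Suc k / \<epsilon>"
    proof -
      have "((2::real) ^ k)\<^sup>2 = 4 ^ k" by (simp add: power2_eq_square flip: power_mult_distrib)
      then show ?thesis by (simp add: A_def \<tau>_def power_divide)
    qed
    ultimately have "\<Psi>2 (4 ^ Suc k / \<epsilon>) \<le> \<Psi>2 (A * orlicz_inv \<Psi>1 (1 / h k))"
      using \<epsilon> by (intro orlicz_mono[OF orl2]) auto
    then have "\<Psi>2 (4 ^ Suc k / \<epsilon>) * \<kappa> k \<le> \<Psi>2 (A * orlicz_inv \<Psi>1 (1 / h k)) * \<kappa> k"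
      using \<kappa>0 by (rule mult_right_mono)
    also have "\<dots> = c * (1 / h k)" using \<Psi>2pos[of k] by (simp add: \<kappa>_def)
    also have "\<dots> = c / (16 * pi) * \<Psi>1 ((\<tau> k)\<^sup>2)" by (simp add: h_def)
    finally show ?thesis .
  qed
  show ?thesis
  proof (rule that[of k0])
    fix G assume cont: "continuous_on (cball 0 1) G" and hol: "G holomorphic_on ball 0 1"
      and I: "integral {0..2 * pi} (\<lambda>t. \<Psi>1 (4 * cmod (G (cis t)))) \<le> 2 * pi"
    let ?D = "disc_part G"
    have Dm [measurable]: "?D \<in> borel_measurable \<mu>"
      by (intro borel_measurable_disc_part continuous_on_subset[OF cont]) auto
    define \<phi> where "\<phi> = (\<lambda>t. sqrt (cmod (G (cis t))))"
    have Gc: "continuous_on S (\<lambda>t. G (cis t))" for S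
      by (intro continuous_on_compose2[OF cont] continuous_intros) auto
    have \<phi>c: "continuous_on S \<phi>" for S unfolding \<phi>_def by (intro continuous_intros Gc)
    have \<Psi>c: "continuous_on S (\<lambda>t. \<Psi>1 (4 * cmod (G (cis t))))" for S
      by (intro continuous_on_orlicz[OF orl1] continuous_intros Gc) auto
    define E where "E = (\<lambda>k. integral {-4 * pi..4 * pi} (\<lambda>t. max 0 (\<phi> t - \<tau> k / 2)))"
    have E0: "0 \<le> E k" for k unfolding E_def
      by (intro integral_nonneg integrable_continuous_real continuous_intros \<phi>c) auto
    let ?S = "\<lambda>j. {z \<in> space \<mu>. 4 ^ (k0 + j) < cmod (?D z)}"
    have S [measurable]: "?S j \<in> sets \<mu>" for j by measurable
    have level: "emeasure \<mu> (?S j) \<le> ennreal (2 * \<kappa> (k0 + j) * (2 / \<tau> (k0 + j)) * E (k0 + j))" for j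
    proof -
      have "(256 * \<tau> k)\<^sup>2 = 4 ^ k" for k by (simp add: \<tau>_def power2_eq_square flip: power_mult_distrib)
      then show ?thesis
        using emeasure_superlevel_le[OF orl1 cont hol I \<tau> \<kappa>0 K\<kappa>[unfolded h_def], of "k0 + j"]
        by (simp add: E_def \<phi>_def)
    qed
    have "(\<integral>\<^sup>+ z. (if 4 ^ k0 < cmod (?D z) then ennreal (\<Psi>2 (cmod (?D z) / \<epsilon>)) else 0) \<partial>\<mu>)
        \<le> (\<integral>\<^sup>+ z. (\<Sum>j. ennreal (\<Psi>2 (4 ^ Suc (k0 + j) / \<epsilon>)) * indicator (?S j) z) \<partial>\<mu>)"
    proof (rule nn_integral_mono)
      fix z assume z: "z \<in> space \<mu>"
      show "(if 4 ^ k0 < cmod (?D z) then ennreal (\<Psi>2 (cmod (?D z) / \<epsilon>)) else 0)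
          \<le> (\<Sum>j. ennreal (\<Psi>2 (4 ^ Suc (k0 + j) / \<epsilon>)) * indicator (?S j) z)"
      proof (cases "4 ^ k0 < cmod (?D z)")
        case True
        \<comment> \<open>The least such j is the level of z, and its term alone dominates the
          integrand. For j = 0 the lower bound is the case assumption, otherwise it is
          minimality.\<close>
        let ?P = "\<lambda>j. cmod (?D z) \<le> 4 ^ Suc (k0 + j)"
        obtain N where "cmod (?D z) < 4 ^ N" using real_arch_pow[of 4 "cmod (?D z)"] by auto
        also have "(4::real) ^ N \<le> 4 ^ Suc (k0 + N)" by (intro power_increasing) auto
        finally have "?P N" by simp
        then have P: "?P (Least ?P)" by (rule LeastI)
        define j where "j = Least ?P"
        have "4 ^ (k0 + j) < cmod (?D z)"
        proof (cases j)
          case 0 then show ?thesis using True by simp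
        next
          case (Suc i)
          then have "\<not> ?P i" unfolding j_def by (metis lessI not_less_Least)
          then show ?thesis using Suc by simp
        qed
        then have zj: "z \<in> ?S j" using z by simp
        have "ennreal (\<Psi>2 (cmod (?D z) / \<epsilon>)) \<le> ennreal (\<Psi>2 (4 ^ Suc (k0 + j) / \<epsilon>))"
          using P \<epsilon> unfolding j_def by (intro ennreal_leI orlicz_mono[OF orl2] divide_right_mono) auto
        also have "\<dots> = (\<Sum>i\<in>{j}. ennreal (\<Psi>2 (4 ^ Suc (k0 + i) / \<epsilon>)) * indicator (?S i) z)"
          using zj by simp
        also have "\<dots> \<le> (\<Sum>i. ennreal (\<Psi>2 (4 ^ Suc (k0 + i) / \<epsilon>)) * indicator (?S i) z)"
          by (rule sum_le_suminf) auto
        finally show ?thesis using True by simp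
      qed simp
    qed
    also have "\<dots> = (\<Sum>j. \<integral>\<^sup>+ z. ennreal (\<Psi>2 (4 ^ Suc (k0 + j) / \<epsilon>)) * indicator (?S j) z \<partial>\<mu>)"
      by (rule nn_integral_suminf) measurable
    also have "\<dots> = (\<Sum>j. ennreal (\<Psi>2 (4 ^ Suc (k0 + j) / \<epsilon>)) * emeasure \<mu> (?S j))"
      by (intro suminf_cong nn_integral_cmult_indicator S)
    also have "\<dots> \<le> ennreal (2 * c)"
    proof (rule suminf_le_const)
      fix N
      define B where "B = 2 ^ k0 / (256::real)"
      have \<tau>B: "\<tau> (k0 + j) = 2 ^ j * B" for j by (simp add: \<tau>_def B_def power_add)
      let ?T = "\<lambda>j t. \<Psi>1 ((2 ^ j * B)\<^sup>2) * (2 / (2 ^ j * B)) * max 0 (\<phi> t - 2 ^ j * B / 2)"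
      have Ti: "?T j integrable_on {-4 * pi..4 * pi}" for j
        by (intro integrable_continuous_real continuous_intros \<phi>c)
      have "(\<Sum>j<N. ennreal (\<Psi>2 (4 ^ Suc (k0 + j) / \<epsilon>)) * emeasure \<mu> (?S j))
          \<le> (\<Sum>j<N. ennreal (c / (8 * pi) * integral {-4 * pi..4 * pi} (?T j)))"
      proof (rule sum_mono)
        fix j
        let ?k = "k0 + j"
        have "ennreal (\<Psi>2 (4 ^ Suc ?k / \<epsilon>)) * emeasure \<mu> (?S j)
            \<le> ennreal (\<Psi>2 (4 ^ Suc ?k / \<epsilon>)) * ennreal (2 * \<kappa> ?k * (2 / \<tau> ?k) * E ?k)"
          by (intro mult_left_mono level) simp
        also have "\<dots> = ennreal (\<Psi>2 (4 ^ Suc ?k / \<epsilon>) * (2 * \<kappa> ?k * (2 / \<tau> ?k) * E ?k))"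
          using \<epsilon> \<kappa>0[of ?k] \<tau>[of ?k] E0[of ?k] by (intro ennreal_mult[symmetric] orlicz_nonneg[OF orl2] mult_nonneg_nonneg) auto
        also have "\<dots> \<le> ennreal (c / (8 * pi) * integral {-4 * pi..4 * pi} (?T j))"
        proof (rule ennreal_leI)
          have "\<Psi>2 (4 ^ Suc ?k / \<epsilon>) * (2 * \<kappa> ?k * (2 / \<tau> ?k) * E ?k)
              = (\<Psi>2 (4 ^ Suc ?k / \<epsilon>) * \<kappa> ?k) * (2 * (2 / \<tau> ?k) * E ?k)" by (simp only: mult_ac)
          also have "\<dots> \<le> (c / (16 * pi) * \<Psi>1 ((\<tau> ?k)\<^sup>2)) * (2 * (2 / \<tau> ?k) * E ?k)"
            using \<tau>[of ?k] E0[of ?k] by (intro mult_right_mono \<Psi>2\<kappa>) auto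
          also have "\<dots> = c / (8 * pi) * (\<Psi>1 ((\<tau> ?k)\<^sup>2) * (2 / \<tau> ?k) * E ?k)" by simp
          also have "\<Psi>1 ((\<tau> ?k)\<^sup>2) * (2 / \<tau> ?k) * E ?k = integral {-4 * pi..4 * pi} (?T j)"
            unfolding E_def \<tau>B by simp
          finally show "\<Psi>2 (4 ^ Suc ?k / \<epsilon>) * (2 * \<kappa> ?k * (2 / \<tau> ?k) * E ?k)
              \<le> c / (8 * pi) * integral {-4 * pi..4 * pi} (?T j)" .
        qed
        finally show "ennreal (\<Psi>2 (4 ^ Suc ?k / \<epsilon>)) * emeasure \<mu> (?S j)
            \<le> ennreal (c / (8 * pi) * integral {-4 * pi..4 * pi} (?T j))" .
      qed
      also have "\<dots> = ennreal (\<Sum>j<N. c / (8 * pi) * integral {-4 * pi..4 * pi} (?T j))"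
      proof (rule sum_ennreal)
        fix j
        show "0 \<le> c / (8 * pi) * integral {-4 * pi..4 * pi} (?T j)"
          using c by (intro mult_nonneg_nonneg integral_nonneg Ti orlicz_nonneg[OF orl1]) (auto simp: B_def)
      qed
      also have "(\<Sum>j<N. c / (8 * pi) * integral {-4 * pi..4 * pi} (?T j))
          = c / (8 * pi) * integral {-4 * pi..4 * pi} (\<lambda>t. \<Sum>j<N. ?T j t)"
        using Ti by (subst integral_sum) (auto simp: sum_distrib_left)
      also have "ennreal \<dots> \<le> ennreal (2 * c)"
      proof (rule ennreal_leI)
        \<comment> \<open>Twice the modular over four periods, each at most 2 * pi, is 16 * pi; the
          prefactor c / (8 * pi) turns this into 2 * c, uniformly in N.\<close>
        have "integral {-4 * pi..4 * pi} (\<lambda>t. \<Sum>j<N. ?T j t) \<le> integral {-4 * pi..4 * pi} (\<lambda>t. 2 * \<Psi>1 (4 * cmod (G (cis t))))"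
        proof (rule integral_le)
          fix t
          have "(\<Sum>j<N. ?T j t) \<le> 2 * \<Psi>1 (4 * (\<phi> t)\<^sup>2)"
            by (rule sum_excess_le_orlicz[OF orl1]) (auto simp: B_def \<phi>_def)
          then show "(\<Sum>j<N. ?T j t) \<le> 2 * \<Psi>1 (4 * cmod (G (cis t)))" by (simp add: \<phi>_def)
        qed (intro integrable_sum integrable_continuous_real continuous_intros \<Psi>c Ti finite_lessThan)+
        also have "\<dots> = 2 * integral {-4 * pi..4 * pi} (\<lambda>t. \<Psi>1 (4 * cmod (G (cis t))))" by simp
        also have "integral {-4 * pi..4 * pi} (\<lambda>t. \<Psi>1 (4 * cmod (G (cis t)))) = 4 * integral {0..2 * pi} (\<lambda>t. \<Psi>1 (4 * cmod (G (cis t))))"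
        proof (rule integral_four_periods[OF \<Psi>c])
          fix t
          have "cis (t + 2 * pi) = cis t" by (simp add: complex_eq_iff)
          then show "\<Psi>1 (4 * cmod (G (cis (t + 2 * pi)))) = \<Psi>1 (4 * cmod (G (cis t)))" by simp
        qed
        also have "2 * (4 * integral {0..2 * pi} (\<lambda>t. \<Psi>1 (4 * cmod (G (cis t))))) \<le> 16 * pi" using I by simp
        finally have "c / (8 * pi) * integral {-4 * pi..4 * pi} (\<lambda>t. \<Sum>j<N. ?T j t) \<le> c / (8 * pi) * (16 * pi)"
          using c by (intro mult_left_mono) auto
        then show "c / (8 * pi) * integral {-4 * pi..4 * pi} (\<lambda>t. \<Sum>j<N. ?T j t) \<le> 2 * c" by simp
      qed
      finally show "(\<Sum>j<N. ennreal (\<Psi>2 (4 ^ Suc (k0 + j) / \<epsilon>)) * emeasure \<mu> (?S j)) \<le> ennreal (2 * c)" .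
    qed simp
    finally show "(\<integral>\<^sup>+ z. (if 4 ^ k0 < cmod (?D z) then ennreal (\<Psi>2 (cmod (?D z) / \<epsilon>)) else 0) \<partial>\<mu>)
        \<le> ennreal (2 * c)" .
  qed
qed

end

section \<open>Hardy-Orlicz functions and their boundary values\<close>

lemma hardy_slice_continuous:
  assumes "f holomorphic_on ball 0 1" "0 \<le> r" "r < 1"
  shows "continuous_on S (\<lambda>t. f (of_real r * cis t))"
  by (rule continuous_on_compose2[OF holomorphic_on_imp_continuous_on[OF assms(1)]])
    (use assms in \<open>auto intro!: continuous_intros simp: norm_mult\<close>)

lemma hardy_modular_le:
  assumes orl: "orlicz_function \<Psi>" and f: "f \<in> hardy_orlicz \<Psi>" and C: "hardy_norm \<Psi> f < C" "0 < C"
    and r: "0 \<le> r" "r < 1"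
  shows "integral {0..2 * pi} (\<lambda>t. \<Psi> (cmod (f (of_real r * cis t)) / C)) \<le> 2 * pi"
proof -
  have hol: "f holomorphic_on ball 0 1" using f by (simp add: hardy_orlicz_def)
  have "lux_norm \<Psi> circle_measure (\<lambda>t. f (of_real r * cis t)) \<le> hardy_norm \<Psi> f"
    unfolding hardy_norm_def by (rule cSUP_upper) (use f r in \<open>auto simp: hardy_orlicz_def\<close>)
  then have "lux_norm \<Psi> circle_measure (\<lambda>t. f (of_real r * cis t)) < C" using C by simp
  then have 1: "(\<integral>\<^sup>+ t. ennreal (\<Psi> (cmod (f (of_real r * cis t)) / C)) \<partial>circle_measure) \<le> 1"
    by (intro modular_le_1_of_lux_norm_less[OF orl]) (use f r in \<open>auto simp: hardy_orlicz_def\<close>)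
  have c: "continuous_on UNIV (\<lambda>t. \<Psi> (cmod (f (of_real r * cis t)) / C))"
    by (intro continuous_on_orlicz[OF orl] continuous_intros hardy_slice_continuous hol r) (use C in auto)
  have "ennreal (integral {0..2 * pi} (\<lambda>t. \<Psi> (cmod (f (of_real r * cis t)) / C)) / (2 * pi)) \<le> 1"
    using 1 C by (subst nn_integral_circle_measure[OF c, symmetric]) (auto intro!: orlicz_nonneg[OF orl])
  then show ?thesis by (simp add: field_simps)
qed

text \<open>Cauchy's formula on a circle between K and the unit circle bounds f on K by a mean of
  |f|, and |f| <= 2 * (x0 + \<Psi> (|f| / 2)) turns that mean into the modular. The bound is the
  same for all f, as Montel's theorem requires.\<close>

lemma locally_bounded_of_modular:
  assumes orl: "orlicz_function \<Psi>" and K: "compact K" "K \<subseteq> ball 0 1"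
  obtains B where "\<And>f z. f holomorphic_on ball 0 1 \<Longrightarrow>
      (\<And>r. 0 \<le> r \<Longrightarrow> r < 1 \<Longrightarrow> integral {0..2 * pi} (\<lambda>t. \<Psi> (cmod (f (of_real r * cis t)) / 2)) \<le> 2 * pi) \<Longrightarrow>
      z \<in> K \<Longrightarrow> cmod (f z) \<le> B"
proof -
  obtain x0 where x0: "0 \<le> x0" "\<And>x. 0 \<le> x \<Longrightarrow> x \<le> x0 + \<Psi> x"
    using le_orlicz_plus_const[OF orl] by blast
  obtain \<rho> where \<rho>: "0 < \<rho>" "\<rho> < 1" "K \<subseteq> cball 0 \<rho>"
  proof (cases "K = {}")
    case True then show ?thesis using that[of "1 / 2"] by auto
  next
    case False
    have "continuous_on K cmod" by (intro continuous_intros)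
    from continuous_attains_sup[OF K(1) False this] obtain w where w: "w \<in> K" "\<And>z. z \<in> K \<Longrightarrow> cmod z \<le> cmod w" by blast
    then have "cmod w < 1" using K by auto
    show ?thesis
    proof (rule that[of "(1 + cmod w) / 2"])
      show "0 < (1 + cmod w) / 2" by (simp add: add_pos_nonneg)
      show "(1 + cmod w) / 2 < 1" using \<open>cmod w < 1\<close> by simp
      show "K \<subseteq> cball 0 ((1 + cmod w) / 2)"
      proof
        fix z assume "z \<in> K"
        from w(2)[OF this] \<open>cmod w < 1\<close> have "cmod z \<le> (1 + cmod w) / 2" by argo
        then show "z \<in> cball 0 ((1 + cmod w) / 2)" by simp
      qed
    qed
  qed
  define r where "r = (1 + \<rho>) / 2"
  have r: "0 < r" "r < 1" "\<rho> < r" using \<rho> by (auto simp: r_def)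
  \<comment> \<open>After the circle of radius r is rescaled to radius 1, points of K have modulus
    at most q, so the Cauchy denominator stays above 1 - q.\<close>
  define q where "q = \<rho> / r"
  have q: "0 < q" "q < 1" using \<rho> r by (auto simp: q_def)
  show ?thesis
  proof (rule that[of "2 * (x0 + 1) / (1 - q)"])
    fix f z assume hol: "f holomorphic_on ball 0 1" and z: "z \<in> K"
      and mod: "\<And>r. 0 \<le> r \<Longrightarrow> r < 1 \<Longrightarrow> integral {0..2 * pi} (\<lambda>t. \<Psi> (cmod (f (of_real r * cis t)) / 2)) \<le> 2 * pi"
    define H where "H = (\<lambda>w. f (of_real r * w))"
    define w where "w = z / of_real r"
    have wq: "cmod w \<le> q" using z \<rho> r by (auto simp: w_def q_def norm_divide intro!: divide_right_mono)
    have sub: "of_real r * v \<in> ball 0 1" if "cmod v \<le> 1" for v :: complex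
    proof -
      have "r * cmod v \<le> r * 1" using that r by (intro mult_left_mono) auto
      then have "r * cmod v < 1" using r by linarith
      then show ?thesis using r by (simp add: norm_mult)
    qed
    have Hc: "continuous_on (cball 0 1) H" unfolding H_def
      by (rule continuous_on_compose2[OF holomorphic_on_imp_continuous_on[OF hol]])
        (use sub in \<open>auto intro!: continuous_intros\<close>)
    have Hh: "H holomorphic_on ball 0 1" unfolding H_def
      by (rule holomorphic_on_compose_gen[OF _ hol, unfolded o_def]) (use sub in \<open>auto intro!: holomorphic_intros\<close>)
    have Hcis: "continuous_on S (\<lambda>t. H (cis t))" for S
      by (intro continuous_on_compose2[OF Hc] continuous_intros) auto
    have C: "((\<lambda>t. H (cis t) / (1 - w * cis (- t))) has_integral complex_of_real (2 * pi) * H w) {0..2 * pi}"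
      by (rule Cauchy_integral_cis[OF Hc Hh]) (use wq q in simp)
    have \<Psi>c: "continuous_on S (\<lambda>t. \<Psi> (cmod (H (cis t)) / 2))" for S
      by (intro continuous_on_orlicz[OF orl] continuous_intros Hcis) auto
    have "2 * pi * cmod (H w) = norm (integral {0..2 * pi} (\<lambda>t. H (cis t) / (1 - w * cis (- t))))"
      using integral_unique[OF C] by (simp add: norm_mult)
    also have "\<dots> \<le> integral {0..2 * pi} (\<lambda>t. 2 / (1 - q) * (x0 + \<Psi> (cmod (H (cis t)) / 2)))"
    proof (rule integral_norm_bound_integral)
      show "(\<lambda>t. H (cis t) / (1 - w * cis (- t))) integrable_on {0..2 * pi}" using C by blast
      show "(\<lambda>t. 2 / (1 - q) * (x0 + \<Psi> (cmod (H (cis t)) / 2))) integrable_on {0..2 * pi}"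
        by (intro integrable_continuous_real continuous_intros \<Psi>c)
      fix t
      have "1 - q \<le> cmod (1 - w * cis (- t))"
        using norm_triangle_ineq2[of 1 "w * cis (- t)"] wq by (simp add: norm_mult)
      moreover have "cmod (H (cis t)) \<le> 2 * (x0 + \<Psi> (cmod (H (cis t)) / 2))"
        using x0(2)[of "cmod (H (cis t)) / 2"] by simp
      ultimately have "cmod (H (cis t)) / cmod (1 - w * cis (- t)) \<le> 2 * (x0 + \<Psi> (cmod (H (cis t)) / 2)) / (1 - q)"
        using q x0(1) orlicz_nonneg[OF orl, of "cmod (H (cis t)) / 2"] by (intro frac_le) auto
      then show "norm (H (cis t) / (1 - w * cis (- t))) \<le> 2 / (1 - q) * (x0 + \<Psi> (cmod (H (cis t)) / 2))"
        by (simp add: norm_divide)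
    qed
    also have "\<dots> = 2 / (1 - q) * (2 * pi * x0 + integral {0..2 * pi} (\<lambda>t. \<Psi> (cmod (H (cis t)) / 2)))"
    proof -
      have "integral {0..2 * pi} (\<lambda>t. x0 + \<Psi> (cmod (H (cis t)) / 2))
          = integral {0..2 * pi} (\<lambda>t. x0) + integral {0..2 * pi} (\<lambda>t. \<Psi> (cmod (H (cis t)) / 2))"
        by (intro integral_add integrable_continuous_real \<Psi>c continuous_intros)
      then have "integral {0..2 * pi} (\<lambda>t. x0 + \<Psi> (cmod (H (cis t)) / 2))
          = 2 * pi * x0 + integral {0..2 * pi} (\<lambda>t. \<Psi> (cmod (H (cis t)) / 2))" by simp
      then show ?thesis by (metis integral_mult_right)
    qed
    also have "\<dots> \<le> 2 / (1 - q) * (2 * pi * x0 + 2 * pi)"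
      using mod[of r] r q by (intro mult_left_mono add_left_mono) (auto simp: H_def)
    also have "\<dots> = 2 * pi * (2 * (x0 + 1) / (1 - q))"
      by (simp add: algebra_simps add_divide_distrib)
    finally have "cmod (H w) \<le> 2 * (x0 + 1) / (1 - q)" by (rule mult_left_le_imp_le) simp
    then show "cmod (f z) \<le> 2 * (x0 + 1) / (1 - q)" using r by (simp add: H_def w_def)
  qed
qed

text \<open>Restricting to rational radii makes the existence of the radial limit a Borel condition on \<open>z\<close>.\<close>

lemma radial_limit_iff_rational_Cauchy:
  fixes f :: "complex \<Rightarrow> complex"
  assumes cont: "continuous_on (ball 0 1) f" and z: "cmod z \<le> 1"
  shows "(\<exists>l. ((\<lambda>r. f (of_real r * z)) \<longlongrightarrow> l) (at_left 1)) \<longleftrightarrow>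
    (\<forall>n::nat. \<exists>m::nat. \<forall>p q :: rat. 1 - 1 / (real m + 1) < of_rat p \<and> p < 1 \<and> 1 - 1 / (real m + 1) < of_rat q \<and> q < 1 \<longrightarrow>
      dist (f (of_real (of_rat p) * z)) (f (of_real (of_rat q) * z)) \<le> 1 / (real n + 1))"
    (is "?L \<longleftrightarrow> ?R")
proof
  assume ?L
  then obtain l where l: "((\<lambda>r. f (of_real r * z)) \<longlongrightarrow> l) (at_left 1)" by blast
  show ?R
  proof
    fix n :: nat
    have "eventually (\<lambda>r. dist (f (of_real r * z)) l < 1 / (2 * (real n + 1))) (at_left 1)"
      by (rule tendstoD[OF l]) simp
    then obtain b where b: "b < 1" "\<And>r. b < r \<Longrightarrow> r < 1 \<Longrightarrow> dist (f (of_real r * z)) l < 1 / (2 * (real n + 1))"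
      unfolding eventually_at_left_field by auto
    obtain m :: nat where m: "1 / (1 - b) < real m" using reals_Archimedean2 by blast
    then have mb: "b < 1 - 1 / (real m + 1)" using b(1) by (simp add: field_simps)
    show "\<exists>m. \<forall>p q :: rat. 1 - 1 / (real m + 1) < of_rat p \<and> p < 1 \<and> 1 - 1 / (real m + 1) < of_rat q \<and> q < 1 \<longrightarrow>
      dist (f (of_real (of_rat p) * z)) (f (of_real (of_rat q) * z)) \<le> 1 / (real n + 1)"
    proof (intro exI[of _ m] allI impI)
      fix p q :: rat
      assume pq: "1 - 1 / (real m + 1) < of_rat p \<and> p < 1 \<and> 1 - 1 / (real m + 1) < of_rat q \<and> q < 1"
      then have lt: "(of_rat p :: real) < 1" "(of_rat q :: real) < 1" by (auto simp: of_rat_less_1_iff)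
      have gt: "b < of_rat p" "b < of_rat q" using pq mb by linarith+
      have "dist (f (of_real (of_rat p) * z)) l < 1 / (2 * (real n + 1))"
        "dist (f (of_real (of_rat q) * z)) l < 1 / (2 * (real n + 1))"
        by (rule b(2)[OF gt(1) lt(1)], rule b(2)[OF gt(2) lt(2)])
      then have "dist (f (of_real (of_rat p) * z)) (f (of_real (of_rat q) * z)) < 1 / (2 * (real n + 1)) + 1 / (2 * (real n + 1))"
        by (meson add_strict_mono dist_triangle2 le_less_trans)
      also have "\<dots> = 1 / (real n + 1)" by (simp add: field_simps)
      finally show "dist (f (of_real (of_rat p) * z)) (f (of_real (of_rat q) * z)) \<le> 1 / (real n + 1)" by simp
    qed
  qed
next
  assume R: ?R
  let ?g = "\<lambda>r. f (of_real r * z)"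
  have gc: "isCont ?g r" if "0 \<le> r" "r < 1" for r
  proof -
    have "r * cmod z \<le> r * 1" using that z by (intro mult_left_mono) auto
    then have "of_real r * z \<in> ball 0 1" using that by (simp add: norm_mult)
    then have "isCont f (of_real r * z)" using cont by (simp add: continuous_on_eq_continuous_at)
    then show ?thesis by (intro isCont_o2[of _ "\<lambda>r. of_real r * z" f] continuous_intros)
  qed
  have real: "\<exists>b<1. \<forall>r s. b < r \<and> r < 1 \<and> b < s \<and> s < 1 \<longrightarrow> dist (?g r) (?g s) \<le> 1 / (real n + 1)" for n :: nat
  proof -
    from R obtain m :: nat where m: "\<And>p q :: rat. 1 - 1 / (real m + 1) < of_rat p \<Longrightarrow> p < 1 \<Longrightarrow>
      1 - 1 / (real m + 1) < of_rat q \<Longrightarrow> q < 1 \<Longrightarrow>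
      dist (?g (of_rat p)) (?g (of_rat q)) \<le> 1 / (real n + 1)" by blast
    define b where "b = 1 - 1 / (real m + 1)"
    have b: "0 \<le> b" "b < 1" by (auto simp: b_def field_simps)
    \<comment> \<open>Rational radii tending to r carry the estimate over to all real radii, by
      continuity along the ray.\<close>
    have approx: "\<exists>P. (\<forall>k. b < of_rat (P k) \<and> P k < 1) \<and> (\<lambda>k. ?g (of_rat (P k))) \<longlonglongrightarrow> ?g r" if r: "b < r" "r < 1" for r
    proof -
      have "\<exists>p :: rat. max b (r - 1 / (real k + 1)) < of_rat p \<and> of_rat p < r" for k :: nat
        using r by (intro of_rat_dense) auto
      then obtain P :: "nat \<Rightarrow> rat" where P: "\<And>k. max b (r - 1 / (real k + 1)) < of_rat (P k)" "\<And>k. of_rat (P k) < r" by metis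
      have "(\<lambda>k. r - 1 / (real k + 1)) \<longlonglongrightarrow> r - 0"
        by (intro tendsto_diff tendsto_const) (use LIMSEQ_inverse_real_of_nat in \<open>simp add: inverse_eq_divide add.commute\<close>)
      then have "(\<lambda>k. of_rat (P k) :: real) \<longlonglongrightarrow> r"
        by (intro tendsto_sandwich[of "\<lambda>k. r - 1 / (real k + 1)" "\<lambda>k. of_rat (P k)" _ "\<lambda>_. r"])
          (use P in \<open>auto intro!: always_eventually less_imp_le\<close>)
      then have "(\<lambda>k. ?g (of_rat (P k))) \<longlonglongrightarrow> ?g r"
        using isCont_tendsto_compose[OF gc[of r]] r b by simp
      moreover have "P k < 1" for k
      proof -
        have "(of_rat (P k) :: real) < 1" using P(2)[of k] r by linarith
        then show ?thesis by (simp add: of_rat_less_1_iff)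
      qed
      ultimately show ?thesis using P by (intro exI[of _ P]) auto
    qed
    have "dist (?g r) (?g s) \<le> 1 / (real n + 1)" if rs: "b < r" "r < 1" "b < s" "s < 1" for r s
    proof -
      obtain P where P: "\<And>k. b < of_rat (P k) \<and> P k < 1" "(\<lambda>k. ?g (of_rat (P k))) \<longlonglongrightarrow> ?g r" using approx[OF rs(1,2)] by blast
      obtain Q where Q: "\<And>k. b < of_rat (Q k) \<and> Q k < 1" "(\<lambda>k. ?g (of_rat (Q k))) \<longlonglongrightarrow> ?g s" using approx[OF rs(3,4)] by blast
      show ?thesis
        by (rule tendsto_upperbound[OF tendsto_dist[OF P(2) Q(2)]])
          (use P(1) Q(1) m in \<open>auto simp: b_def intro!: always_eventually\<close>)
    qed
    then show ?thesis using b by blast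
  qed
  \<comment> \<open>One fixed sequence of radii supplies the candidate limit; the Cauchy estimate
    then compares it with every radius near 1.\<close>
  define S where "S = (\<lambda>k. 1 - 1 / (real k + 2))"
  have S1: "S k < 1" for k by (simp add: S_def)
  have S: "S \<longlonglongrightarrow> 1"
    unfolding S_def by real_asymp
  have "Cauchy (\<lambda>k. ?g (S k))"
  proof (rule metric_CauchyI)
    fix e :: real assume "0 < e"
    then obtain n :: nat where n: "1 / (real n + 1) < e" using nat_approx_posE by (metis of_nat_Suc add.commute)
    obtain b where b: "b < 1" "\<And>r s. b < r \<and> r < 1 \<and> b < s \<and> s < 1 \<Longrightarrow> dist (?g r) (?g s) \<le> 1 / (real n + 1)" using real[of n] by blast
    obtain M where M: "\<And>k. M \<le> k \<Longrightarrow> b < S k" using order_tendstoD(1)[OF S b(1)] unfolding eventually_sequentially by blast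
    show "\<exists>M. \<forall>m\<ge>M. \<forall>n\<ge>M. dist (?g (S m)) (?g (S n)) < e"
    proof (intro exI[of _ M] allI impI)
      fix i j assume "M \<le> i" "M \<le> j"
      then have "dist (?g (S i)) (?g (S j)) \<le> 1 / (real n + 1)" using M S1 by (intro b(2)) auto
      then show "dist (?g (S i)) (?g (S j)) < e" using n by simp
    qed
  qed
  then obtain l where l: "(\<lambda>k. ?g (S k)) \<longlonglongrightarrow> l" using Cauchy_convergent convergent_def by blast
  have "(?g \<longlongrightarrow> l) (at_left 1)"
  proof (rule tendstoI)
    fix e :: real assume "0 < e"
    then obtain n :: nat where n: "1 / (real n + 1) < e" using nat_approx_posE by (metis of_nat_Suc add.commute)
    obtain b where b: "b < 1" "\<And>r s. b < r \<and> r < 1 \<and> b < s \<and> s < 1 \<Longrightarrow> dist (?g r) (?g s) \<le> 1 / (real n + 1)" using real[of n] by blast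
    have "dist (?g r) l < e" if r: "b < r" "r < 1" for r
    proof -
      have "dist (?g r) l \<le> 1 / (real n + 1)"
      proof (rule tendsto_upperbound[OF tendsto_dist[OF tendsto_const l]])
        show "\<forall>\<^sub>F k in sequentially. dist (?g r) (?g (S k)) \<le> 1 / (real n + 1)"
          using order_tendstoD(1)[OF S b(1)]
        proof eventually_elim
          case (elim k)
          then show ?case using b(2)[of r "S k"] r S1[of k] by simp
        qed
      qed simp
      then show ?thesis using n by simp
    qed
    then show "eventually (\<lambda>r. dist (?g r) l < e) (at_left 1)"
      unfolding eventually_at_left_field using b(1) by blast
  qed
  then show ?L by blast
qed

context
  fixes \<mu> :: "complex measure"
  assumes mu_borel: "sets \<mu> = sets (restrict_space borel (cball (0::complex) 1))"
    and mu_finite: "finite_measure \<mu>"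
begin

text \<open>The measure may be incomplete, so agreement with \<open>disc_part f\<close> off a null
  set would not give measurability. The rational Cauchy criterion makes the existence of the radial
  limit a countable combination of measurable conditions, and where the limit exists one fixed
  sequence of radii computes it.\<close>

lemma borel_measurable_boundary_ext:
  assumes cont: "continuous_on (ball 0 1) f"
  shows "boundary_ext f \<in> borel_measurable \<mu>"
proof -
  \<comment> \<open>The default 0 makes \<open>U p\<close> measurable for every real p. Radii tested
    by the criterion lie in [0, 1), where the default is not taken.\<close>
  define U where "U = (\<lambda>p z. if 0 \<le> p \<and> p < 1 then f (of_real p * z) else 0)"
  have U [measurable]: "U p \<in> borel_measurable \<mu>" for p
  proof (cases "0 \<le> p \<and> p < 1")
    case True
    have "of_real p * z \<in> ball 0 1" if "z \<in> cball 0 1" for z :: complex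
    proof -
      have "p * cmod z \<le> p * 1" using that True by (intro mult_left_mono) auto
      then show ?thesis using True by (simp add: norm_mult)
    qed
    then have "continuous_on (cball 0 1) (\<lambda>z. f (of_real p * z))"
      by (intro continuous_on_compose2[OF cont] continuous_intros) auto
    then show ?thesis using True borel_measurable_continuous_cball[OF mu_borel mu_finite] by (simp add: U_def)
  next
    case False
    then have "U p = (\<lambda>_. 0)" by (auto simp: U_def fun_eq_iff)
    then show ?thesis by simp
  qed
  have D [measurable]: "disc_part f \<in> borel_measurable \<mu>"
    by (rule borel_measurable_disc_part[OF mu_borel mu_finite cont])
  define Q where "Q = (\<lambda>z. \<forall>n::nat. \<exists>m::nat. \<forall>p q :: rat. 1 - 1 / (real m + 1) < of_rat p \<and> p < 1 \<and> 1 - 1 / (real m + 1) < of_rat q \<and> q < 1 \<longrightarrow>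
      dist (U (of_rat p) z) (U (of_rat q) z) \<le> 1 / (real n + 1))"
  have [measurable]: "Measurable.pred \<mu> Q" unfolding Q_def by measurable
  have "(\<lambda>z. if cmod z < 1 then disc_part f z else if Q z then lim (\<lambda>k. U (1 - 1 / (real k + 2)) z) else 0) \<in> borel_measurable \<mu>"
  proof -
    have "cmod \<in> borel_measurable \<mu>" by (intro borel_measurable_muI[OF mu_borel mu_finite]) simp
    then have [measurable]: "Measurable.pred \<mu> (\<lambda>z. cmod z < 1)" by measurable
    show ?thesis by measurable
  qed
  moreover have "(if cmod z < 1 then disc_part f z else if Q z then lim (\<lambda>k. U (1 - 1 / (real k + 2)) z) else 0) = boundary_ext f z"
    if z: "z \<in> space \<mu>" for z
  proof -
    have z1: "cmod z \<le> 1" using z by (simp add: space_eq_cball[OF mu_borel mu_finite])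
    have Ueq: "U (of_rat p) z = f (of_real (of_rat p) * z)" if "1 - 1 / (real m + 1) < of_rat p" "p < 1" for p and m :: nat
    proof -
      have "(0::real) \<le> 1 - 1 / (real m + 1)" by (simp add: field_simps)
      then have "(0::real) \<le> of_rat p" using that(1) by linarith
      then show ?thesis using that by (simp add: U_def of_rat_less_1_iff)
    qed
    have "Q z \<longleftrightarrow> (\<exists>l. ((\<lambda>r. f (of_real r * z)) \<longlongrightarrow> l) (at_left 1))"
      unfolding radial_limit_iff_rational_Cauchy[OF cont z1] Q_def
      by (intro all_cong1 ex_cong1) (metis Ueq)
    moreover have "lim (\<lambda>k. U (1 - 1 / (real k + 2)) z) = Lim (at_left 1) (\<lambda>r. f (of_real r * z))"
      if "((\<lambda>r. f (of_real r * z)) \<longlongrightarrow> l) (at_left 1)" for l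
    proof -
      have "filterlim (\<lambda>k. 1 - 1 / (real k + 2)) (at_left 1) sequentially" by real_asymp
      from filterlim_compose[OF that this] have "(\<lambda>k. f (of_real (1 - 1 / (real k + 2)) * z)) \<longlonglongrightarrow> l" .
      moreover have "U (1 - 1 / (real k + 2)) z = f (of_real (1 - 1 / (real k + 2)) * z)" for k
        by (simp add: U_def field_simps)
      ultimately have "lim (\<lambda>k. U (1 - 1 / (real k + 2)) z) = l" by (intro limI) simp
      moreover have "Lim (at_left 1) (\<lambda>r. f (of_real r * z)) = l"
        by (rule tendsto_Lim[OF _ that]) simp
      ultimately show ?thesis by simp
    qed
    ultimately show ?thesis by (auto simp: boundary_ext_def disc_part_def)
  qed
  ultimately show ?thesis by (subst measurable_cong[symmetric]) auto
qed

end

section \<open>Compactness\<close>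

context
  fixes \<mu> :: "complex measure" and \<Psi>1 \<Psi>2 :: "real \<Rightarrow> real"
  assumes mu_borel: "sets \<mu> = sets (restrict_space borel (cball (0::complex) 1))"
    and mu_finite: "finite_measure \<mu>"
    and orl1: "orlicz_function \<Psi>1" and orl2: "orlicz_function \<Psi>2"
    and Kc: "\<And>A c. 0 < A \<Longrightarrow> 0 < c \<Longrightarrow> eventually (\<lambda>h. K_mu \<mu> h \<le>
             ereal (c * ((1 / h) / \<Psi>2 (A * orlicz_inv \<Psi>1 (1 / h))))) (at_right 0)"
begin

text \<open>The modular of a dilate of g on the unit circle is the modular of g on a smaller circle,
  so the closed disc case applies to all dilates with the same k0. The strict inequality cutting out
  the large part is stable under small changes, which gives the pointwise lower bound for Fatou's
  lemma.\<close>

lemma large_part_small: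
  assumes \<epsilon>: "0 < \<epsilon>" and c: "0 < c"
  obtains k0 where "\<And>g. g holomorphic_on ball 0 1 \<Longrightarrow>
      (\<And>r. 0 \<le> r \<Longrightarrow> r < 1 \<Longrightarrow> integral {0..2 * pi} (\<lambda>t. \<Psi>1 (4 * cmod (g (of_real r * cis t)))) \<le> 2 * pi) \<Longrightarrow>
      (\<integral>\<^sup>+ z. (if 4 ^ k0 < cmod (disc_part g z) then ennreal (\<Psi>2 (cmod (disc_part g z) / \<epsilon>)) else 0) \<partial>\<mu>)
        \<le> ennreal (2 * c)"
proof -
  obtain k0 where k0: "\<And>G. continuous_on (cball 0 1) G \<Longrightarrow> G holomorphic_on ball 0 1 \<Longrightarrow>
      integral {0..2 * pi} (\<lambda>t. \<Psi>1 (4 * cmod (G (cis t)))) \<le> 2 * pi \<Longrightarrow>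
      (\<integral>\<^sup>+ z. (if 4 ^ k0 < cmod (disc_part G z) then ennreal (\<Psi>2 (cmod (disc_part G z) / \<epsilon>)) else 0) \<partial>\<mu>)
        \<le> ennreal (2 * c)"
    using large_part_small_cball[OF mu_borel mu_finite orl1 orl2 Kc \<epsilon> c] by blast
  show ?thesis
  proof (rule that[of k0])
    fix g assume hol: "g holomorphic_on ball 0 1"
      and mod: "\<And>r. 0 \<le> r \<Longrightarrow> r < 1 \<Longrightarrow> integral {0..2 * pi} (\<lambda>t. \<Psi>1 (4 * cmod (g (of_real r * cis t)))) \<le> 2 * pi"
    define R where "R = (\<lambda>n. 1 - 1 / (real n + 2))"
    have R: "0 \<le> R n" "R n < 1" for n by (auto simp: R_def field_simps)
    have R1: "R \<longlonglongrightarrow> 1" unfolding R_def by real_asymp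
    define G where "G = (\<lambda>n z. g (of_real (R n) * z))"
    have sub: "of_real (R n) * v \<in> ball 0 1" if "cmod v \<le> 1" for v :: complex and n
    proof -
      have "R n * cmod v \<le> R n * 1" using that R by (intro mult_left_mono) auto
      then show ?thesis using R[of n] by (simp add: norm_mult)
    qed
    have gc: "continuous_on (ball 0 1) g" by (rule holomorphic_on_imp_continuous_on[OF hol])
    have Gc: "continuous_on (cball 0 1) (G n)" for n unfolding G_def
      by (rule continuous_on_compose2[OF gc]) (use sub in \<open>auto intro!: continuous_intros\<close>)
    have Gh: "G n holomorphic_on ball 0 1" for n unfolding G_def
      by (rule holomorphic_on_compose_gen[OF _ hol, unfolded o_def]) (use sub in \<open>auto intro!: holomorphic_intros\<close>)
    have [measurable]: "disc_part (G n) \<in> borel_measurable \<mu>" for n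
      by (intro borel_measurable_disc_part[OF mu_borel mu_finite] continuous_on_subset[OF Gc]) auto
    have [measurable]: "(\<lambda>z. ennreal (\<Psi>2 (cmod (disc_part (G n) z) / \<epsilon>))) \<in> borel_measurable \<mu>" for n
      using \<epsilon> by (intro borel_measurable_modular[OF orl2]) auto
    show "(\<integral>\<^sup>+ z. (if 4 ^ k0 < cmod (disc_part g z) then ennreal (\<Psi>2 (cmod (disc_part g z) / \<epsilon>)) else 0) \<partial>\<mu>)
        \<le> ennreal (2 * c)"
    proof (rule nn_integral_le_of_liminf)
      fix n
      show "(\<integral>\<^sup>+ z. (if 4 ^ k0 < cmod (disc_part (G n) z) then ennreal (\<Psi>2 (cmod (disc_part (G n) z) / \<epsilon>)) else 0) \<partial>\<mu>)
          \<le> ennreal (2 * c)"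
        by (rule k0[OF Gc Gh]) (use mod R in \<open>simp add: G_def\<close>)
    next
      fix z
      show "(if 4 ^ k0 < cmod (disc_part g z) then ennreal (\<Psi>2 (cmod (disc_part g z) / \<epsilon>)) else 0)
        \<le> liminf (\<lambda>n. if 4 ^ k0 < cmod (disc_part (G n) z) then ennreal (\<Psi>2 (cmod (disc_part (G n) z) / \<epsilon>)) else 0)"
      proof (cases "4 ^ k0 < cmod (disc_part g z)")
        case True
        have z: "cmod z < 1"
        proof (rule ccontr)
          assume "\<not> cmod z < 1"
          with True show False using zero_le_power[of "4::real" k0] by (simp add: disc_part_def)
        qed
        have "isCont g z" using gc z by (simp add: continuous_on_eq_continuous_at)
        moreover have "(\<lambda>n. of_real (R n) * z) \<longlonglongrightarrow> of_real 1 * z" by (intro tendsto_intros R1)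
        ultimately have "(\<lambda>n. G n z) \<longlonglongrightarrow> g z" unfolding G_def by (intro isCont_tendsto_compose[of z g]) auto
        then have lim: "(\<lambda>n. cmod (disc_part (G n) z)) \<longlonglongrightarrow> cmod (disc_part g z)"
          using z by (auto simp: disc_part_def intro: tendsto_norm)
        have "(\<lambda>n. \<Psi>2 (cmod (disc_part (G n) z) / \<epsilon>)) \<longlonglongrightarrow> \<Psi>2 (cmod (disc_part g z) / \<epsilon>)"
          by (rule continuous_on_tendsto_compose[OF orlicz_continuous[OF orl2] tendsto_divide[OF lim tendsto_const]])
            (use \<epsilon> in auto)
        then have "(\<lambda>n. ennreal (\<Psi>2 (cmod (disc_part (G n) z) / \<epsilon>))) \<longlonglongrightarrow> ennreal (\<Psi>2 (cmod (disc_part g z) / \<epsilon>))"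
          by (rule tendsto_ennrealI)
        moreover have "eventually (\<lambda>n. ennreal (\<Psi>2 (cmod (disc_part (G n) z) / \<epsilon>)) =
            (if 4 ^ k0 < cmod (disc_part (G n) z) then ennreal (\<Psi>2 (cmod (disc_part (G n) z) / \<epsilon>)) else 0)) sequentially"
          using order_tendstoD(1)[OF lim True] by eventually_elim simp
        ultimately have "(\<lambda>n. if 4 ^ k0 < cmod (disc_part (G n) z) then ennreal (\<Psi>2 (cmod (disc_part (G n) z) / \<epsilon>)) else 0)
            \<longlonglongrightarrow> ennreal (\<Psi>2 (cmod (disc_part g z) / \<epsilon>))"
          by (rule Lim_transform_eventually)
        from lim_imp_Liminf[OF _ this] show ?thesis using True by simp
      qed simp
    qed measurable
  qed
qed

text \<open>Division by 4 * C normalises g so that 4 * |G| = |g| / C. The large part then has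
  integral at most 2, and the rest is bounded on a space of finite measure.\<close>

lemma disc_part_orlicz_space:
  assumes hol: "g holomorphic_on ball 0 1" and C: "0 < C"
    and mod: "\<And>r. 0 \<le> r \<Longrightarrow> r < 1 \<Longrightarrow> integral {0..2 * pi} (\<lambda>t. \<Psi>1 (cmod (g (of_real r * cis t)) / C)) \<le> 2 * pi"
  shows "disc_part g \<in> orlicz_space \<Psi>2 \<mu>"
proof -
  interpret finite_measure \<mu> by (rule mu_finite)
  define G where "G = (\<lambda>z. g z / of_real (4 * C))"
  obtain k0 where k0: "\<And>g. g holomorphic_on ball 0 1 \<Longrightarrow>
      (\<And>r. 0 \<le> r \<Longrightarrow> r < 1 \<Longrightarrow> integral {0..2 * pi} (\<lambda>t. \<Psi>1 (4 * cmod (g (of_real r * cis t)))) \<le> 2 * pi) \<Longrightarrow>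
      (\<integral>\<^sup>+ z. (if 4 ^ k0 < cmod (disc_part g z) then ennreal (\<Psi>2 (cmod (disc_part g z) / 1)) else 0) \<partial>\<mu>)
        \<le> ennreal (2 * 1)"
    using large_part_small[of 1 1] by auto
  have Gh: "G holomorphic_on ball 0 1" unfolding G_def using C by (intro holomorphic_intros hol) auto
  have nG: "cmod (G z) = cmod (g z) / (4 * C)" for z using C by (simp add: G_def norm_divide norm_mult)
  have nD: "cmod (disc_part G z) = cmod (disc_part g z) / (4 * C)" for z by (simp add: disc_part_def nG)
  have meas: "disc_part g \<in> borel_measurable \<mu>" and [measurable]: "disc_part G \<in> borel_measurable \<mu>"
    by (intro borel_measurable_disc_part[OF mu_borel mu_finite] holomorphic_on_imp_continuous_on hol Gh)+
  have [measurable]: "(\<lambda>z. ennreal (\<Psi>2 (cmod (disc_part G z) / 1))) \<in> borel_measurable \<mu>"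
    by (intro borel_measurable_modular[OF orl2]) auto
  have "(\<integral>\<^sup>+ z. ennreal (\<Psi>2 (cmod (disc_part g z) / (4 * C))) \<partial>\<mu>)
      \<le> (\<integral>\<^sup>+ z. (if 4 ^ k0 < cmod (disc_part G z) then ennreal (\<Psi>2 (cmod (disc_part G z) / 1)) else 0)
        + ennreal (\<Psi>2 (4 ^ k0)) \<partial>\<mu>)"
    by (intro nn_integral_mono) (auto simp: nD not_less intro!: ennreal_leI orlicz_mono[OF orl2] divide_nonneg_nonneg C[THEN less_imp_le])
  also have "\<dots> = (\<integral>\<^sup>+ z. (if 4 ^ k0 < cmod (disc_part G z) then ennreal (\<Psi>2 (cmod (disc_part G z) / 1)) else 0) \<partial>\<mu>)
      + (\<integral>\<^sup>+ z. ennreal (\<Psi>2 (4 ^ k0)) \<partial>\<mu>)"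
    by (intro nn_integral_add) auto
  also have "\<dots> \<le> ennreal (2 * 1) + ennreal (\<Psi>2 (4 ^ k0)) * emeasure \<mu> (space \<mu>)"
    by (intro add_mono k0 Gh) (use mod in \<open>simp_all add: nG\<close>)
  also have "\<dots> < \<infinity>" by (simp add: emeasure_eq_measure ennreal_mult_less_top)
  finally have fin: "(\<integral>\<^sup>+ z. ennreal (\<Psi>2 (cmod (disc_part g z) / (4 * C))) \<partial>\<mu>) < \<infinity>" .
  show ?thesis by (rule orlicz_spaceI[OF orl2 meas _ fin]) (use C in simp)
qed

lemma AE_boundary_ext_eq_disc_part:
  assumes "emeasure \<mu> (sphere 0 1) = 0" shows "AE z in \<mu>. boundary_ext f z = disc_part f z"
proof (rule AE_I[where N = "sphere 0 1"])
  show "{z \<in> space \<mu>. boundary_ext f z \<noteq> disc_part f z} \<subseteq> sphere 0 1"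
    by (auto simp: space_eq_cball[OF mu_borel mu_finite] boundary_ext_def disc_part_def)
  show "sphere 0 1 \<in> sets \<mu>" by (intro borel_in_sets[OF mu_borel mu_finite]) auto
qed (rule assms)

lemma boundary_ext_orlicz_space:
  assumes nul: "emeasure \<mu> (sphere 0 1) = 0" and f: "f \<in> hardy_orlicz \<Psi>1"
  shows "boundary_ext f \<in> orlicz_space \<Psi>2 \<mu>"
proof -
  define C where "C = max 0 (hardy_norm \<Psi>1 f) + 1"
  have C: "0 < C" "hardy_norm \<Psi>1 f < C" by (auto simp: C_def)
  have hol: "f holomorphic_on ball 0 1" using f by (simp add: hardy_orlicz_def)
  have "disc_part f \<in> orlicz_space \<Psi>2 \<mu>"
    by (rule disc_part_orlicz_space[OF hol C(1)]) (rule hardy_modular_le[OF orl1 f C(2,1)])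
  then obtain D where D: "0 < D" "(\<integral>\<^sup>+ z. ennreal (\<Psi>2 (cmod (disc_part f z) / D)) \<partial>\<mu>) \<le> 1"
    by (auto simp: orlicz_space_def)
  have "(\<integral>\<^sup>+ z. ennreal (\<Psi>2 (cmod (boundary_ext f z) / D)) \<partial>\<mu>) = (\<integral>\<^sup>+ z. ennreal (\<Psi>2 (cmod (disc_part f z) / D)) \<partial>\<mu>)"
    using AE_boundary_ext_eq_disc_part[OF nul, of f] by (intro nn_integral_cong_AE) (auto elim: AE_mp)
  with D borel_measurable_boundary_ext[OF mu_borel mu_finite holomorphic_on_imp_continuous_on[OF hol]]
  show ?thesis unfolding orlicz_space_def by auto
qed

text \<open>The large part contributes at most 1 / 2 for all k at once. On the rest the values are
  at most 4 ^ k0, and dominated convergence with a constant majorant brings that integral below 1 /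
  2.\<close>

lemma tendsto_lux_norm_of_pointwise:
  assumes d: "\<And>k. d k holomorphic_on ball 0 1"
    and mod: "\<And>k r. 0 \<le> r \<Longrightarrow> r < 1 \<Longrightarrow> integral {0..2 * pi} (\<lambda>t. \<Psi>1 (cmod (d k (of_real r * cis t)) / 4)) \<le> 2 * pi"
    and lim: "\<And>z. cmod z < 1 \<Longrightarrow> (\<lambda>k. d k z) \<longlonglongrightarrow> 0"
    and \<epsilon>: "0 < \<epsilon>"
  shows "eventually (\<lambda>k. (\<integral>\<^sup>+ z. ennreal (\<Psi>2 (cmod (disc_part (d k) z) / \<epsilon>)) \<partial>\<mu>) \<le> 1) sequentially"
proof -
  interpret finite_measure \<mu> by (rule mu_finite)
  \<comment> \<open>16 = 4 * 4: the modular bound is given for |d k| / 4, while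
    \<open>large_part_small\<close> asks for it at 4 * |G k|.\<close>
  define \<epsilon>' where "\<epsilon>' = \<epsilon> / 16"
  have \<epsilon>': "0 < \<epsilon>'" using \<epsilon> by (simp add: \<epsilon>'_def)
  define G where "G = (\<lambda>k z. d k z / 16)"
  obtain k0 where k0: "\<And>g. g holomorphic_on ball 0 1 \<Longrightarrow>
      (\<And>r. 0 \<le> r \<Longrightarrow> r < 1 \<Longrightarrow> integral {0..2 * pi} (\<lambda>t. \<Psi>1 (4 * cmod (g (of_real r * cis t)))) \<le> 2 * pi) \<Longrightarrow>
      (\<integral>\<^sup>+ z. (if 4 ^ k0 < cmod (disc_part g z) then ennreal (\<Psi>2 (cmod (disc_part g z) / \<epsilon>')) else 0) \<partial>\<mu>)
        \<le> ennreal (2 * (1 / 4))"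
    using large_part_small[OF \<epsilon>', of "1 / 4"] by auto
  have Gh: "G k holomorphic_on ball 0 1" for k unfolding G_def by (intro holomorphic_intros d) auto
  have nD: "cmod (disc_part (d k) z) / \<epsilon> = cmod (disc_part (G k) z) / \<epsilon>'" for k z
    by (simp add: disc_part_def G_def norm_divide \<epsilon>'_def)
  have [measurable]: "disc_part (G k) \<in> borel_measurable \<mu>" for k
    by (intro borel_measurable_disc_part[OF mu_borel mu_finite] holomorphic_on_imp_continuous_on Gh)
  have [measurable]: "(\<lambda>z. ennreal (\<Psi>2 (cmod (disc_part (G k) z) / \<epsilon>'))) \<in> borel_measurable \<mu>" for k
    using \<epsilon>' by (intro borel_measurable_modular[OF orl2]) auto
  define small where "small = (\<lambda>k z. ennreal (\<Psi>2 (min (cmod (disc_part (G k) z)) (4 ^ k0) / \<epsilon>')))"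
  have [measurable]: "small k \<in> borel_measurable \<mu>" for k unfolding small_def
    using \<epsilon>' by (intro measurable_compose[OF borel_measurable_orlicz[OF orl2] measurable_ennreal]) auto
  have "(\<lambda>k. \<integral>\<^sup>+ z. small k z \<partial>\<mu>) \<longlonglongrightarrow> (\<integral>\<^sup>+ z. 0 \<partial>\<mu>)"
  proof (rule nn_integral_dominated_convergence[where w = "\<lambda>_. ennreal (\<Psi>2 (4 ^ k0 / \<epsilon>'))"])
    show "AE z in \<mu>. small k z \<le> ennreal (\<Psi>2 (4 ^ k0 / \<epsilon>'))" for k
      using \<epsilon>' by (intro AE_I2) (auto simp: small_def intro!: ennreal_leI orlicz_mono[OF orl2] divide_right_mono)
    show "(\<integral>\<^sup>+ z. ennreal (\<Psi>2 (4 ^ k0 / \<epsilon>')) \<partial>\<mu>) < \<infinity>"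
      by (simp add: emeasure_eq_measure ennreal_mult_less_top)
    show "AE z in \<mu>. (\<lambda>k. small k z) \<longlonglongrightarrow> 0"
    proof (rule AE_I2)
      fix z
      have "(\<lambda>k. disc_part (G k) z) \<longlonglongrightarrow> 0"
        using tendsto_divide[OF lim[of z] tendsto_const[of "16::complex"]]
        by (cases "cmod z < 1") (simp_all add: disc_part_def G_def)
      from tendsto_min[OF tendsto_norm[OF this] tendsto_const[of "4 ^ k0"]]
      have "(\<lambda>k. min (cmod (disc_part (G k) z)) (4 ^ k0) / \<epsilon>') \<longlonglongrightarrow> 0 / \<epsilon>'"
        by (intro tendsto_divide tendsto_const) (use \<epsilon>' in auto)
      then have "(\<lambda>k. \<Psi>2 (min (cmod (disc_part (G k) z)) (4 ^ k0) / \<epsilon>')) \<longlonglongrightarrow> \<Psi>2 0"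
        using \<epsilon>' by (intro continuous_on_tendsto_compose[OF orlicz_continuous[OF orl2]]) auto
      from tendsto_ennrealI[OF this] show "(\<lambda>k. small k z) \<longlonglongrightarrow> 0"
        by (simp add: small_def orlicz_zero[OF orl2])
    qed
  qed simp_all
  then have "(\<lambda>k. \<integral>\<^sup>+ z. small k z \<partial>\<mu>) \<longlonglongrightarrow> 0" by simp
  moreover have "0 < ennreal (1 / 2)" by (rule ennreal_less_zero_iff[THEN iffD2]) simp
  ultimately have "eventually (\<lambda>k. (\<integral>\<^sup>+ z. small k z \<partial>\<mu>) < ennreal (1 / 2)) sequentially"
    by (rule order_tendstoD(2))
  then show ?thesis
  proof eventually_elim
    case (elim k)
    have "(\<integral>\<^sup>+ z. ennreal (\<Psi>2 (cmod (disc_part (d k) z) / \<epsilon>)) \<partial>\<mu>)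
      \<le> (\<integral>\<^sup>+ z. (if 4 ^ k0 < cmod (disc_part (G k) z) then ennreal (\<Psi>2 (cmod (disc_part (G k) z) / \<epsilon>')) else 0)
        + small k z \<partial>\<mu>)"
      by (intro nn_integral_mono) (auto simp: nD not_less small_def min_absorb1)
    also have "\<dots> = (\<integral>\<^sup>+ z. (if 4 ^ k0 < cmod (disc_part (G k) z) then ennreal (\<Psi>2 (cmod (disc_part (G k) z) / \<epsilon>')) else 0) \<partial>\<mu>)
        + (\<integral>\<^sup>+ z. small k z \<partial>\<mu>)"
      by (intro nn_integral_add) auto
    also have "\<dots> \<le> ennreal (2 * (1 / 4)) + ennreal (1 / 2)"
      by (intro add_mono k0 Gh less_imp_le[OF elim]) (use mod in \<open>simp add: G_def norm_divide\<close>)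
    also have "\<dots> = 1" by (subst ennreal_plus[symmetric]) auto
    finally show ?case .
  qed
qed

text \<open>The limit in the Orlicz space is \<open>disc_part g\<close> for the Montel limit g,
  whose slices inherit the modular bound by Fatou's lemma. The differences from g then form a
  sequence with a uniform modular bound that tends to 0 pointwise.\<close>

lemma compact_embedding_of_K_smallo:
  assumes nul: "emeasure \<mu> (sphere 0 1) = 0"
  shows "compact_embedding \<Psi>1 \<Psi>2 \<mu>"
  unfolding compact_embedding_def
proof (intro conjI ballI allI impI)
  fix f assume "f \<in> hardy_orlicz \<Psi>1"
  then show "boundary_ext f \<in> orlicz_space \<Psi>2 \<mu>" by (rule boundary_ext_orlicz_space[OF nul])
next
  fix F :: "nat \<Rightarrow> complex \<Rightarrow> complex"
  assume F: "\<forall>n. F n \<in> hardy_orlicz \<Psi>1 \<and> hardy_norm \<Psi>1 (F n) \<le> 1"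
  \<comment> \<open>The constant is 2 because a norm at most 1 controls the modular only at
    constants strictly above 1.\<close>
  define \<H> where "\<H> = {f. f holomorphic_on ball 0 1 \<and>
    (\<forall>r. 0 \<le> r \<longrightarrow> r < 1 \<longrightarrow> integral {0..2 * pi} (\<lambda>t. \<Psi>1 (cmod (f (of_real r * cis t)) / 2)) \<le> 2 * pi)}"
  have FH: "F n \<in> \<H>" for n
  proof -
    have "hardy_norm \<Psi>1 (F n) < 2" using F by (metis le_less_trans one_less_numeral_iff semiring_norm(76))
    then show ?thesis using F hardy_modular_le[OF orl1, of "F n" 2] by (auto simp: \<H>_def hardy_orlicz_def)
  qed
  have bdd: "\<exists>B. \<forall>h\<in>\<H>. \<forall>z\<in>K. cmod (h z) \<le> B" if K: "compact K" "K \<subseteq> ball 0 1" for K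
  proof -
    obtain B where "\<And>f z. f holomorphic_on ball 0 1 \<Longrightarrow>
      (\<And>r. 0 \<le> r \<Longrightarrow> r < 1 \<Longrightarrow> integral {0..2 * pi} (\<lambda>t. \<Psi>1 (cmod (f (of_real r * cis t)) / 2)) \<le> 2 * pi) \<Longrightarrow>
      z \<in> K \<Longrightarrow> cmod (f z) \<le> B"
      using locally_bounded_of_modular[OF orl1 K] by blast
    then show ?thesis by (intro exI[of _ B]) (auto simp: \<H>_def)
  qed
  obtain g s where g: "g holomorphic_on ball 0 1" and s: "strict_mono (s :: nat \<Rightarrow> nat)"
    and lim: "\<And>z. z \<in> ball 0 1 \<Longrightarrow> (\<lambda>n. F (s n) z) \<longlonglongrightarrow> g z"
    by (rule Montel[of "ball 0 1" \<H> F]) (use FH bdd in \<open>auto simp: \<H>_def\<close>)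
  have slice: "continuous_on UNIV (\<lambda>t. \<Psi>1 (cmod (f (of_real r * cis t)) / C))"
    if "f holomorphic_on ball 0 1" "0 \<le> r" "r < 1" "0 < C" for f r C
    by (intro continuous_on_orlicz[OF orl1] continuous_intros hardy_slice_continuous that) (use that in auto)
  have Fh: "F n holomorphic_on ball 0 1"
    and Fm: "0 \<le> r \<Longrightarrow> r < 1 \<Longrightarrow> integral {0..2 * pi} (\<lambda>t. \<Psi>1 (cmod (F n (of_real r * cis t)) / 2)) \<le> 2 * pi" for n r
    using FH[of n] by (auto simp: \<H>_def)
  have gm: "integral {0..2 * pi} (\<lambda>t. \<Psi>1 (cmod (g (of_real r * cis t)) / 2)) \<le> 2 * pi" if r: "0 \<le> r" "r < 1" for r
  proof -
    have "(\<integral>\<^sup>+ t. ennreal (\<Psi>1 (cmod (g (of_real r * cis t)) / 2)) \<partial>circle_measure) \<le> 1"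
    proof (rule nn_integral_le_of_liminf)
      fix n
      show "(\<lambda>t. ennreal (\<Psi>1 (cmod (F (s n) (of_real r * cis t)) / 2))) \<in> borel_measurable circle_measure"
        using borel_measurable_continuous_onI[OF slice[OF Fh[of "s n"] r, of 2]]
        by (simp add: circle_measure_def cong: measurable_cong_sets)
      have "(\<integral>\<^sup>+ t. ennreal (\<Psi>1 (cmod (F (s n) (of_real r * cis t)) / 2)) \<partial>circle_measure)
          = ennreal (integral {0..2 * pi} (\<lambda>t. \<Psi>1 (cmod (F (s n) (of_real r * cis t)) / 2)) / (2 * pi))"
        by (intro nn_integral_circle_measure slice Fh r orlicz_nonneg[OF orl1]) auto
      also have "\<dots> \<le> 1" using Fm[OF r, of "s n"] by simp
      finally show "(\<integral>\<^sup>+ t. ennreal (\<Psi>1 (cmod (F (s n) (of_real r * cis t)) / 2)) \<partial>circle_measure) \<le> 1" .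
    next
      fix t
      have "of_real r * cis t \<in> ball 0 1" using r by (simp add: norm_mult)
      from tendsto_divide[OF tendsto_norm[OF lim[OF this]] tendsto_const[of 2]]
      have "(\<lambda>n. \<Psi>1 (cmod (F (s n) (of_real r * cis t)) / 2)) \<longlonglongrightarrow> \<Psi>1 (cmod (g (of_real r * cis t)) / 2)"
        by (intro continuous_on_tendsto_compose[OF orlicz_continuous[OF orl1]]) auto
      from lim_imp_Liminf[OF _ tendsto_ennrealI[OF this]]
      show "ennreal (\<Psi>1 (cmod (g (of_real r * cis t)) / 2)) \<le> liminf (\<lambda>n. ennreal (\<Psi>1 (cmod (F (s n) (of_real r * cis t)) / 2)))"
        by simp
    qed
    moreover have "(\<integral>\<^sup>+ t. ennreal (\<Psi>1 (cmod (g (of_real r * cis t)) / 2)) \<partial>circle_measure)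
          = ennreal (integral {0..2 * pi} (\<lambda>t. \<Psi>1 (cmod (g (of_real r * cis t)) / 2)) / (2 * pi))"
      by (intro nn_integral_circle_measure slice g r orlicz_nonneg[OF orl1]) auto
    ultimately show ?thesis by (simp add: field_simps)
  qed
  define d where "d = (\<lambda>k z. F (s k) z - g z)"
  have dh: "d k holomorphic_on ball 0 1" for k unfolding d_def by (intro holomorphic_intros Fh g)
  \<comment> \<open>4 = 2 * 2: midpoint convexity, applied to two functions controlled at the
    constant 2.\<close>
  have dm: "integral {0..2 * pi} (\<lambda>t. \<Psi>1 (cmod (d k (of_real r * cis t)) / 4)) \<le> 2 * pi" if r: "0 \<le> r" "r < 1" for k r
  proof -
    let ?f = "\<lambda>t. \<Psi>1 (cmod (F (s k) (of_real r * cis t)) / 2)" and ?g = "\<lambda>t. \<Psi>1 (cmod (g (of_real r * cis t)) / 2)"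
    have i: "?f integrable_on {0..2 * pi}" "?g integrable_on {0..2 * pi}"
      "(\<lambda>t. \<Psi>1 (cmod (d k (of_real r * cis t)) / 4)) integrable_on {0..2 * pi}"
      by (intro integrable_continuous_real continuous_on_subset[OF slice] Fh g dh r; simp)+
    have "integral {0..2 * pi} (\<lambda>t. \<Psi>1 (cmod (d k (of_real r * cis t)) / 4)) \<le> integral {0..2 * pi} (\<lambda>t. (?f t + ?g t) / 2)"
    proof (rule integral_le)
      fix t
      have "\<Psi>1 (cmod (d k (of_real r * cis t)) / 4)
          \<le> \<Psi>1 ((cmod (F (s k) (of_real r * cis t)) / 2 + cmod (g (of_real r * cis t)) / 2) / 2)"
        using norm_triangle_ineq4[of "F (s k) (of_real r * cis t)" "g (of_real r * cis t)"]
        by (intro orlicz_mono[OF orl1]) (auto simp: d_def)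
      also have "\<dots> \<le> (?f t + ?g t) / 2" by (intro orlicz_midpoint[OF orl1]) auto
      finally show "\<Psi>1 (cmod (d k (of_real r * cis t)) / 4) \<le> (?f t + ?g t) / 2" .
    qed (use i in \<open>auto intro!: integrable_add\<close>)
    also have "\<dots> = (integral {0..2 * pi} ?f + integral {0..2 * pi} ?g) / 2"
      using i by (simp add: integral_add)
    also have "\<dots> \<le> 2 * pi" using Fm[OF r, of "s k"] gm[OF r] by simp
    finally show ?thesis .
  qed
  have dlim: "(\<lambda>k. d k z) \<longlonglongrightarrow> 0" if "cmod z < 1" for z
    using tendsto_diff[OF lim[of z] tendsto_const[of "g z"]] that by (simp add: d_def)
  have gL: "disc_part g \<in> orlicz_space \<Psi>2 \<mu>" by (rule disc_part_orlicz_space[OF g, of 2]) (use gm in auto)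
  have bL: "boundary_ext (F n) \<in> orlicz_space \<Psi>2 \<mu>" for n
    using F by (intro boundary_ext_orlicz_space nul) auto
  have "(\<lambda>k. lux_norm \<Psi>2 \<mu> (\<lambda>z. boundary_ext (F (s k)) z - disc_part g z)) \<longlonglongrightarrow> 0"
  proof (rule tendstoI)
    fix e :: real assume e: "0 < e"
    have "eventually (\<lambda>k. (\<integral>\<^sup>+ z. ennreal (\<Psi>2 (cmod (disc_part (d k) z) / (e / 2))) \<partial>\<mu>) \<le> 1) sequentially"
      by (rule tendsto_lux_norm_of_pointwise[OF dh dm dlim]) (use e in auto)
    then show "eventually (\<lambda>k. dist (lux_norm \<Psi>2 \<mu> (\<lambda>z. boundary_ext (F (s k)) z - disc_part g z)) 0 < e) sequentially"
    proof eventually_elim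
      case (elim k)
      have "(\<integral>\<^sup>+ z. ennreal (\<Psi>2 (cmod (boundary_ext (F (s k)) z - disc_part g z) / (e / 2))) \<partial>\<mu>)
          = (\<integral>\<^sup>+ z. ennreal (\<Psi>2 (cmod (disc_part (d k) z) / (e / 2))) \<partial>\<mu>)"
      proof (rule nn_integral_cong_AE)
        show "AE z in \<mu>. ennreal (\<Psi>2 (cmod (boundary_ext (F (s k)) z - disc_part g z) / (e / 2)))
            = ennreal (\<Psi>2 (cmod (disc_part (d k) z) / (e / 2)))"
          using AE_boundary_ext_eq_disc_part[OF nul, of "F (s k)"]
          by eventually_elim (simp add: disc_part_def d_def)
      qed
      with elim have "lux_norm \<Psi>2 \<mu> (\<lambda>z. boundary_ext (F (s k)) z - disc_part g z) \<le> e / 2"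
        using e by (intro lux_norm_le[OF orl2]) auto
      moreover have "0 \<le> lux_norm \<Psi>2 \<mu> (\<lambda>z. boundary_ext (F (s k)) z - disc_part g z)"
        by (intro lux_norm_nonneg[OF orl2] orlicz_space_diff[OF orl2] bL gL)
      ultimately show ?case using e by simp
    qed
  qed
  with s gL show "\<exists>s g. strict_mono s \<and> g \<in> orlicz_space \<Psi>2 \<mu> \<and>
      (\<lambda>k. lux_norm \<Psi>2 \<mu> (\<lambda>z. boundary_ext (F (s k)) z - g z)) \<longlonglongrightarrow> 0" by blast
qed

end

theorem mainTheorem11:
  fixes \<mu> :: "complex measure" and \<Psi>1 \<Psi>2 :: "real \<Rightarrow> real"
  assumes mu_borel: "sets \<mu> = sets (restrict_space borel (cball (0::complex) 1))"
    and mu_finite: "finite_measure \<mu>"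
    and orl1: "orlicz_function \<Psi>1"
    and orl2: "orlicz_function \<Psi>2"
  shows
    "(compact_embedding \<Psi>1 \<Psi>2 \<mu> \<longrightarrow>
        (\<forall>A>0. rho_mu \<mu> \<in> o[at_right 0](\<lambda>h. 1 / \<Psi>2 (A * orlicz_inv \<Psi>1 (1 / h)))))
   \<and> ((emeasure \<mu> (sphere 0 1) = 0 \<and>
        (\<forall>A>0. \<forall>c>0. eventually (\<lambda>h. K_mu \<mu> h \<le>
             ereal (c * ((1 / h) / \<Psi>2 (A * orlicz_inv \<Psi>1 (1 / h))))) (at_right 0)))
       \<longrightarrow> compact_embedding \<Psi>1 \<Psi>2 \<mu>)
   \<and> ((\<Psi>1 = \<Psi>2 \<and> nabla0 \<Psi>1) \<longrightarrow>
        ((compact_embedding \<Psi>1 \<Psi>1 \<mu> \<longleftrightarrow>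
            (\<forall>A>0. rho_mu \<mu> \<in> o[at_right 0](\<lambda>h. 1 / \<Psi>1 (A * orlicz_inv \<Psi>1 (1 / h)))))
       \<and> (compact_embedding \<Psi>1 \<Psi>1 \<mu> \<longleftrightarrow>
            (\<forall>A>0. \<forall>c>0. eventually (\<lambda>h. K_mu \<mu> h \<le>
             ereal (c * ((1 / h) / \<Psi>1 (A * orlicz_inv \<Psi>1 (1 / h))))) (at_right 0)))))"
proof -
  note mu = mu_borel mu_finite
  let ?rho = "\<lambda>\<Psi>. \<forall>A>0. rho_mu \<mu> \<in> o[at_right 0](\<lambda>h. 1 / \<Psi> (A * orlicz_inv \<Psi>1 (1 / h)))"
  let ?K = "\<lambda>\<Psi>. \<forall>A>0. \<forall>c>0. eventually (\<lambda>h. K_mu \<mu> h \<le>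
             ereal (c * ((1 / h) / \<Psi> (A * orlicz_inv \<Psi>1 (1 / h))))) (at_right 0)"
  \<comment> \<open>A generic target function lets the same fact serve \<Psi>2 in the first claim
    and \<Psi>1 in the third.\<close>
  have rho: "?rho \<Psi>" if "orlicz_function \<Psi>" "compact_embedding \<Psi>1 \<Psi> \<mu>" for \<Psi>
    using rho_smallo_of_compact_embedding[OF mu orl1 that] by blast
  have compact: "compact_embedding \<Psi>1 \<Psi> \<mu>"
    if "orlicz_function \<Psi>" "emeasure \<mu> (sphere 0 1) = 0" "?K \<Psi>" for \<Psi>
    by (rule compact_embedding_of_K_smallo[OF mu orl1 that(1) _ that(2)]) (use that(3) in blast)
  have "?rho \<Psi>1" if K: "?K \<Psi>1"
    using rho_smallo_of_K_smallo[OF mu orl1 orl1] K by blast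
  moreover have "?K \<Psi>1" if "nabla0 \<Psi>1" "?rho \<Psi>1"
    using K_smallo_of_rho_smallo[OF mu orl1 that(1)] that(2) by blast
  \<comment> \<open>The third claim does not assume a null circle. For A = 1 the comparison function
    is h itself, so the window bound forces nullity and the sufficiency part becomes
    applicable.\<close>
  moreover have "emeasure \<mu> (sphere 0 1) = 0" if r: "?rho \<Psi>1"
  proof (rule sphere_null_of_rho_smallo[OF mu])
    have "eventually (\<lambda>h. 1 / \<Psi>1 (1 * orlicz_inv \<Psi>1 (1 / h)) = h) (at_right 0)"
      using eventually_at_right_less[of "0::real"]
      by eventually_elim (simp add: orlicz_orlicz_inv[OF orl1])
    from landau_o.small.cong[OF this] r show "rho_mu \<mu> \<in> o[at_right 0](\<lambda>h. h)"
      by (metis zero_less_one)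
  qed
  ultimately show ?thesis using rho compact orl1 orl2 by blast
qed

end
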